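(* Let $R(z)\in\mathbb{C}(z)^{m\times m}$ be a para-Hermitian rational matrix having no poles on the unit circle, written (uniquely) as $$R(z)=R_{in}(z)+R_{out}(z)+R_0,$$ where $R_{in}(z)$ is strictly proper with all its poles in the open unit disk, $R_{out}(z)$ satisfies $R_{out}(0)=0$ and has all its poles (infinity included) strictly outside the unit circle, and $R_0$ is constant, so that $R_{in}^*(z)=R_{out}(1/z)$ and $R_0^*=R_0$. Let $R_{in}(z)=R_{-1}z^{-1}+R_{-2}z^{-2}+R_{-3}z^{-3}+\cdots$ be the Taylor expansion of $R_{in}$ around infinity, and let $H,H_\sigma,U_1,V_1,U_{11},V_{11},\widehat H$ be the matrices built from it as described in the context, which give the minimal generalized state-space realization $$R_{in}(z)=U_{11}\widehat H\,(z\widehat H-U_1^*H_\sigma V_1)^{-1}\,\widehat HV_{11}^*.$$ Then $$R_{out}(z)=zV_{11}\widehat H^*\,(\widehat H^*-zV_1^*H_\sigma^*U_1)^{-1}\,\widehat H^*U_{11}^*$$ is a minimal generalized state-space realization of $R_{out}(z)$, and the following pencil $L(z)$ is a strongly minimal $*$-palindromic linear system matrix of $(1+z)R(z)$ (i.e., one with transfer function $(1+z)R(z)$): $$L(z)=\left[\begin{array}{cc|c}0&U_1^*H_\sigma V_1-z\widehat H&\widehat HV_{11}^*\\ zV_1^*H_\sigma^*U_1-\widehat H^*&0&\widehat H^*U_{11}^*(1+z)\\ \hline zV_{11}\widehat H^*&U_{11}\widehat H(1+z)&R_0(1+z)\end{array}\right].$$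
   Context: For a rational matrix $R(t)$ with complex coefficients, $R^*(t):=[R(\overline{t})]^*$ (the coefficients are conjugate-transposed, the variable is not conjugated). A square rational matrix $R(z)$ is para-Hermitian if $R^*(z)=R(1/z)$. For constant matrices $^*$ is the conjugate transpose. Strictly proper means tending to $0$ as $z\to\infty$. Hankel matrices. Given the expansion coefficients $R_{-j}\in\mathbb{C}^{m\times m}$ ($j\ge1$) of $R_{in}$ and a positive integer $k$, $H$ is the $km\times km$ block matrix whose $(i,j)$ block is $R_{-(i+j-1)}$ and $H_\sigma$ is the $km\times km$ block matrix whose $(i,j)$ block is $R_{-(i+j)}$, $1\le i,j\le k$. The integer $k$ is taken sufficiently large that $r_f:=\mathrm{rank}\,H$ equals the total polar degree of $R_{in}(z)$ (the sum of the degrees of the denominators in its Smith–McMillan form). Let $U=[U_1\ U_2]$ and $V=[V_1\ V_2]$ be unitary matrices with $U^*HV=\begin{bmatrix}\widehat H&0\\0&0\end{bmatrix}$, where $\widehat H=U_1^*HV_1$ is $r_f\times r_f$ and invertible. $U_{11}$ and $V_{11}$ are the $m\times r_f$ matrices formed by the first $m$ rows of $U_1$ and of $V_1$, respectively. A pencil is a polynomial matrix of the form $L(z)=zL_1+L_0$. With $\mathrm{rev}_1 G(z):=zG(1/z)$, a square pencil $L(z)$ is $*$-palindromic if $\mathrm{rev}_1L^*(z)=L(z)$. A linear system matrix is a block-partitioned complex pencil $$L(z)=\begin{bmatrix}-A(z)&B(z)\\ C(z)&D(z)\end{bmatrix}=\begin{bmatrix}-zA_1+A_0& zB_1-B_0\\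 zC_1-C_0& zD_1-D_0\end{bmatrix}$$ with $A(z)$ a square regular pencil ($\det A(z)\not\equiv0$; possibly of size $0$). Its transfer function is $D(z)+C(z)A(z)^{-1}B(z)$. It is minimal if $\begin{bmatrix}-A(z_0)&B(z_0)\end{bmatrix}$ has full row rank and $\begin{bmatrix}-A(z_0)\\ C(z_0)\end{bmatrix}$ has full column rank for all $z_0\in\mathbb{C}$; minimal at $\infty$ if $\begin{bmatrix}-A_1&B_1\end{bmatrix}$ has full row rank and $\begin{bmatrix}-A_1\\ C_1\end{bmatrix}$ has full column rank; strongly minimal if both hold. In the pencil $L(z)$ of the claim the partition lines indicate the blocks: the top-left block is $-A(z)$. An expression $C(z)A(z)^{-1}B(z)$ with pencils $A,B,C$ ($A$ regular) is called a minimal generalized state-space realization of its value if the linear system matrix $\begin{bmatrix}-A(z)&B(z)\\ C(z)&0\end{bmatrix}$ is minimal. For $R_{out}$ this is applied with $A(z)=\widehat H^*-zV_1^*H_\sigma^*U_1$, $B=\widehat H^*U_{11}^*$, $C(z)=zV_{11}\widehat H^*$. *)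

theory Defs
  imports
    "HOL-Computational_Algebra.Field_as_Ring"
    "HOL-Computational_Algebra.Polynomial_Factorial"
    "Jordan_Normal_Form.Schur_Decomposition"
    "Jordan_Normal_Form.Gauss_Jordan_Elimination"
    "Jordan_Normal_Form.DL_Rank"
begin

section \<open>Rational functions and rational matrices\<close>

text \<open>
  The field \<open>\<complex>(z)\<close> is \<^typ>\<open>complex poly fract\<close>. The numerator and denominator below are
  those of the reduced fraction (coprime, monic denominator), so a pole is a root of the
  denominator.
\<close>

type_synonym ratfun = "complex poly fract"

definition rat_num :: "ratfun \<Rightarrow> complex poly" where
  "rat_num r = fst (quot_of_fract r)"

definition rat_den :: "ratfun \<Rightarrow> complex poly" where
  "rat_den r = snd (quot_of_fract r)"

text \<open>Meaningful only where \<open>r\<close> has no pole (elsewhere it is \<open>0\<close>, by division by zero).\<close>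

definition rat_eval :: "ratfun \<Rightarrow> complex \<Rightarrow> complex" where
  "rat_eval r x = poly (rat_num r) x / poly (rat_den r) x"

definition rat_const :: "complex \<Rightarrow> ratfun" where
  "rat_const c = to_fract [:c:]"

definition rat_z :: ratfun where
  "rat_z = to_fract [:0, 1:]"

text \<open>\<open>r(1/z)\<close>, again an element of \<open>\<complex>(z)\<close>.\<close>

definition rat_recip :: "ratfun \<Rightarrow> ratfun" where
  "rat_recip r =
     poly (map_poly rat_const (rat_num r)) (1 / rat_z) /
     poly (map_poly rat_const (rat_den r)) (1 / rat_z)"

text \<open>Conjugation of the coefficients; the variable is not conjugated.\<close>

definition rat_cnj :: "ratfun \<Rightarrow> ratfun" where
  "rat_cnj r = to_fract (map_poly cnj (rat_num r)) / to_fract (map_poly cnj (rat_den r))"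

definition rmat_const :: "complex mat \<Rightarrow> ratfun mat" where
  "rmat_const M = map_mat rat_const M"

definition rmat_poly :: "complex poly mat \<Rightarrow> ratfun mat" where
  "rmat_poly P = map_mat to_fract P"

definition rmat_recip :: "ratfun mat \<Rightarrow> ratfun mat" where
  "rmat_recip G = map_mat rat_recip G"

definition rmat_star :: "ratfun mat \<Rightarrow> ratfun mat" where
  "rmat_star G = map_mat rat_cnj (transpose_mat G)"

definition rmat_eval :: "ratfun mat \<Rightarrow> complex \<Rightarrow> complex mat" where
  "rmat_eval G x = map_mat (\<lambda>r. rat_eval r x) G"

definition rmat_inverse :: "ratfun mat \<Rightarrow> ratfun mat" where
  "rmat_inverse G = the (mat_inverse G)"

definition para_hermitian :: "ratfun mat \<Rightarrow> bool" where
  "para_hermitian G \<longleftrightarrow> square_mat G \<and> rmat_star G = rmat_recip G"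

definition has_pole :: "ratfun mat \<Rightarrow> complex \<Rightarrow> bool" where
  "has_pole G x \<longleftrightarrow>
     (\<exists>i<dim_row G. \<exists>j<dim_col G. poly (rat_den (G $$ (i, j))) x = 0)"

definition strictly_proper :: "ratfun mat \<Rightarrow> bool" where
  "strictly_proper G \<longleftrightarrow>
     (\<forall>i<dim_row G. \<forall>j<dim_col G. (rat_eval (G $$ (i, j)) \<longlongrightarrow> 0) at_infinity)"

text \<open>\<open>G(z) = c 1 z\<^sup>-\<^sup>1 + c 2 z\<^sup>-\<^sup>2 + \<dots>\<close> near infinity; the value \<open>c 0\<close> is irrelevant.\<close>

definition expansion_at_infinity :: "ratfun mat \<Rightarrow> (nat \<Rightarrow> complex mat) \<Rightarrow> bool" where
  "expansion_at_infinity G c \<longleftrightarrow>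
     (\<forall>l\<ge>1. c l \<in> carrier_mat (dim_row G) (dim_col G)) \<and>
     (\<forall>i<dim_row G. \<forall>j<dim_col G. \<forall>\<^sub>F z in at_infinity.
        (\<lambda>l. c (Suc l) $$ (i, j) / z ^ Suc l) sums rat_eval (G $$ (i, j)) z)"


section \<open>Smith--McMillan form and polar degree\<close>

definition unimodular :: "nat \<Rightarrow> complex poly mat \<Rightarrow> bool" where
  "unimodular n P \<longleftrightarrow> P \<in> carrier_mat n n \<and> is_unit (det P)"

text \<open>The form is \<open>diag (e 0 / f 0, \<dots>, e (r-1) / f (r-1), 0, \<dots>, 0)\<close>.\<close>

definition smith_mcmillan_form ::
  "ratfun mat \<Rightarrow> nat \<Rightarrow> (nat \<Rightarrow> complex poly) \<Rightarrow> (nat \<Rightarrow> complex poly) \<Rightarrow> bool" where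
  "smith_mcmillan_form G r e f \<longleftrightarrow>
     r \<le> min (dim_row G) (dim_col G) \<and>
     (\<forall>i<r. lead_coeff (e i) = 1 \<and> lead_coeff (f i) = 1 \<and> coprime (e i) (f i)) \<and>
     (\<forall>i. Suc i < r \<longrightarrow> e i dvd e (Suc i) \<and> f (Suc i) dvd f i) \<and>
     (\<exists>P Q. unimodular (dim_row G) P \<and> unimodular (dim_col G) Q \<and>
        G = rmat_poly P *
            mat (dim_row G) (dim_col G)
              (\<lambda>(i, j). if i = j \<and> i < r then to_fract (e i) / to_fract (f i) else 0) *
            rmat_poly Q)"

definition has_total_polar_degree :: "ratfun mat \<Rightarrow> nat \<Rightarrow> bool" where
  "has_total_polar_degree G d \<longleftrightarrow>
     (\<exists>r e f. smith_mcmillan_form G r e f \<and> d = (\<Sum>i<r. degree (f i)))"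


section \<open>Constant matrices\<close>

definition mat_rank :: "complex mat \<Rightarrow> nat" where
  "mat_rank M = vec_space.rank (dim_row M) M"

definition full_row_rank :: "complex mat \<Rightarrow> bool" where
  "full_row_rank M \<longleftrightarrow> mat_rank M = dim_row M"

definition full_col_rank :: "complex mat \<Rightarrow> bool" where
  "full_col_rank M \<longleftrightarrow> mat_rank M = dim_col M"

definition unitary_mat :: "complex mat \<Rightarrow> bool" where
  "unitary_mat U \<longleftrightarrow> square_mat U \<and> inverts_mat U (mat_adjoint U) \<and> inverts_mat (mat_adjoint U) U"

definition append_cols :: "'a :: zero mat \<Rightarrow> 'a mat \<Rightarrow> 'a mat" (infixr "@\<^sub>c" 65) where
  "A @\<^sub>c B = four_block_mat A B (0\<^sub>m 0 (dim_col A)) (0\<^sub>m 0 (dim_col B))"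

definition first_rows :: "nat \<Rightarrow> 'a mat \<Rightarrow> 'a mat" where
  "first_rows m M = mat m (dim_col M) (\<lambda>(i, j). M $$ (i, j))"

text \<open>
  \<open>k \<times> k\<close> blocks of size \<open>m \<times> m\<close>. Blocks are numbered from \<open>0\<close> here, so with one-based block
  indices the \<open>(i, j)\<close> block is \<open>c (i + j - 1 + s)\<close>: the shift \<open>s = 0\<close> gives \<open>H\<close> and \<open>s = 1\<close>
  gives \<open>H\<^sub>\<sigma>\<close> when \<open>c j = R\<^sub>-\<^sub>j\<close>.
\<close>

definition block_hankel :: "nat \<Rightarrow> nat \<Rightarrow> nat \<Rightarrow> (nat \<Rightarrow> complex mat) \<Rightarrow> complex mat" where
  "block_hankel m k s c =
     mat (k * m) (k * m) (\<lambda>(i, j). c (i div m + j div m + 1 + s) $$ (i mod m, j mod m))"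


section \<open>Pencils and linear system matrices\<close>

definition pmat_const :: "complex mat \<Rightarrow> complex poly mat" where
  "pmat_const M = map_mat (\<lambda>c. [:c:]) M"

definition pmat_eval :: "complex poly mat \<Rightarrow> complex \<Rightarrow> complex mat" where
  "pmat_eval P x = map_mat (\<lambda>p. poly p x) P"

definition pmat_coeff :: "complex poly mat \<Rightarrow> nat \<Rightarrow> complex mat" where
  "pmat_coeff P l = map_mat (\<lambda>p. coeff p l) P"

definition is_pencil :: "complex poly mat \<Rightarrow> bool" where
  "is_pencil P \<longleftrightarrow>
     (\<exists>L1 \<in> carrier_mat (dim_row P) (dim_col P). \<exists>L0 \<in> carrier_mat (dim_row P) (dim_col P).
        P = [:0, 1:] \<cdot>\<^sub>m pmat_const L1 + pmat_const L0)"

definition rev1 :: "ratfun mat \<Rightarrow> ratfun mat" where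
  "rev1 G = rat_z \<cdot>\<^sub>m rmat_recip G"

definition star_palindromic :: "complex poly mat \<Rightarrow> bool" where
  "star_palindromic P \<longleftrightarrow>
     is_pencil P \<and> square_mat P \<and> rev1 (rmat_star (rmat_poly P)) = rmat_poly P"

definition linear_system_matrix ::
  "complex poly mat \<Rightarrow> complex poly mat \<Rightarrow> complex poly mat \<Rightarrow> complex poly mat \<Rightarrow>
   complex poly mat \<Rightarrow> bool" where
  "linear_system_matrix L A B C D \<longleftrightarrow>
     square_mat A \<and> dim_row B = dim_row A \<and> dim_col C = dim_col A \<and>
     dim_row D = dim_row C \<and> dim_col D = dim_col B \<and>
     is_pencil A \<and> is_pencil B \<and> is_pencil C \<and> is_pencil D \<and>
     det A \<noteq> 0 \<and> L = four_block_mat (- A) B C D"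

definition transfer_function ::
  "complex poly mat \<Rightarrow> complex poly mat \<Rightarrow> complex poly mat \<Rightarrow> complex poly mat \<Rightarrow> ratfun mat" where
  "transfer_function A B C D =
     rmat_poly D + rmat_poly C * rmat_inverse (rmat_poly A) * rmat_poly B"

definition minimal_system :: "complex poly mat \<Rightarrow> complex poly mat \<Rightarrow> complex poly mat \<Rightarrow> bool" where
  "minimal_system A B C \<longleftrightarrow>
     (\<forall>x. full_row_rank (- pmat_eval A x @\<^sub>c pmat_eval B x) \<and>
          full_col_rank (- pmat_eval A x @\<^sub>r pmat_eval C x))"

definition minimal_system_at_infinity ::
  "complex poly mat \<Rightarrow> complex poly mat \<Rightarrow> complex poly mat \<Rightarrow> bool" where
  "minimal_system_at_infinity A B C \<longleftrightarrow>
     full_row_rank (- pmat_coeff A 1 @\<^sub>c pmat_coeff B 1) \<and>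
     full_col_rank (- pmat_coeff A 1 @\<^sub>r pmat_coeff C 1)"

definition strongly_minimal_system ::
  "complex poly mat \<Rightarrow> complex poly mat \<Rightarrow> complex poly mat \<Rightarrow> bool" where
  "strongly_minimal_system A B C \<longleftrightarrow> minimal_system A B C \<and> minimal_system_at_infinity A B C"

definition minimal_gss_realization ::
  "complex poly mat \<Rightarrow> complex poly mat \<Rightarrow> complex poly mat \<Rightarrow> ratfun mat \<Rightarrow> bool" where
  "minimal_gss_realization A B C G \<longleftrightarrow>
     (let D = 0\<^sub>m (dim_row C) (dim_col B)
      in linear_system_matrix (four_block_mat (- A) B C D) A B C D) \<and>
     minimal_system A B C \<and>
     G = rmat_poly C * rmat_inverse (rmat_poly A) * rmat_poly B"

end

theory Submission
  imports Defs
begin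

text \<open>
  The Smith--McMillan form turns the polar degree \<open>d\<close> of \<open>R\<^sub>i\<^sub>n\<close> into a state space of dimension
  \<open>d\<close>: there are constant matrices with \<open>R\<^sub>i\<^sub>n = C (z - S)\<^sup>-\<^sup>1 B\<close>, hence \<open>R\<^sub>-\<^sub>j = C S\<^sup>j\<^sup>-\<^sup>1 B\<close>, and the
  Hankel matrices factor as \<open>H = O K\<close> and \<open>H\<^sub>\<sigma> = O S K\<close> through the observability and controllability
  matrices. As \<open>U\<^sub>1\<^sup>* O\<close> and \<open>K V\<^sub>1\<close> are square with invertible product \<open>H\<close>-hat, they are changes of basis that carry
  \<open>(S, B, C)\<close> to the realization in the theorem; they also give \<open>O\<close> a left and \<open>K\<close> a right inverse,
  from which minimality follows, and so does the absence of eigenvalues of the pencil on or outside the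
  unit circle.

  Reversal and conjugate transposition carry this realization to one of \<open>R\<^sub>o\<^sub>u\<^sub>t\<close>, with all its
  eigenvalues outside the closed disk. A null vector of the combined pencil splits into null vectors of the two
  parts, at most one of which is nonzero because the spectra are disjoint; and \<open>-1\<close>, where the
  factor \<open>1 + z\<close> vanishes, belongs to neither spectrum.
\<close>

section \<open>Rational functions\<close>

text \<open>The decisive coincidence is one of dimensions: the compressed Hankel matrix has the size
  of the polar degree, and so has the state space read off from the Smith-McMillan form. Hence the
  two changes of basis are square, and invertibility of their product makes each invertible. Between
  the unimodular factors the input and output matrices are polynomial at first; division by
  \<open>z - S\<close> leaves constant remainders, and strict properness removes the polynomial
  rest.

  Instead of a resolvent, a realization carries a rational matrix \<open>Y\<close> with
  \<open>z Y = S Y + B\<close>; decay at infinity, the Markov parameters and the spread of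
  regularity are all drawn from this relation.

  The factor \<open>1 + z\<close> turns para-Hermitian into palindromic: reversal fixes
  \<open>1 + z\<close>, hence \<open>(1 + z) R\<close>. In the pencil it stands on the input of one
  half and the output of the other, which reversal exchanges; the two remaining places carry
  \<open>1\<close> and \<open>z\<close>, exchanged as well. At infinity the pencil of the inner part
  has an invertible leading coefficient, while for the outer part infinity is the mirror image of
  the point \<open>0\<close> of the inner one.\<close>

lemma rat_den_nonzero [simp]: "rat_den r \<noteq> 0"
  by (simp add: rat_den_def)

lemma rat_num_over_den: "to_fract (rat_num r) / to_fract (rat_den r) = r"
  by (simp add: rat_num_def rat_den_def flip: Fract_conv_to_fract)

lemma coprime_num_den: "coprime (rat_num r) (rat_den r)"
  by (simp add: rat_num_def rat_den_def coprime_quot_of_fract)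

lemma cross_multiply:
  assumes "r = to_fract p / to_fract q" "q \<noteq> 0"
  shows "rat_num r * q = p * rat_den r"
proof -
  have "to_fract (rat_num r) / to_fract (rat_den r) = to_fract p / to_fract q"
    using assms(1) rat_num_over_den by simp
  then have "to_fract (rat_num r * q) = to_fract (p * rat_den r)"
    using assms(2) by (simp add: field_simps)
  then show ?thesis by (simp only: to_fract_eq_iff)
qed

section \<open>Evaluation at points that are not poles\<close>

definition regular_at :: "complex \<Rightarrow> ratfun \<Rightarrow> bool" where
  "regular_at x r \<longleftrightarrow> poly (rat_den r) x \<noteq> 0"

lemma has_pole_iff:
  "has_pole G x \<longleftrightarrow> (\<exists>i<dim_row G. \<exists>j<dim_col G. \<not> regular_at x (G $$ (i, j)))"
  by (simp add: has_pole_def regular_at_def)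

text \<open>The reduced denominator divides every other denominator of the same function. So any
  representation with nonvanishing denominator certifies regularity and yields the value, and sums,
  products and substitutions need not be reduced first.\<close>

lemma fract_at_regular_point:
  assumes "r = to_fract p / to_fract q" "poly q x \<noteq> 0"
  shows "regular_at x r" "rat_eval r x = poly p x / poly q x"
proof -
  have q: "q \<noteq> 0" using assms(2) by auto
  note cm = cross_multiply[OF assms(1) q]
  have "rat_den r dvd rat_num r * q" unfolding cm by simp
  then have "rat_den r dvd q"
    using coprime_num_den[of r] by (simp add: coprime_commute coprime_dvd_mult_right_iff)
  then show d: "regular_at x r"
    unfolding regular_at_def using assms(2) by (auto simp: dvd_def)
  have "poly (rat_num r) x * poly q x = poly p x * poly (rat_den r) x"
    using arg_cong[OF cm, of "\<lambda>p. poly p x"] by simp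
  then show "rat_eval r x = poly p x / poly q x"
    using d assms(2) unfolding regular_at_def rat_eval_def by (simp add: field_simps)
qed

lemma regular_at_rep:
  assumes "regular_at x r"
  obtains p q where "r = to_fract p / to_fract q" "poly q x \<noteq> 0" "rat_eval r x = poly p x / poly q x"
  using assms that[of "rat_num r" "rat_den r"]
  by (simp add: regular_at_def rat_eval_def rat_num_over_den)

lemma to_fract_at:
  "regular_at x (to_fract p)" "rat_eval (to_fract p) x = poly p x"
  using fract_at_regular_point[of "to_fract p" p 1 x] by simp_all

lemma const_at [simp]:
  "regular_at x (rat_const c)" "rat_eval (rat_const c) x = c"
  using to_fract_at[where x=x and p="[:c:]"] by (simp_all add: rat_const_def)

lemma rat_z_at [simp]:
  "regular_at x rat_z" "rat_eval rat_z x = x"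
  using to_fract_at[where x=x and p="[:0, 1:]"] by (simp_all add: rat_z_def)

lemma zero_at [simp]: "regular_at x 0" "rat_eval 0 x = 0"
  using to_fract_at[where x=x and p=0] by simp_all

lemma one_at [simp]: "regular_at x 1" "rat_eval 1 x = 1"
  using to_fract_at[where x=x and p=1] by simp_all

lemma add_at [simp]:
  assumes "regular_at x r" "regular_at x s"
  shows "regular_at x (r + s)" "rat_eval (r + s) x = rat_eval r x + rat_eval s x"
proof -
  obtain p q where 1: "r = to_fract p / to_fract q" "poly q x \<noteq> 0" "rat_eval r x = poly p x / poly q x"
    using assms(1) by (rule regular_at_rep)
  obtain p' q' where 2: "s = to_fract p' / to_fract q'" "poly q' x \<noteq> 0" "rat_eval s x = poly p' x / poly q' x"
    using assms(2) by (rule regular_at_rep)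
  have nz: "q \<noteq> 0" "q' \<noteq> 0" using 1 2 by auto
  have e: "r + s = to_fract (p * q' + p' * q) / to_fract (q * q')"
    using nz by (simp add: 1(1) 2(1) field_simps)
  have "poly (q * q') x \<noteq> 0" using 1 2 by simp
  from fract_at_regular_point[OF e this]
  show "regular_at x (r + s)" "rat_eval (r + s) x = rat_eval r x + rat_eval s x"
    using 1(2,3) 2(2,3) by (simp_all add: add_frac_eq)
qed

lemma mult_at [simp]:
  assumes "regular_at x r" "regular_at x s"
  shows "regular_at x (r * s)" "rat_eval (r * s) x = rat_eval r x * rat_eval s x"
proof -
  obtain p q where 1: "r = to_fract p / to_fract q" "poly q x \<noteq> 0" "rat_eval r x = poly p x / poly q x"
    using assms(1) by (rule regular_at_rep)
  obtain p' q' where 2: "s = to_fract p' / to_fract q'" "poly q' x \<noteq> 0" "rat_eval s x = poly p' x / poly q' x"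
    using assms(2) by (rule regular_at_rep)
  have e: "r * s = to_fract (p * p') / to_fract (q * q')"
    by (simp add: 1(1) 2(1))
  have "poly (q * q') x \<noteq> 0" using 1 2 by simp
  from fract_at_regular_point[OF e this]
  show "regular_at x (r * s)" "rat_eval (r * s) x = rat_eval r x * rat_eval s x"
    using 1 2 by simp_all
qed

lemma minus_one_at: "regular_at x (-1)" "rat_eval (-1) x = -1"
  using to_fract_at[where x=x and p="-1"] by simp_all

lemma uminus_at [simp]:
  assumes "regular_at x r"
  shows "regular_at x (- r)" "rat_eval (- r) x = - rat_eval r x"
  using mult_at[OF minus_one_at(1) assms] by (simp_all add: minus_one_at)

lemma diff_at [simp]:
  assumes "regular_at x r" "regular_at x s"
  shows "regular_at x (r - s)" "rat_eval (r - s) x = rat_eval r x - rat_eval s x"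
  using add_at[OF assms(1) uminus_at(1)[OF assms(2)]] assms(2) by simp_all

lemma sum_at:
  assumes "\<And>i. i \<in> I \<Longrightarrow> regular_at x (f i)"
  shows "regular_at x (sum f I)" "rat_eval (sum f I) x = (\<Sum>i\<in>I. rat_eval (f i) x)"
proof -
  have "regular_at x (sum f I) \<and> rat_eval (sum f I) x = (\<Sum>i\<in>I. rat_eval (f i) x)"
    using assms by (induction I rule: infinite_finite_induct) auto
  then show "regular_at x (sum f I)" "rat_eval (sum f I) x = (\<Sum>i\<in>I. rat_eval (f i) x)" by auto
qed

lemma finite_singular_points: "finite {x. \<not> regular_at x r}"
  by (simp add: regular_at_def poly_roots_finite)

lemma eventually_regular_at_infinity: "eventually (\<lambda>x. regular_at x r) at_infinity"
proof -
  have "eventually (\<lambda>x. \<forall>y\<in>{x. \<not> regular_at x r}. x \<noteq> y) at_infinity"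
  proof (rule eventually_ball_finite[OF finite_singular_points], intro ballI)
    fix y :: complex
    have "\<forall>x::complex. norm x \<ge> norm y + 1 \<longrightarrow> x \<noteq> y" by auto
    then show "eventually (\<lambda>x. x \<noteq> y) at_infinity" unfolding eventually_at_infinity by blast
  qed
  then show ?thesis by (rule eventually_mono) auto
qed

lemma eventually_regular_at: "eventually (\<lambda>x. regular_at x r) (at a)"
proof -
  have "eventually (\<lambda>x. \<forall>y\<in>{x. \<not> regular_at x r}. x \<noteq> y) (at a)"
    by (rule eventually_ball_finite[OF finite_singular_points]) (auto simp: eventually_neq_at_within)
  then show ?thesis by (rule eventually_mono) auto
qed

section \<open>Field homomorphisms: substitution of \<open>1/z\<close> and conjugation of
  coefficients\<close>

interpretation to_fract_hom: inj_comm_ring_hom to_fract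
  by unfold_locales simp_all

text \<open>The universal property of the fraction field, in the form in which
  \<open>rat_recip\<close> and \<open>rat_cnj\<close> are defined: apply \<open>h\<close> to the
  reduced numerator and denominator. Injectivity keeps the image of a denominator nonzero, and
  \<open>cross_multiply\<close> makes the result independent of the representation.\<close>

lemma field_hom_fract_extension:
  fixes h :: "complex poly \<Rightarrow> 'a :: field"
  assumes "inj_comm_ring_hom h"
  defines "g \<equiv> \<lambda>r. h (rat_num r) / h (rat_den r)"
  shows "q \<noteq> 0 \<Longrightarrow> g (to_fract p / to_fract q) = h p / h q" "field_hom g"
proof -
  interpret inj_comm_ring_hom h by fact
  have *: "g (to_fract p / to_fract q) = h p / h q" if "q \<noteq> 0" for p q
  proof -
    let ?r = "to_fract p / to_fract q"
    have "h (rat_num ?r * q) = h (p * rat_den ?r)"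
      using cross_multiply[OF refl that] by simp
    then have "h (rat_num ?r) * h q = h p * h (rat_den ?r)"
      by (simp add: hom_mult)
    then show ?thesis using that by (simp add: g_def field_simps)
  qed
  then show "q \<noteq> 0 \<Longrightarrow> g (to_fract p / to_fract q) = h p / h q" by simp
  have rep: "\<exists>p q. q \<noteq> 0 \<and> r = to_fract p / to_fract q" for r :: ratfun
    by (metis rat_den_nonzero rat_num_over_den)
  show "field_hom g"
  proof
    show "g 0 = 0" using *[of 1 0] by simp
    show "g 1 = 1" using *[of 1 1] by simp
    fix r s :: ratfun
    obtain p q p' q' where 1: "q \<noteq> 0" "r = to_fract p / to_fract q"
        and 2: "q' \<noteq> 0" "s = to_fract p' / to_fract q'" using rep[of r] rep[of s] by blast
    have m: "r * s = to_fract (p * p') / to_fract (q * q')" by (simp add: 1 2)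
    show "g (r * s) = g r * g s"
      unfolding m using 1 2 *[of "q * q'" "p * p'"] * by (simp add: hom_mult del: to_fract_mult)
    have a: "r + s = to_fract (p * q' + p' * q) / to_fract (q * q')"
      using 1 2 by (simp add: field_simps)
    show "g (r + s) = g r + g s"
      unfolding a using 1 2 *[of "q * q'" "p * q' + p' * q"] *
      by (simp add: hom_add hom_mult add_frac_eq del: to_fract_mult to_fract_add)
  qed
qed

lemma rat_const_hom: "inj_comm_ring_hom rat_const"
  by unfold_locales (simp_all add: rat_const_def flip: to_fract_add to_fract_mult pCons_one to_fract_1)

lemma map_poly_cnj_hom: "inj_comm_ring_hom (\<lambda>p. to_fract (map_poly cnj p))"
proof
  fix x y :: "complex poly"
  have "map_poly cnj (x * y) = map_poly cnj x * map_poly cnj y"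
    by (rule poly_eqI) (simp add: coeff_map_poly coeff_mult)
  then show "to_fract (map_poly cnj (x * y)) = to_fract (map_poly cnj x) * to_fract (map_poly cnj y)"
    by simp
  have "map_poly cnj (x + y) = map_poly cnj x + map_poly cnj y"
    by (rule poly_eqI) (simp add: coeff_map_poly)
  then show "to_fract (map_poly cnj (x + y)) = to_fract (map_poly cnj x) + to_fract (map_poly cnj y)"
    by simp
qed (simp_all add: map_poly_eq_0_iff)

lemma map_poly_pCons_0: "f 0 = 0 \<Longrightarrow> map_poly f (pCons a p) = pCons (f a) (map_poly f p)"
  by (rule poly_eqI) (simp add: coeff_map_poly coeff_pCons split: nat.split)

lemma rat_const_0 [simp]: "rat_const 0 = 0" and rat_const_1 [simp]: "rat_const 1 = 1"
  by (simp_all add: rat_const_def flip: one_pCons)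

lemma poly_rat_z: "poly (map_poly rat_const p) rat_z = to_fract p"
proof (induction p)
  case (pCons a p)
  have "pCons a p = [:a:] + [:0, 1:] * p" by simp
  then show ?case
    using pCons by (simp add: map_poly_pCons_0) (simp add: rat_const_def rat_z_def flip: to_fract_add to_fract_mult)
qed simp

lemma rat_z_nonzero [simp]: "rat_z \<noteq> 0" by (simp add: rat_z_def)

definition poly_recip :: "complex poly \<Rightarrow> ratfun" where
  "poly_recip p = poly (map_poly rat_const p) (1 / rat_z)"

text \<open>Clearing denominators in \<open>p(1/z)\<close> reverses the coefficients. This shows
  that \<open>p(1/z)\<close> vanishes only for \<open>p = 0\<close>, and it turns
  \<open>rat_recip\<close> back into a quotient of polynomials that can be evaluated.\<close>

lemma poly_recip_eq: "poly_recip p = to_fract (reflect_poly p) / rat_z ^ degree p"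
proof -
  interpret c: inj_comm_ring_hom rat_const by (rule rat_const_hom)
  have r: "reflect_poly (map_poly rat_const p) = map_poly rat_const (reflect_poly p)"
    by (rule poly_eqI) (simp add: coeff_reflect_poly coeff_map_poly degree_map_poly)
  have "poly (reflect_poly (map_poly rat_const p)) rat_z = rat_z ^ degree p * poly_recip p"
    by (simp add: poly_reflect_poly_nz poly_recip_def degree_map_poly inverse_eq_divide)
  then show ?thesis by (simp add: r poly_rat_z field_simps)
qed

lemma poly_recip_hom: "inj_comm_ring_hom poly_recip"
proof -
  interpret c: inj_comm_ring_hom rat_const by (rule rat_const_hom)
  interpret cp: map_poly_inj_comm_ring_hom rat_const ..
  show ?thesis
  proof
    show "p = 0" if "poly_recip p = 0" for p using that by (simp add: poly_recip_eq)
  qed (simp_all add: poly_recip_def cp.hom_add cp.hom_mult)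
qed

interpretation rat_recip: field_hom rat_recip
  using field_hom_fract_extension(2)[OF poly_recip_hom]
  unfolding poly_recip_def rat_recip_def[abs_def, symmetric] .

interpretation rat_cnj: field_hom rat_cnj
  using field_hom_fract_extension(2)[OF map_poly_cnj_hom]
  unfolding rat_cnj_def[abs_def, symmetric] .

lemma rat_recip_fract:
  "q \<noteq> 0 \<Longrightarrow> rat_recip (to_fract p / to_fract q) = poly_recip p / poly_recip q"
  using field_hom_fract_extension(1)[OF poly_recip_hom, of q p]
  by (simp add: rat_recip_def poly_recip_def)

lemma rat_cnj_fract:
  "q \<noteq> 0 \<Longrightarrow> rat_cnj (to_fract p / to_fract q) = to_fract (map_poly cnj p) / to_fract (map_poly cnj q)"
  using field_hom_fract_extension(1)[OF map_poly_cnj_hom, of q p]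
  by (simp add: rat_cnj_def)

lemma rat_recip_to_fract: "rat_recip (to_fract p) = poly_recip p"
  using rat_recip_fract[of 1 p] by (simp add: poly_recip_eq)

lemma rat_cnj_to_fract: "rat_cnj (to_fract p) = to_fract (map_poly cnj p)"
  using rat_cnj_fract[of 1 p] by simp

lemma rat_recip_const [simp]: "rat_recip (rat_const c) = rat_const c"
  by (simp add: rat_const_def rat_recip_to_fract poly_recip_eq)

lemma rat_cnj_const [simp]: "rat_cnj (rat_const c) = rat_const (cnj c)"
  by (simp add: rat_const_def rat_cnj_to_fract map_poly_pCons_0)

lemma rat_recip_z [simp]: "rat_recip rat_z = 1 / rat_z"
  by (simp add: rat_z_def rat_recip_to_fract poly_recip_def map_poly_pCons_0)

lemma rat_cnj_z [simp]: "rat_cnj rat_z = rat_z"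
  by (simp add: rat_z_def rat_cnj_to_fract map_poly_pCons_0)

lemma rat_recip_involution [simp]: "rat_recip (rat_recip r) = r"
proof -
  have "rat_recip (poly_recip p) = to_fract p" for p
  proof (induction p)
    case (pCons a p)
    have "poly_recip (pCons a p) = rat_const a + 1 / rat_z * poly_recip p"
      by (simp add: poly_recip_def map_poly_pCons_0)
    moreover have "to_fract (pCons a p) = rat_const a + rat_z * to_fract p"
      by (simp add: rat_const_def rat_z_def flip: to_fract_add to_fract_mult)
    ultimately show ?case using pCons by (simp add: rat_recip.hom_add rat_recip.hom_mult rat_recip.hom_div)
  qed (simp add: poly_recip_def)
  then show ?thesis
    using rat_num_over_den[of r]
    by (metis rat_den_nonzero rat_recip.hom_div rat_recip_fract)
qed

lemma rat_recip_at:
  assumes "x \<noteq> 0" "regular_at (1 / x) r"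
  shows "regular_at x (rat_recip r)" "rat_eval (rat_recip r) x = rat_eval r (1 / x)"
proof -
  obtain p q where 1: "r = to_fract p / to_fract q" "poly q (1 / x) \<noteq> 0"
      "rat_eval r (1 / x) = poly p (1 / x) / poly q (1 / x)"
    using assms(2) by (rule regular_at_rep)
  have q: "q \<noteq> 0" using 1 by auto
  \<comment> \<open>The two powers of \<open>z\<close> are placed crosswise instead of being
    cancelled, which avoids comparing the degrees of \<open>p\<close> and \<open>q\<close>; they are
    harmless because \<open>x\<close> is nonzero.\<close>
  have e: "rat_recip r = to_fract (reflect_poly p * [:0, 1:] ^ degree q) /
      to_fract (reflect_poly q * [:0, 1:] ^ degree p)"
    unfolding 1(1) rat_recip_fract[OF q]
    by (simp add: poly_recip_eq rat_z_def to_fract_hom.hom_power)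
  have nz: "poly (reflect_poly q * [:0, 1:] ^ degree p) x \<noteq> 0"
    using assms(1) 1(2) by (simp add: poly_reflect_poly_nz inverse_eq_divide)
  from fract_at_regular_point[OF e nz]
  show "regular_at x (rat_recip r)" "rat_eval (rat_recip r) x = rat_eval r (1 / x)"
    using assms(1) 1 by (simp_all add: poly_reflect_poly_nz inverse_eq_divide)
qed

lemma rat_cnj_at:
  assumes "regular_at (cnj x) r"
  shows "regular_at x (rat_cnj r)" "rat_eval (rat_cnj r) x = cnj (rat_eval r (cnj x))"
proof -
  obtain p q where 1: "r = to_fract p / to_fract q" "poly q (cnj x) \<noteq> 0"
      "rat_eval r (cnj x) = poly p (cnj x) / poly q (cnj x)"
    using assms by (rule regular_at_rep)
  have q: "q \<noteq> 0" using 1 by auto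
  have c: "poly (map_poly cnj s) x = cnj (poly s (cnj x))" for s
    using poly_cnj[of s "cnj x"] by simp
  have nz: "poly (map_poly cnj q) x \<noteq> 0" using 1(2) by (simp add: c)
  have e: "rat_cnj r = to_fract (map_poly cnj p) / to_fract (map_poly cnj q)"
    unfolding 1(1) by (rule rat_cnj_fract[OF q])
  from fract_at_regular_point[OF e nz]
  show "regular_at x (rat_cnj r)" "rat_eval (rat_cnj r) x = cnj (rat_eval r (cnj x))"
    using 1 by (simp_all add: c)
qed

text \<open>Multiplying out the denominator shows that its value at \<open>a\<close> cannot vanish together
  with the numerator.\<close>

lemma regular_at_if_tendsto_0:
  assumes "(rat_eval r \<longlongrightarrow> 0) (at a)"
  shows "regular_at a r" "rat_eval r a = 0"
proof -
  have cont: "(poly p \<longlongrightarrow> poly p a) (at a)" for p :: "complex poly"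
    using poly_isCont[of a p] by (simp add: isCont_def)
  have "eventually (\<lambda>x. rat_eval r x * poly (rat_den r) x = poly (rat_num r) x) (at a)"
    by (rule eventually_mono[OF eventually_regular_at[of r a]])
      (simp add: regular_at_def rat_eval_def)
  moreover have "((\<lambda>x. rat_eval r x * poly (rat_den r) x) \<longlongrightarrow> 0 * poly (rat_den r) a) (at a)"
    by (intro tendsto_mult assms cont)
  ultimately have "(poly (rat_num r) \<longlongrightarrow> 0) (at a)"
    by (simp add: tendsto_cong)
  then have n: "poly (rat_num r) a = 0" using cont[of "rat_num r"] LIM_unique by blast
  show "regular_at a r"
    unfolding regular_at_def
    using coprime_num_den[of r] n by (metis coprime_poly_0)
  show "rat_eval r a = 0" by (simp add: rat_eval_def n)
qed

text \<open>\<open>rat_recip_at\<close> leaves out the point \<open>0\<close>, which corresponds to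
  infinity. Decay at infinity becomes a limit at \<open>0\<close>, and a rational function with
  limit \<open>0\<close> has no pole there.\<close>

lemma rat_recip_at_0:
  assumes "(rat_eval r \<longlongrightarrow> 0) at_infinity"
  shows "regular_at 0 (rat_recip r)" "rat_eval (rat_recip r) 0 = 0"
proof -
  have "((\<lambda>x. rat_eval r (inverse x)) \<longlongrightarrow> 0) (at 0)"
    using filterlim_compose[OF assms filterlim_inverse_at_infinity] .
  moreover have "eventually (\<lambda>x. rat_eval r (inverse x) = rat_eval (rat_recip r) x) (at 0)"
  proof -
    have "eventually (\<lambda>x. regular_at (inverse x) r) (at 0)"
      using filterlim_inverse_at_infinity eventually_regular_at_infinity
      by (rule eventually_compose_filterlim[rotated])
    moreover have "eventually (\<lambda>x. x \<noteq> 0) (at (0::complex))"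
      by (rule eventually_neq_at_within)
    ultimately show ?thesis
      by eventually_elim (simp add: rat_recip_at inverse_eq_divide)
  qed
  ultimately have "(rat_eval (rat_recip r) \<longlongrightarrow> 0) (at 0)"
    by (simp add: tendsto_cong)
  then show "regular_at 0 (rat_recip r)" "rat_eval (rat_recip r) 0 = 0"
    using regular_at_if_tendsto_0 by blast+
qed

lemma rat_eval_tendsto:
  assumes "regular_at a r"
  shows "(rat_eval r \<longlongrightarrow> rat_eval r a) (at a)"
  unfolding rat_eval_def[abs_def]
  using assms poly_isCont[of a] by (intro tendsto_divide) (simp_all add: isCont_def regular_at_def)

lemma rat_recip_tendsto_0:
  assumes "regular_at 0 r" "rat_eval r 0 = 0"
  shows "(rat_eval (rat_recip r) \<longlongrightarrow> 0) at_infinity"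
proof -
  have l: "filterlim (\<lambda>x::complex. inverse x) (at 0) at_infinity"
    by (simp add: filterlim_inverse_at_iff filterlim_ident)
  have "((\<lambda>x. rat_eval r (inverse x)) \<longlongrightarrow> 0) at_infinity"
    using filterlim_compose[OF rat_eval_tendsto[OF assms(1)] l] assms(2) by simp
  moreover have "eventually (\<lambda>x. rat_eval r (inverse x) = rat_eval (rat_recip r) x) at_infinity"
  proof -
    have "eventually (\<lambda>x. regular_at (inverse x) r) at_infinity"
      using l eventually_regular_at[of r 0] by (rule eventually_compose_filterlim[rotated])
    moreover have "eventually (\<lambda>x. x \<noteq> (0::complex)) at_infinity"
      using eventually_at_infinity[of "\<lambda>x. x \<noteq> (0::complex)"] by (metis norm_zero not_one_le_zero)
    ultimately show ?thesis
      by eventually_elim (simp add: rat_recip_at inverse_eq_divide)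
  qed
  ultimately show ?thesis by (simp add: tendsto_cong)
qed

section \<open>Rational functions without poles\<close>

lemma at_infinity_neq_bot [simp]: "(at_infinity :: complex filter) \<noteq> bot"
proof
  assume "(at_infinity :: complex filter) = bot"
  then have "eventually (\<lambda>_::complex. False) at_infinity" by simp
  then obtain b where "\<forall>x::complex. \<not> norm x \<ge> b" unfolding eventually_at_infinity by auto
  then show False by (metis abs_ge_self norm_of_real)
qed

lemma poly_tendsto_0_imp_0:
  fixes p :: "complex poly"
  assumes "(poly p \<longlongrightarrow> 0) at_infinity"
  shows "p = 0"
proof (rule ccontr)
  assume nz: "p \<noteq> 0"
  obtain a q where p: "p = pCons a q" by (cases p)
  show False
  proof (cases "q = 0")
    case True
    then have "poly p = (\<lambda>_. a)" using p by auto
    then have "((\<lambda>_::complex. a) \<longlongrightarrow> 0) at_infinity" using assms by simp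
    then show False using nz p True by (simp add: tendsto_const_iff)
  next
    case False
    from poly_infinity[OF this, of 1 a] obtain s where s: "\<forall>z. s \<le> cmod z \<longrightarrow> 1 \<le> cmod (poly p z)"
      using p by auto
    have "eventually (\<lambda>z. cmod (poly p z) < 1) at_infinity"
      using tendstoD[OF assms, of 1] by simp
    moreover have "eventually (\<lambda>z. cmod (poly p z) \<ge> 1) at_infinity"
      unfolding eventually_at_infinity using s by blast
    ultimately have "eventually (\<lambda>z::complex. False) at_infinity"
      by eventually_elim simp
    then show False by simp
  qed
qed

text \<open>A rational Liouville theorem: without poles the denominator has no root, hence is
  constant by the fundamental theorem of algebra, and a polynomial that decays at infinity is
  zero.\<close>

lemma entire_tendsto_0_imp_0:
  assumes "\<And>x. regular_at x r" "(rat_eval r \<longlongrightarrow> 0) at_infinity"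
  shows "r = 0"
proof -
  have "degree (rat_den r) = 0"
    using assms(1) fundamental_theorem_of_algebra[of "rat_den r"]
    by (auto simp: regular_at_def constant_degree)
  then obtain d where d: "rat_den r = [:d:]" by (metis degree_eq_zeroE)
  then have "d \<noteq> 0" using rat_den_nonzero[of r] by auto
  define p where "p = smult (1 / d) (rat_num r)"
  have "rat_den r * p = rat_num r" using d \<open>d \<noteq> 0\<close> by (simp add: p_def)
  then have "to_fract (rat_den r) * to_fract p = to_fract (rat_num r)"
    by (simp flip: to_fract_mult)
  then have r: "r = to_fract p"
    using rat_num_over_den[of r] by (metis nonzero_mult_div_cancel_left rat_den_nonzero to_fract_eq_0_iff)
  have "rat_eval r = poly p" unfolding r by (rule ext) (simp add: to_fract_at)
  then show ?thesis using r assms(2) poly_tendsto_0_imp_0 by (metis to_fract_0)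
qed

section \<open>Matrices of constants, polynomials and rational functions\<close>

interpretation rat_const: inj_comm_ring_hom rat_const by (rule rat_const_hom)

lemma poly_const_hom: "semiring_hom (\<lambda>c::complex. [:c:])"
  by unfold_locales (simp_all add: one_pCons)

definition lin_pencil :: "complex mat \<Rightarrow> complex mat \<Rightarrow> complex poly mat" where
  "lin_pencil E F = [:0, 1:] \<cdot>\<^sub>m pmat_const E - pmat_const F"

lemma rmat_dims [simp]:
  "dim_row (rmat_poly P) = dim_row P" "dim_col (rmat_poly P) = dim_col P"
  "dim_row (rmat_const A) = dim_row A" "dim_col (rmat_const A) = dim_col A"
  "dim_row (pmat_const A) = dim_row A" "dim_col (pmat_const A) = dim_col A"
  "dim_row (pmat_eval P x) = dim_row P" "dim_col (pmat_eval P x) = dim_col P"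
  "dim_row (rmat_eval G x) = dim_row G" "dim_col (rmat_eval G x) = dim_col G"
  by (simp_all add: rmat_poly_def rmat_const_def pmat_const_def pmat_eval_def rmat_eval_def)

lemma rmat_carriers [simp]:
  "rmat_poly P \<in> carrier_mat n k \<longleftrightarrow> P \<in> carrier_mat n k"
  "rmat_const A \<in> carrier_mat n k \<longleftrightarrow> A \<in> carrier_mat n k"
  "pmat_const A \<in> carrier_mat n k \<longleftrightarrow> A \<in> carrier_mat n k"
  "pmat_eval P x \<in> carrier_mat n k \<longleftrightarrow> P \<in> carrier_mat n k"
  "rmat_eval G x \<in> carrier_mat n k \<longleftrightarrow> G \<in> carrier_mat n k"
  by (simp_all only: carrier_mat_def mem_Collect_eq rmat_dims)

lemma rmat_indices [simp]:
  "i < dim_row P \<Longrightarrow> j < dim_col P \<Longrightarrow> rmat_poly P $$ (i, j) = to_fract (P $$ (i, j))"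
  "i < dim_row A \<Longrightarrow> j < dim_col A \<Longrightarrow> rmat_const A $$ (i, j) = rat_const (A $$ (i, j))"
  "i < dim_row A \<Longrightarrow> j < dim_col A \<Longrightarrow> pmat_const A $$ (i, j) = [:A $$ (i, j):]"
  "i < dim_row P \<Longrightarrow> j < dim_col P \<Longrightarrow> pmat_eval P x $$ (i, j) = poly (P $$ (i, j)) x"
  "i < dim_row G \<Longrightarrow> j < dim_col G \<Longrightarrow> rmat_eval G x $$ (i, j) = rat_eval (G $$ (i, j)) x"
  by (simp_all add: rmat_poly_def rmat_const_def pmat_const_def pmat_eval_def rmat_eval_def)

lemma rmat_poly_mult:
  "A \<in> carrier_mat n k \<Longrightarrow> B \<in> carrier_mat k l \<Longrightarrow> rmat_poly (A * B) = rmat_poly A * rmat_poly B"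
  unfolding rmat_poly_def by (rule to_fract_hom.mat_hom_mult)

lemma rmat_const_mult:
  "A \<in> carrier_mat n k \<Longrightarrow> B \<in> carrier_mat k l \<Longrightarrow> rmat_const (A * B) = rmat_const A * rmat_const B"
  unfolding rmat_const_def by (rule rat_const.mat_hom_mult)

lemma pmat_const_mult:
  "A \<in> carrier_mat n k \<Longrightarrow> B \<in> carrier_mat k l \<Longrightarrow> pmat_const (A * B) = pmat_const A * pmat_const B"
  unfolding pmat_const_def by (rule semiring_hom.mat_hom_mult[OF poly_const_hom])

lemma rmat_poly_add:
  "A \<in> carrier_mat n k \<Longrightarrow> B \<in> carrier_mat n k \<Longrightarrow> rmat_poly (A + B) = rmat_poly A + rmat_poly B"
  by (rule eq_matI) auto

lemma rmat_poly_diff: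
  "A \<in> carrier_mat n k \<Longrightarrow> B \<in> carrier_mat n k \<Longrightarrow> rmat_poly (A - B) = rmat_poly A - rmat_poly B"
  by (rule eq_matI) auto

lemma rmat_poly_smult: "rmat_poly (p \<cdot>\<^sub>m A) = to_fract p \<cdot>\<^sub>m rmat_poly A"
  by (rule eq_matI) auto

lemma rmat_poly_const [simp]: "rmat_poly (pmat_const A) = rmat_const A"
  by (rule eq_matI) (auto simp: rat_const_def)

lemma rmat_const_one [simp]: "rmat_const (1\<^sub>m n) = 1\<^sub>m n"
  by (rule eq_matI) auto

lemma pmat_const_one [simp]: "pmat_const (1\<^sub>m n) = 1\<^sub>m n"
  by (rule eq_matI) (auto simp: one_pCons)


lemma lin_pencil_carrier [simp]:
  "E \<in> carrier_mat n k \<Longrightarrow> F \<in> carrier_mat n k \<Longrightarrow> lin_pencil E F \<in> carrier_mat n k"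
  unfolding lin_pencil_def by (rule minus_carrier_mat) simp

lemma rmat_lin_pencil:
  "E \<in> carrier_mat n k \<Longrightarrow> F \<in> carrier_mat n k \<Longrightarrow>
     rmat_poly (lin_pencil E F) = rat_z \<cdot>\<^sub>m rmat_const E - rmat_const F"
  unfolding lin_pencil_def
  by (subst rmat_poly_diff[of _ n k]) (simp_all add: rmat_poly_smult rat_z_def)

lemma pmat_eval_lin_pencil:
  "E \<in> carrier_mat n k \<Longrightarrow> F \<in> carrier_mat n k \<Longrightarrow> pmat_eval (lin_pencil E F) x = x \<cdot>\<^sub>m E - F"
  unfolding lin_pencil_def by (rule eq_matI) auto

text \<open>Used with \<open>T1 * T2\<close> equal to the compressed Hankel matrix and
  \<open>T1 * S * T2\<close> equal to the compressed shifted one: their pencil is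
  \<open>z - S\<close> in other coordinates.\<close>

lemma lin_pencil_congruence:
  assumes "T1 \<in> carrier_mat d d" "S \<in> carrier_mat d d" "T2 \<in> carrier_mat d d"
  shows "lin_pencil (T1 * T2) (T1 * S * T2) = pmat_const T1 * lin_pencil (1\<^sub>m d) S * pmat_const T2"
proof -
  have "pmat_const T1 * lin_pencil (1\<^sub>m d) S = [:0, 1:] \<cdot>\<^sub>m pmat_const T1 - pmat_const (T1 * S)"
    using assms unfolding lin_pencil_def
    by (simp add: mult_minus_distrib_mat[of _ d d _ d] mult_smult_distrib[of _ d d _ d] pmat_const_mult[of _ d d _ d])
  then have "pmat_const T1 * lin_pencil (1\<^sub>m d) S * pmat_const T2 =
      [:0, 1:] \<cdot>\<^sub>m pmat_const (T1 * T2) - pmat_const (T1 * S * T2)"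
    using assms
    by (simp add: minus_mult_distrib_mat[of _ d d _ _ d] mult_smult_assoc_mat[of _ d d _ d]
        pmat_const_mult[of _ d d _ d] pmat_const_mult[of "T1 * S" d d T2 d] mult_carrier_mat[of T1 d d S d])
  then show ?thesis by (simp add: lin_pencil_def)
qed

section \<open>State-space realizations\<close>

text \<open>Horner's scheme for matrices, by induction on a bound for the degree. Write
  \<open>M = M0 + z M'\<close> and divide \<open>M'\<close>, leaving a remainder \<open>C\<close>;
  since \<open>z C = C (z - S) + C S\<close>, the new remainder \<open>M0 + C S\<close> is again
  constant.\<close>

lemma right_division_by_pencil:
  assumes S: "S \<in> carrier_mat d d" and M: "M \<in> carrier_mat p d"
    and deg: "\<forall>i<p. \<forall>j<d. \<forall>l\<ge>n. coeff (M $$ (i, j)) l = 0"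
  shows "\<exists>T\<in>carrier_mat p d. \<exists>C\<in>carrier_mat p d. M = T * lin_pencil (1\<^sub>m d) S + pmat_const C"
  using M deg
proof (induction n arbitrary: M)
  case 0
  have "M $$ (i, j) = 0" if "i < p" "j < d" for i j
    using 0(2) that by (intro poly_eqI) simp
  then have "M = 0\<^sub>m p d" using 0(1) by (intro eq_matI) auto
  moreover have "0\<^sub>m p d * lin_pencil (1\<^sub>m d) S + pmat_const (0\<^sub>m p d) = 0\<^sub>m p d"
    unfolding left_mult_zero_mat[OF lin_pencil_carrier[OF one_carrier_mat S]]
    by (rule eq_matI) simp_all
  ultimately have "M = 0\<^sub>m p d * lin_pencil (1\<^sub>m d) S + pmat_const (0\<^sub>m p d)"
    by metis
  then show ?case by (intro bexI[OF _ zero_carrier_mat])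
next
  case (Suc n)
  let ?L = "lin_pencil (1\<^sub>m d) S"
  note L = lin_pencil_carrier[OF one_carrier_mat S]
  define M' where "M' = map_mat (poly_shift 1) M"
  define M0 where "M0 = map_mat (\<lambda>q. coeff q 0) M"
  have c: "M' \<in> carrier_mat p d" "M0 \<in> carrier_mat p d" using Suc.prems by (simp_all add: M'_def M0_def)
  have "\<forall>i<p. \<forall>j<d. \<forall>l\<ge>n. coeff (M' $$ (i, j)) l = 0"
  proof (intro allI impI)
    fix i j l assume "i < p" "j < d" "n \<le> l"
    then show "coeff (M' $$ (i, j)) l = 0"
      using Suc.prems(1) Suc.prems(2)[rule_format, of i j "Suc l"] by (simp add: M'_def coeff_poly_shift)
  qed
  from Suc.IH[OF c(1) this] obtain T C
    where TC: "T \<in> carrier_mat p d" "C \<in> carrier_mat p d" "M' = T * ?L + pmat_const C"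
    by blast
  have M: "M = pmat_const M0 + [:0, 1:] \<cdot>\<^sub>m M'"
    using Suc.prems c
    by (intro eq_matI) (auto simp: M'_def M0_def poly_eq_iff coeff_poly_shift coeff_pCons split: nat.split)
  have C: "[:0, 1:] \<cdot>\<^sub>m pmat_const C = pmat_const C * ?L + pmat_const (C * S)"
    using TC S unfolding lin_pencil_def
    by (simp add: mult_minus_distrib_mat[of _ p d _ d] mult_smult_distrib[of _ p d _ d] pmat_const_mult[of _ p d _ d])
      (rule eq_matI, auto)
  have "M = ([:0, 1:] \<cdot>\<^sub>m T + pmat_const C) * ?L + pmat_const (M0 + C * S)"
  proof -
    have 1: "([:0, 1:] \<cdot>\<^sub>m T + pmat_const C) * ?L = [:0, 1:] \<cdot>\<^sub>m (T * ?L) + pmat_const C * ?L"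
      using TC L by (simp add: add_mult_distrib_mat[of _ p d _ _ d] mult_smult_assoc_mat[of _ p d _ d])
    have 2: "[:0, 1:] \<cdot>\<^sub>m M' = [:0, 1:] \<cdot>\<^sub>m (T * ?L) + (pmat_const C * ?L + pmat_const (C * S))"
      unfolding C[symmetric] TC(3) using TC L by (intro eq_matI) (auto simp: algebra_simps)
    have 3: "pmat_const (M0 + C * S) = pmat_const M0 + pmat_const (C * S)"
      using TC c S by (intro eq_matI) auto
    have 4: "a + (b + (x + y)) = (b + x) + (a + y)"
      if "a \<in> carrier_mat p d" "b \<in> carrier_mat p d" "x \<in> carrier_mat p d" "y \<in> carrier_mat p d"
      for a b x y :: "complex poly mat"
      using that by (intro eq_matI) auto
    have "M = pmat_const M0 + ([:0, 1:] \<cdot>\<^sub>m (T * ?L) + (pmat_const C * ?L + pmat_const (C * S)))"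
      unfolding 2[symmetric] by (rule M)
    also have "\<dots> = ([:0, 1:] \<cdot>\<^sub>m (T * ?L) + pmat_const C * ?L) + (pmat_const M0 + pmat_const (C * S))"
      by (rule 4) (simp_all add: TC c mult_carrier_mat[OF _ L] mult_carrier_mat[OF TC(2) S])
    finally show ?thesis unfolding 1 3 .
  qed
  moreover have "[:0, 1:] \<cdot>\<^sub>m T + pmat_const C \<in> carrier_mat p d" "M0 + C * S \<in> carrier_mat p d"
    using TC c S by auto
  ultimately show ?case by blast
qed

lemma coeff_bound:
  fixes M :: "complex poly mat"
  shows "\<exists>n. \<forall>i<p. \<forall>j<d. \<forall>l\<ge>n. coeff (M $$ (i, j)) l = 0"
proof -
  let ?n = "Suc (\<Sum>i<p. \<Sum>j<d. degree (M $$ (i, j)))"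
  have "degree (M $$ (i, j)) < ?n" if "i < p" "j < d" for i j
  proof -
    have "degree (M $$ (i, j)) \<le> (\<Sum>j<d. degree (M $$ (i, j)))"
      using that by (intro member_le_sum) auto
    also have "\<dots> \<le> (\<Sum>i<p. \<Sum>j<d. degree (M $$ (i, j)))"
      using that by (intro member_le_sum[where f = "\<lambda>i. \<Sum>j<d. degree (M $$ (i, j))"]) auto
    finally show ?thesis by simp
  qed
  then show ?thesis by (meson coeff_eq_0 order_less_le_trans)
qed

lemma right_division:
  assumes "S \<in> carrier_mat d d" "M \<in> carrier_mat p d"
  obtains T C where "T \<in> carrier_mat p d" "C \<in> carrier_mat p d"
    "M = T * lin_pencil (1\<^sub>m d) S + pmat_const C"
  using right_division_by_pencil[OF assms] coeff_bound[of p d M] by blast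

text \<open>Transposition exchanges the two sides and replaces \<open>z - S\<close> by the same
  pencil for the transpose of \<open>S\<close>.\<close>

lemma left_division:
  assumes S: "S \<in> carrier_mat d d" and M: "M \<in> carrier_mat d p"
  obtains T C where "T \<in> carrier_mat d p" "C \<in> carrier_mat d p"
    "M = lin_pencil (1\<^sub>m d) S * T + pmat_const C"
proof -
  have St: "S\<^sup>T \<in> carrier_mat d d" and Mt: "M\<^sup>T \<in> carrier_mat p d"
    using S M by simp_all
  from St Mt obtain T C where TC: "T \<in> carrier_mat p d" "C \<in> carrier_mat p d"
      "M\<^sup>T = T * lin_pencil (1\<^sub>m d) (S\<^sup>T) + pmat_const C"
    by (rule right_division)
  note L = lin_pencil_carrier[OF one_carrier_mat St]
  have tL: "(lin_pencil (1\<^sub>m d) (S\<^sup>T))\<^sup>T = lin_pencil (1\<^sub>m d) S"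
    unfolding lin_pencil_def using S by (intro eq_matI) simp_all
  have tC: "(pmat_const C)\<^sup>T = pmat_const (C\<^sup>T)"
    by (rule eq_matI) simp_all
  have "M = (T * lin_pencil (1\<^sub>m d) (S\<^sup>T) + pmat_const C)\<^sup>T"
    using TC(3) by (metis transpose_transpose)
  also have "\<dots> = (T * lin_pencil (1\<^sub>m d) (S\<^sup>T))\<^sup>T + (pmat_const C)\<^sup>T"
    by (rule transpose_add[OF mult_carrier_mat[OF TC(1) L]]) (simp add: TC)
  also have "\<dots> = lin_pencil (1\<^sub>m d) S * T\<^sup>T + pmat_const (C\<^sup>T)"
    by (simp only: transpose_mult[OF TC(1) L] tL tC)
  finally show ?thesis
    using that[of "T\<^sup>T" "C\<^sup>T"] TC by simp
qed

text \<open>For the last row of a companion matrix, where \<open>z ^ degree f\<close> is to be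
  reduced modulo the monic \<open>f\<close>.\<close>

lemma monic_sum_of_monoms:
  fixes f :: "complex poly"
  assumes "lead_coeff f = 1"
  shows "(\<Sum>b<degree f. rat_const (coeff f b) * to_fract (monom 1 b)) =
    to_fract f - to_fract (monom 1 (degree f))"
proof -
  have "f = (\<Sum>b\<le>degree f. monom (coeff f b) b)" by (simp add: poly_as_sum_of_monoms)
  also have "\<dots> = (\<Sum>b<degree f. [:coeff f b:] * monom 1 b) + monom 1 (degree f)"
    using assms by (simp add: lessThan_Suc_atMost[symmetric] smult_monom)
  finally have "to_fract ((\<Sum>b<degree f. [:coeff f b:] * monom 1 b) + monom 1 (degree f)) = to_fract f" by simp
  then show ?thesis unfolding to_fract_add to_fract_sum to_fract_mult rat_const_def[symmetric] eq_diff_eq .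
qed

text \<open>The state space is \<open>\<Oplus>\<^sub>i \<complex>[z] / (f\<^sub>i)\<close> with the monomial bases, on which \<open>S\<close> acts as
  multiplication by \<open>z\<close>; the pair \<open>(i, a)\<close> stands for the class of \<open>z\<^sup>a\<close> in the \<open>i\<close>-th summand.\<close>

lemma diagonal_realization:
  assumes f: "\<And>i. i < r \<Longrightarrow> lead_coeff (f i) = 1" and r: "r \<le> p" "r \<le> m"
    and d: "d = (\<Sum>i<r. degree (f i))"
  obtains S E N X W where "S \<in> carrier_mat d d" "E \<in> carrier_mat p d" "N \<in> carrier_mat d m"
    "X \<in> carrier_mat p m" "W \<in> carrier_mat d m"
    "rmat_poly (lin_pencil (1\<^sub>m d) S) * W = rmat_const N"
    "mat p m (\<lambda>(i, j). if i = j \<and> i < r then to_fract (e i) / to_fract (f i) else 0) =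
       rmat_poly X + rmat_poly E * W"
proof -
  define J where "J = (SIGMA i:{..<r}. {..<degree (f i)})"
  have "card J = d" by (simp add: J_def d)
  moreover have "finite J" by (simp add: J_def)
  ultimately obtain \<beta> where \<beta>: "bij_betw \<beta> {0..<d} J"
    using ex_bij_betw_nat_finite by metis
  have \<beta>J: "\<beta> s \<in> J" if "s < d" for s using \<beta> that by (auto simp: bij_betw_def)
  have sum_\<beta>: "(\<Sum>s = 0..<d. g (\<beta> s)) = (\<Sum>i<r. \<Sum>a<degree (f i). g (i, a))" for g :: "nat \<times> nat \<Rightarrow> ratfun"
    unfolding sum.reindex_bij_betw[OF \<beta>] J_def by (simp add: sum.Sigma)
  have f0: "f i \<noteq> 0" if "i < r" for i using f[OF that] by auto
  \<comment> \<open>Companion blocks: in the block of \<open>f i\<close> the state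
    \<open>z ^ a\<close> is sent to \<open>z ^ (a + 1)\<close>, except for the last
    \<open>a\<close>, where the power is reduced modulo \<open>f i\<close>.\<close>
  define s where "s x y = (if fst x = fst y
     then if Suc (snd x) < degree (f (fst x)) then if snd y = Suc (snd x) then 1 else 0
          else - coeff (f (fst x)) (snd y) else 0)" for x y
  \<comment> \<open>The state \<open>(i, a)\<close> is realized by \<open>z ^ a / f i\<close>,
    placed in column \<open>i\<close>.\<close>
  define w where "w x j = (if fst x = j then to_fract (monom 1 (snd x)) / to_fract (f j) else 0)" for x j
  \<comment> \<open>The input enters at the last state only: \<open>z ^ degree f / f\<close> is
    \<open>1\<close> plus the strictly proper remainder that the companion row accounts for.\<close>
  define n where "n x j = (if fst x = j \<and> Suc (snd x) = degree (f j) then 1 else 0 :: complex)" for x j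
  have shift: "rat_z * w (i, a) j - (\<Sum>i'<r. \<Sum>b<degree (f i'). rat_const (s (i, a) (i', b)) * w (i', b) j)
      = rat_const (n (i, a) j)" if ia: "i < r" "a < degree (f i)" for i a j
  proof (cases "i = j")
    case False
    then have "rat_const (s (i, a) (i', b)) * w (i', b) j = 0" for i' b
      by (simp add: s_def w_def)
    then show ?thesis using False by (simp add: w_def n_def)
  next
    case True
    let ?F = "f i"
    have mz: "rat_z * to_fract (monom 1 a) = to_fract (monom 1 (Suc a))"
      by (simp add: rat_z_def monom_Suc flip: to_fract_mult)
    have "(\<Sum>i'<r. \<Sum>b<degree (f i'). rat_const (s (i, a) (i', b)) * w (i', b) j) =
        (\<Sum>i'<r. if i' = i then \<Sum>b<degree ?F. rat_const (s (i, a) (i, b)) * w (i, b) j else 0)"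
      using True by (intro sum.cong) (auto simp: w_def)
    also have "\<dots> = (\<Sum>b<degree ?F. rat_const (s (i, a) (i, b)) * (to_fract (monom 1 b) / to_fract ?F))"
      using ia True by (simp add: sum.delta w_def)
    also have "\<dots> = rat_z * (to_fract (monom 1 a) / to_fract ?F) - rat_const (n (i, a) j)"
    proof (cases "Suc a < degree ?F")
      case less: True
      have "(\<Sum>b<degree ?F. rat_const (s (i, a) (i, b)) * (to_fract (monom 1 b) / to_fract ?F)) =
          (\<Sum>b<degree ?F. if b = Suc a then to_fract (monom 1 (Suc a)) / to_fract ?F else 0)"
        using less by (intro sum.cong) (auto simp: s_def)
      also have "\<dots> = to_fract (monom 1 (Suc a)) / to_fract ?F"
        using less by (simp add: sum.delta)
      finally show ?thesis using less True by (simp add: n_def mz)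
    next
      case False
      then have a: "Suc a = degree ?F" using ia by simp
      have "(\<Sum>b<degree ?F. rat_const (s (i, a) (i, b)) * (to_fract (monom 1 b) / to_fract ?F)) =
          (\<Sum>b<degree ?F. - (rat_const (coeff ?F b) * to_fract (monom 1 b)) / to_fract ?F)"
        using False by (intro sum.cong) (auto simp: s_def rat_const.hom_uminus)
      also have "\<dots> = - (\<Sum>b<degree ?F. rat_const (coeff ?F b) * to_fract (monom 1 b)) / to_fract ?F"
        by (simp add: sum_negf sum_divide_distrib)
      also have "\<dots> = (to_fract (monom 1 (Suc a)) - to_fract ?F) / to_fract ?F"
        unfolding monic_sum_of_monoms[OF f[OF ia(1)]] a by simp
      also have "\<dots> = to_fract (monom 1 (Suc a)) / to_fract ?F - 1"
        using f0[OF ia(1)] by (simp add: diff_divide_distrib)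
      finally show ?thesis using a True by (simp add: n_def mz)
    qed
    finally show ?thesis using True by (simp add: w_def)
  qed
  define S where "S = mat d d (\<lambda>(t, u). s (\<beta> t) (\<beta> u))"
  define W where "W = mat d m (\<lambda>(t, j). w (\<beta> t) j)"
  define N where "N = mat d m (\<lambda>(t, j). n (\<beta> t) j)"
  \<comment> \<open>Since \<open>w (i, 0) i\<close> is \<open>1 / f i\<close>, the diagonal entry
    \<open>e i / f i\<close> is \<open>e i\<close> times the state \<open>(i, 0)\<close>.\<close>
  define E where "E = mat p d (\<lambda>(i, t). if \<beta> t = (i, 0) then e i else 0)"
  \<comment> \<open>If \<open>f i\<close> has degree \<open>0\<close> there is no state
    \<open>(i, 0)\<close>. Then \<open>f i = 1\<close> because it is monic, and \<open>e i\<close>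
    has to go into the polynomial part.\<close>
  define X where "X = mat p m (\<lambda>(i, j). if i = j \<and> i < r \<and> degree (f i) = 0 then e i else 0)"
  have S: "S \<in> carrier_mat d d" by (simp add: S_def)
  have W: "W \<in> carrier_mat d m" by (simp add: W_def)
  have pen: "rmat_poly (lin_pencil (1\<^sub>m d) S) = rat_z \<cdot>\<^sub>m 1\<^sub>m d - rmat_const S"
    using rmat_lin_pencil[OF one_carrier_mat S] by simp
  have "(rat_z \<cdot>\<^sub>m 1\<^sub>m d - rmat_const S) * W = rat_z \<cdot>\<^sub>m W - rmat_const S * W"
    using S W by (simp add: minus_mult_distrib_mat[of _ d d _ _ m] mult_smult_assoc_mat[of _ d d _ m])
  also have "\<dots> = rmat_const N"
  proof (rule eq_matI)
    fix t j assume "t < dim_row (rmat_const N)" "j < dim_col (rmat_const N)"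
    then have tj: "t < d" "j < m" by (simp_all add: N_def)
    obtain i a where ia: "\<beta> t = (i, a)" by fastforce
    then have "i < r" "a < degree (f i)" using \<beta>J[OF tj(1)] by (auto simp: J_def)
    from shift[OF this, of j]
    have "rat_z * w (\<beta> t) j - (\<Sum>u = 0..<d. rat_const (s (\<beta> t) (\<beta> u)) * w (\<beta> u) j) = rat_const (n (\<beta> t) j)"
      unfolding ia sum_\<beta>[of "\<lambda>x. rat_const (s (i, a) x) * w x j"] .
    then show "(rat_z \<cdot>\<^sub>m W - rmat_const S * W) $$ (t, j) = rmat_const N $$ (t, j)"
      using tj by (simp add: S_def W_def N_def scalar_prod_def)
  qed (simp_all add: N_def W_def S_def)
  finally have pW: "rmat_poly (lin_pencil (1\<^sub>m d) S) * W = rmat_const N" unfolding pen .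
  have D: "mat p m (\<lambda>(i, j). if i = j \<and> i < r then to_fract (e i) / to_fract (f i) else 0) =
       rmat_poly X + rmat_poly E * W"
  proof (rule eq_matI)
    fix i j assume "i < dim_row (rmat_poly X + rmat_poly E * W)" "j < dim_col (rmat_poly X + rmat_poly E * W)"
    then have ij: "i < p" "j < m" by (simp_all add: E_def W_def)
    have "(rmat_poly E * W) $$ (i, j) = (\<Sum>t = 0..<d. (if \<beta> t = (i, 0) then to_fract (e i) else 0) * w (\<beta> t) j)"
      using ij by (simp add: E_def W_def scalar_prod_def if_distrib[of to_fract] cong: if_cong)
    also have "\<dots> = (\<Sum>i'<r. \<Sum>a<degree (f i'). (if (i', a) = (i, 0) then to_fract (e i) else 0) * w (i', a) j)"
      by (rule sum_\<beta>[of "\<lambda>x. (if x = (i, 0) then to_fract (e i) else 0) * w x j"])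
    also have "\<dots> = (\<Sum>i'<r. if i' = i then if 0 < degree (f i) then to_fract (e i) * w (i, 0) j else 0 else 0)"
    proof (rule sum.cong[OF refl])
      fix i'
      have "(\<Sum>a<degree (f i'). (if (i', a) = (i, 0) then to_fract (e i) else 0) * w (i', a) j) =
          (\<Sum>a<degree (f i'). if a = 0 then if i' = i then to_fract (e i) * w (i, 0) j else 0 else 0)"
        by (rule sum.cong) auto
      also have "\<dots> = (if i' = i then if 0 < degree (f i) then to_fract (e i) * w (i, 0) j else 0 else 0)"
        by (simp add: sum.delta)
      finally show "(\<Sum>a<degree (f i'). (if (i', a) = (i, 0) then to_fract (e i) else 0) * w (i', a) j) = \<dots>" .
    qed
    also have "\<dots> = (if i < r \<and> 0 < degree (f i) then to_fract (e i) * w (i, 0) j else 0)"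
      by (simp add: sum.delta)
    finally have EW: "(rmat_poly E * W) $$ (i, j) = \<dots>" .
    have "f i = 1" if "i < r" "degree (f i) = 0"
      using f[OF that(1)] that(2) by (metis degree_eq_zeroE lead_coeff_pCons(2) one_pCons)
    then show "mat p m (\<lambda>(i, j). if i = j \<and> i < r then to_fract (e i) / to_fract (f i) else 0) $$ (i, j) =
        (rmat_poly X + rmat_poly E * W) $$ (i, j)"
      using ij EW by (auto simp: X_def w_def E_def W_def)
  qed (simp_all add: E_def W_def X_def)
  show ?thesis by (rule that[OF S _ _ _ W pW D]) (simp_all add: E_def N_def X_def)
qed

text \<open>Around the diagonal realization stand the polynomial matrices \<open>P\<close> and
  \<open>Q\<close>, so that the input matrix \<open>N Q\<close> and the output matrix
  \<open>P E\<close> depend on \<open>z\<close>. Dividing the former by \<open>z - S\<close> on the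
  left and the latter on the right leaves the constants \<open>B\<close> and \<open>C\<close>; the
  quotients contribute only to the polynomial part \<open>X\<close>.\<close>

lemma smith_mcmillan_realization:
  assumes "has_total_polar_degree G d" and G: "G \<in> carrier_mat p m"
  obtains S B C X Y where "S \<in> carrier_mat d d" "B \<in> carrier_mat d m" "C \<in> carrier_mat p d"
    "X \<in> carrier_mat p m" "Y \<in> carrier_mat d m"
    "rmat_poly (lin_pencil (1\<^sub>m d) S) * Y = rmat_const B" "G = rmat_poly X + rmat_const C * Y"
proof -
  from assms(1) obtain r e f where smf: "smith_mcmillan_form G r e f" and d: "d = (\<Sum>i<r. degree (f i))"
    unfolding has_total_polar_degree_def by (elim exE conjE)
  have dims: "dim_row G = p" "dim_col G = m" using G by simp_all
  from smf[unfolded smith_mcmillan_form_def unimodular_def dims]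
  have r: "r \<le> p" "r \<le> m" and f: "\<And>i. i < r \<Longrightarrow> lead_coeff (f i) = 1"
    and "\<exists>P Q. (P \<in> carrier_mat p p \<and> is_unit (det P)) \<and> (Q \<in> carrier_mat m m \<and> is_unit (det Q)) \<and>
      G = rmat_poly P * mat p m (\<lambda>(i, j). if i = j \<and> i < r then to_fract (e i) / to_fract (f i) else 0) *
       rmat_poly Q"
    by simp_all
  then obtain P Q where P: "P \<in> carrier_mat p p" and Q: "Q \<in> carrier_mat m m"
    and PQ: "G = rmat_poly P * mat p m (\<lambda>(i, j). if i = j \<and> i < r then to_fract (e i) / to_fract (f i) else 0) *
       rmat_poly Q"
    by (elim exE conjE)
  obtain S E N X0 W where S: "S \<in> carrier_mat d d" and E: "E \<in> carrier_mat p d" and N: "N \<in> carrier_mat d m"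
    and X0: "X0 \<in> carrier_mat p m" and W: "W \<in> carrier_mat d m"
    and pW: "rmat_poly (lin_pencil (1\<^sub>m d) S) * W = rmat_const N"
    and D: "mat p m (\<lambda>(i, j). if i = j \<and> i < r then to_fract (e i) / to_fract (f i) else 0) =
       rmat_poly X0 + rmat_poly E * W"
    by (rule diagonal_realization[OF f r d])
  let ?L = "lin_pencil (1\<^sub>m d) S"
  have L: "?L \<in> carrier_mat d d" using S by simp
  have NQ: "pmat_const N * Q \<in> carrier_mat d m" by (rule mult_carrier_mat[of _ d m]) (simp_all add: N Q)
  from left_division[OF S NQ] obtain T B where T: "T \<in> carrier_mat d m" and B: "B \<in> carrier_mat d m"
    and TB: "pmat_const N * Q = ?L * T + pmat_const B" by blast
  have PE: "P * E \<in> carrier_mat p d" using P E by simp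
  from right_division[OF S PE] obtain T' C where T': "T' \<in> carrier_mat p d" and C: "C \<in> carrier_mat p d"
    and TC: "P * E = T' * ?L + pmat_const C" by blast
  \<comment> \<open>As \<open>(z - S) W Q = N Q = (z - S) T + B\<close>, subtracting the quotient
    \<open>T\<close> leaves a state with the constant input \<open>B\<close>.\<close>
  define Y where "Y = W * rmat_poly Q - rmat_poly T"
  define X where "X = P * X0 * Q + (P * E) * T + T' * pmat_const B"
  have c: "rmat_poly P \<in> carrier_mat p p" "rmat_poly Q \<in> carrier_mat m m" "rmat_poly E \<in> carrier_mat p d"
    "rmat_poly X0 \<in> carrier_mat p m" "rmat_poly T \<in> carrier_mat d m" "rmat_poly T' \<in> carrier_mat p d"
    "rmat_poly ?L \<in> carrier_mat d d" "rmat_const B \<in> carrier_mat d m" "rmat_const C \<in> carrier_mat p d"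
    "rmat_const N \<in> carrier_mat d m"
    using P Q E X0 T T' L B C N by simp_all
  have Y: "Y \<in> carrier_mat d m" using W c T by (simp add: Y_def minus_carrier_mat)
  have WQ: "W * rmat_poly Q \<in> carrier_mat d m" using W c by simp
  have "rmat_poly ?L * Y = rmat_poly ?L * (W * rmat_poly Q) - rmat_poly ?L * rmat_poly T"
    unfolding Y_def by (rule mult_minus_distrib_mat[OF c(7) WQ c(5)])
  also have "rmat_poly ?L * (W * rmat_poly Q) = rmat_const N * rmat_poly Q"
    unfolding assoc_mult_mat[OF c(7) W c(2), symmetric] pW ..
  also have "\<dots> = rmat_poly (pmat_const N * Q)"
    using rmat_poly_mult[of "pmat_const N" d m Q m] N Q by simp
  also have "\<dots> = rmat_poly ?L * rmat_poly T + rmat_const B"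
    unfolding TB using L T B by (simp add: rmat_poly_add[of _ d m] rmat_poly_mult[of _ d d _ m])
  also have "rmat_poly ?L * rmat_poly T + rmat_const B - rmat_poly ?L * rmat_poly T = rmat_const B"
  proof -
    have "a + b - a = b" if "a \<in> carrier_mat d m" "b \<in> carrier_mat d m" for a b :: "ratfun mat"
      using that by (intro eq_matI) auto
    then show ?thesis using mult_carrier_mat[OF c(7) c(5)] c(8) .
  qed
  finally have LY: "rmat_poly ?L * Y = rmat_const B" .
  \<comment> \<open>Now \<open>W Q\<close> is \<open>Y + T\<close>, and
    \<open>P E Y = T' (z - S) Y + C Y = T' B + C Y\<close>, so apart from \<open>C Y\<close> only
    polynomial terms remain.\<close>
  have "rmat_poly P * (rmat_poly E * W) * rmat_poly Q = rmat_poly (P * E) * (W * rmat_poly Q)"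
    unfolding rmat_poly_mult[OF P E] assoc_mult_mat[OF c(1) c(3) WQ] assoc_mult_mat[OF c(3) W c(2), symmetric]
    by (rule assoc_mult_mat[OF c(1) mult_carrier_mat[OF c(3) W] c(2)])
  also have "W * rmat_poly Q = Y + rmat_poly T"
  proof -
    have "a = a - b + b" if "a \<in> carrier_mat d m" "b \<in> carrier_mat d m" for a b :: "ratfun mat"
      using that by (intro eq_matI) auto
    then show ?thesis unfolding Y_def using WQ c(5) .
  qed
  also have "rmat_poly (P * E) * (Y + rmat_poly T) = rmat_poly (P * E) * Y + rmat_poly (P * E) * rmat_poly T"
    by (rule mult_add_distrib_mat[of _ p d _ m]) (use PE Y c in simp_all)
  also have "rmat_poly (P * E) * Y = rmat_poly T' * rmat_const B + rmat_const C * Y"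
  proof -
    have "rmat_poly (P * E) = rmat_poly T' * rmat_poly ?L + rmat_const C"
      unfolding TC using L T' C by (simp add: rmat_poly_add[of _ p d] rmat_poly_mult[of _ p d _ d])
    then have "rmat_poly (P * E) * Y = rmat_poly T' * rmat_poly ?L * Y + rmat_const C * Y"
      using add_mult_distrib_mat[OF mult_carrier_mat[OF c(6) c(7)] c(9) Y] by simp
    then show ?thesis unfolding assoc_mult_mat[OF c(6) c(7) Y] LY .
  qed
  finally have 1: "rmat_poly P * (rmat_poly E * W) * rmat_poly Q =
     rmat_poly T' * rmat_const B + rmat_const C * Y + rmat_poly (P * E) * rmat_poly T" .
  have EW: "rmat_poly E * W \<in> carrier_mat p m" using c W by simp
  have Bc: "pmat_const B \<in> carrier_mat d m" using B by simp
  have X1: "P * X0 * Q \<in> carrier_mat p m" by (rule mult_carrier_mat[OF mult_carrier_mat[OF P X0] Q])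
  have X2: "P * E * T \<in> carrier_mat p m" by (rule mult_carrier_mat[OF PE T])
  have X3: "T' * pmat_const B \<in> carrier_mat p m" by (rule mult_carrier_mat[OF T' Bc])
  have "G = rmat_poly P * rmat_poly X0 * rmat_poly Q + rmat_poly P * (rmat_poly E * W) * rmat_poly Q"
    unfolding PQ D mult_add_distrib_mat[OF c(1) c(4) EW]
    by (rule add_mult_distrib_mat[of _ p m]) (use c EW in simp_all)
  also have "\<dots> = ((rmat_poly P * rmat_poly X0 * rmat_poly Q + rmat_poly (P * E) * rmat_poly T) +
      rmat_poly T' * rmat_const B) + rmat_const C * Y"
  proof -
    have r: "a + ((b + x) + y) = ((a + y) + b) + x"
      if "a \<in> carrier_mat p m" "b \<in> carrier_mat p m" "x \<in> carrier_mat p m" "y \<in> carrier_mat p m"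
      for a b x y :: "ratfun mat"
      using that by (intro eq_matI) auto
    show ?thesis
      unfolding 1
    proof (rule r)
      show "rmat_poly P * rmat_poly X0 * rmat_poly Q \<in> carrier_mat p m"
        by (rule mult_carrier_mat[OF mult_carrier_mat[OF c(1) c(4)] c(2)])
      show "rmat_poly T' * rmat_const B \<in> carrier_mat p m" by (rule mult_carrier_mat[OF c(6) c(8)])
      show "rmat_const C * Y \<in> carrier_mat p m" by (rule mult_carrier_mat[OF c(9) Y])
      show "rmat_poly (P * E) * rmat_poly T \<in> carrier_mat p m"
        by (rule mult_carrier_mat[OF _ c(5)]) (simp add: PE)
    qed
  qed
  also have "rmat_poly P * rmat_poly X0 * rmat_poly Q + rmat_poly (P * E) * rmat_poly T
      + rmat_poly T' * rmat_const B = rmat_poly X"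
  proof -
    have 2: "rmat_poly (P * X0 * Q) = rmat_poly P * rmat_poly X0 * rmat_poly Q"
      unfolding rmat_poly_mult[OF mult_carrier_mat[OF P X0] Q] rmat_poly_mult[OF P X0] ..
    have 3: "rmat_poly (T' * pmat_const B) = rmat_poly T' * rmat_const B"
      using rmat_poly_mult[OF T' Bc] by simp
    show ?thesis
      unfolding X_def rmat_poly_add[OF add_carrier_mat[OF X2] X3] rmat_poly_add[OF X1 X2]
        2 3 rmat_poly_mult[OF PE T] ..
  qed
  finally have "G = rmat_poly X + rmat_const C * Y" .
  moreover have "X \<in> carrier_mat p m"
    unfolding X_def by (rule add_carrier_mat[OF X3])
  ultimately show ?thesis by (rule that[OF S B C _ Y LY, rotated])
qed

section \<open>Markov parameters\<close>

text \<open>The recursive form of the state equation. It needs no inverse of \<open>z - S\<close>,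
  and the limit and regularity arguments below start from it.\<close>

lemma pencil_solution_entry:
  assumes S: "S \<in> carrier_mat d d" and Y: "Y \<in> carrier_mat d m" and B: "B \<in> carrier_mat d m"
    and LY: "rmat_poly (lin_pencil (1\<^sub>m d) S) * Y = rmat_const B"
  shows "rat_z \<cdot>\<^sub>m Y = rmat_const S * Y + rmat_const B"
proof -
  have pen: "rmat_poly (lin_pencil (1\<^sub>m d) S) = rat_z \<cdot>\<^sub>m 1\<^sub>m d - rmat_const S"
    using rmat_lin_pencil[OF one_carrier_mat S] by simp
  have "rmat_const B = rat_z \<cdot>\<^sub>m Y - rmat_const S * Y"
    using S Y LY[symmetric] unfolding pen
    by (simp add: minus_mult_distrib_mat[of _ d d _ _ m] mult_smult_assoc_mat[of _ d d _ m])
  moreover have "rmat_const S * Y \<in> carrier_mat d m" "rat_z \<cdot>\<^sub>m Y \<in> carrier_mat d m"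
    using S Y by (auto intro!: mult_carrier_mat)
  moreover have "b = c + a" if "a = b - c" "b \<in> carrier_mat d m" "c \<in> carrier_mat d m" for a b c :: "ratfun mat"
    using that by (intro eq_matI) auto
  ultimately show ?thesis by blast
qed

lemma const_combination_at:
  fixes a :: "nat \<Rightarrow> complex"
  assumes "\<And>u. u < d \<Longrightarrow> regular_at x (y u)"
  shows "regular_at x (\<Sum>u<d. rat_const (a u) * y u)"
    and "rat_eval (\<Sum>u<d. rat_const (a u) * y u) x = (\<Sum>u<d. a u * rat_eval (y u) x)"
proof -
  have r: "regular_at x (rat_const (a u) * y u)" if "u \<in> {..<d}" for u
    using assms that by simp
  show "regular_at x (\<Sum>u<d. rat_const (a u) * y u)" by (rule sum_at(1)[OF r])
  have "rat_eval (\<Sum>u<d. rat_const (a u) * y u) x = (\<Sum>u<d. rat_eval (rat_const (a u) * y u) x)"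
    by (rule sum_at(2)[OF r])
  also have "\<dots> = (\<Sum>u<d. a u * rat_eval (y u) x)"
    using assms by (intro sum.cong) auto
  finally show "rat_eval (\<Sum>u<d. rat_const (a u) * y u) x = \<dots>" .
qed

text \<open>From \<open>z Y = S Y + B\<close> the entries of a column satisfy \<open>|z| h \<le> s h + b\<close> for
  \<open>h(z) = \<Sum>\<^sub>i |Y\<^sub>i(z)|\<close>.\<close>

lemma pencil_solution_tendsto_0:
  assumes S: "S \<in> carrier_mat d d" and Y: "Y \<in> carrier_mat d m" and B: "B \<in> carrier_mat d m"
    and eq: "rat_z \<cdot>\<^sub>m Y = rmat_const S * Y + rmat_const B"
    and i: "i < d" and j: "j < m"
  shows "(rat_eval (Y $$ (i, j)) \<longlongrightarrow> 0) at_infinity"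
proof -
  define y where "y t x = rat_eval (Y $$ (t, j)) x" for t x
  define h where "h x = (\<Sum>t<d. cmod (y t x))" for x
  define s where "s = (\<Sum>t<d. \<Sum>u<d. cmod (S $$ (t, u)))"
  define b where "b = (\<Sum>t<d. cmod (B $$ (t, j)))"
  have entry: "rat_z * Y $$ (t, j) = (\<Sum>u<d. rat_const (S $$ (t, u)) * Y $$ (u, j)) + rat_const (B $$ (t, j))"
    if "t < d" for t
  proof -
    have "(rat_z \<cdot>\<^sub>m Y) $$ (t, j) = (rmat_const S * Y + rmat_const B) $$ (t, j)" by (simp only: eq)
    then show ?thesis using that j S Y B by (simp add: scalar_prod_def atLeast0LessThan)
  qed
  have "eventually (\<lambda>x. \<forall>t\<in>{..<d}. regular_at x (Y $$ (t, j))) at_infinity"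
    by (intro eventually_ball_finite ballI finite_lessThan eventually_regular_at_infinity)
  \<comment> \<open>With \<open>cmod x \<ge> s + 1\<close> the difference \<open>cmod x - s\<close>
    is at least \<open>1\<close>, so that the inequality can be solved for
    \<open>h x\<close>.\<close>
  moreover have "eventually (\<lambda>x::complex. s + 1 \<le> norm x) at_infinity"
    unfolding eventually_at_infinity by blast
  ultimately have bound: "eventually (\<lambda>x. norm (y i x) \<le> b * inverse (norm x - s)) at_infinity"
  proof eventually_elim
    case (elim x)
    have "cmod x * cmod (y t x) \<le> (\<Sum>u<d. cmod (S $$ (t, u))) * h x + cmod (B $$ (t, j))" if "t < d" for t
    proof -
      have "x * y t x = rat_eval (rat_z * Y $$ (t, j)) x"
        unfolding y_def using elim that by simp
      also have "\<dots> = (\<Sum>u<d. S $$ (t, u) * y u x) + B $$ (t, j)"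
        unfolding entry[OF that] y_def using elim
        by (subst add_at(2)) (auto simp: const_combination_at)
      finally have "cmod x * cmod (y t x) = cmod ((\<Sum>u<d. S $$ (t, u) * y u x) + B $$ (t, j))"
        by (metis norm_mult)
      also have "\<dots> \<le> (\<Sum>u<d. cmod (S $$ (t, u)) * cmod (y u x)) + cmod (B $$ (t, j))"
        by (intro norm_triangle_le add_mono sum_norm_le) (simp_all add: norm_mult)
      also have "(\<Sum>u<d. cmod (S $$ (t, u)) * cmod (y u x)) \<le> (\<Sum>u<d. cmod (S $$ (t, u)) * h x)"
        unfolding h_def by (intro sum_mono mult_left_mono member_le_sum) auto
      finally show ?thesis by (simp add: sum_distrib_right)
    qed
    then have "(\<Sum>t<d. cmod x * cmod (y t x)) \<le>
        (\<Sum>t<d. (\<Sum>u<d. cmod (S $$ (t, u))) * h x + cmod (B $$ (t, j)))"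
      by (intro sum_mono) simp
    moreover have "(\<Sum>t<d. (\<Sum>u<d. cmod (S $$ (t, u))) * h x + cmod (B $$ (t, j))) = s * h x + b"
      by (simp add: s_def b_def sum.distrib sum_distrib_right)
    ultimately have "cmod x * h x \<le> s * h x + b"
      by (simp add: h_def[of x] sum_distrib_left)
    then have "h x * (norm x - s) \<le> b" by (simp add: algebra_simps)
    then have "h x \<le> b * inverse (norm x - s)" using elim by (simp add: field_simps)
    moreover have "norm (y i x) \<le> h x"
      unfolding h_def using i by (intro member_le_sum) auto
    ultimately show ?case by simp
  qed
  have "filterlim (\<lambda>x::complex. - s + norm x) at_top at_infinity"
    by (rule filterlim_tendsto_add_at_top[OF tendsto_const filterlim_norm_at_top])
  then have "filterlim (\<lambda>x::complex. norm x - s) at_top at_infinity" by simp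
  then have "((\<lambda>x::complex. b * inverse (norm x - s)) \<longlongrightarrow> b * 0) at_infinity"
    by (intro tendsto_mult tendsto_const tendsto_inverse_0_at_top)
  then have "((\<lambda>x::complex. b * inverse (norm x - s)) \<longlongrightarrow> 0) at_infinity" by simp
  moreover from bound have "eventually (\<lambda>x. norm (y i x) \<le> norm (b * inverse (norm x - s)) * 1) at_infinity"
    by eventually_elim auto
  ultimately have "(y i \<longlongrightarrow> 0) at_infinity" by (rule tendsto_0_le)
  then show ?thesis by (simp add: y_def[abs_def])
qed

lemma const_mult_tendsto_0:
  assumes C: "C \<in> carrier_mat p d" and Y: "Y \<in> carrier_mat d m"
    and lim: "\<And>t. t < d \<Longrightarrow> (rat_eval (Y $$ (t, j)) \<longlongrightarrow> 0) at_infinity"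
    and ij: "i < p" "j < m"
  shows "(rat_eval ((rmat_const C * Y) $$ (i, j)) \<longlongrightarrow> 0) at_infinity"
proof -
  have "eventually (\<lambda>x. \<forall>t\<in>{..<d}. regular_at x (Y $$ (t, j))) at_infinity"
    by (intro eventually_ball_finite ballI finite_lessThan eventually_regular_at_infinity)
  then have "eventually (\<lambda>x. (\<Sum>t<d. C $$ (i, t) * rat_eval (Y $$ (t, j)) x) =
      rat_eval ((rmat_const C * Y) $$ (i, j)) x) at_infinity"
    by eventually_elim (use C Y ij in \<open>simp add: scalar_prod_def atLeast0LessThan const_combination_at\<close>)
  moreover have "((\<lambda>x. \<Sum>t<d. C $$ (i, t) * rat_eval (Y $$ (t, j)) x) \<longlongrightarrow> (\<Sum>t<d. C $$ (i, t) * 0)) at_infinity"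
    by (intro tendsto_sum tendsto_mult tendsto_const lim) simp
  ultimately show ?thesis by (simp add: tendsto_cong)
qed

text \<open>Both \<open>G\<close> and \<open>C Y\<close> decay at infinity, so the polynomial matrix
  \<open>X\<close>, being their difference, does too and must vanish.\<close>

lemma strictly_proper_realization:
  assumes "has_total_polar_degree G d" and G: "G \<in> carrier_mat p m" and sp: "strictly_proper G"
  obtains S B C Y where "S \<in> carrier_mat d d" "B \<in> carrier_mat d m" "C \<in> carrier_mat p d"
    "Y \<in> carrier_mat d m"
    "rmat_poly (lin_pencil (1\<^sub>m d) S) * Y = rmat_const B" "G = rmat_const C * Y"
proof -
  from assms(1) G obtain S B C X Y where S: "S \<in> carrier_mat d d" and B: "B \<in> carrier_mat d m"
    and C: "C \<in> carrier_mat p d" and X: "X \<in> carrier_mat p m" and Y: "Y \<in> carrier_mat d m"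
    and LY: "rmat_poly (lin_pencil (1\<^sub>m d) S) * Y = rmat_const B" and GX: "G = rmat_poly X + rmat_const C * Y"
    by (rule smith_mcmillan_realization)
  have CY: "rmat_const C * Y \<in> carrier_mat p m" using C Y by (auto intro!: mult_carrier_mat)
  have "X $$ (i, j) = 0" if ij: "i < p" "j < m" for i j
  proof (rule poly_tendsto_0_imp_0)
    let ?g = "G $$ (i, j)" and ?y = "(rmat_const C * Y) $$ (i, j)"
    have "?g = rmat_poly X $$ (i, j) + ?y"
      unfolding GX by (rule index_add_mat) (use CY ij in auto)
    then have x: "to_fract (X $$ (i, j)) = ?g - ?y" using X ij by simp
    have "(rat_eval ?y \<longlongrightarrow> 0) at_infinity"
      by (rule const_mult_tendsto_0[OF C Y pencil_solution_tendsto_0 ij])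
        (use S Y B ij pencil_solution_entry[OF S Y B LY] in auto)
    moreover have "(rat_eval ?g \<longlongrightarrow> 0) at_infinity"
      using sp ij G unfolding strictly_proper_def by auto
    ultimately have "((\<lambda>x. rat_eval ?g x - rat_eval ?y x) \<longlongrightarrow> 0) at_infinity"
      using tendsto_diff by fastforce
    moreover have "eventually (\<lambda>x. rat_eval ?g x - rat_eval ?y x = poly (X $$ (i, j)) x) at_infinity"
      using eventually_regular_at_infinity[of ?g] eventually_regular_at_infinity[of ?y]
      by eventually_elim (metis diff_at(2) to_fract_at(2) x)
    ultimately show "(poly (X $$ (i, j)) \<longlongrightarrow> 0) at_infinity" by (simp add: tendsto_cong)
  qed
  then have "rmat_poly X = 0\<^sub>m p m" using X by (intro eq_matI) auto
  then have "G = rmat_const C * Y" unfolding GX using left_add_zero_mat[OF CY] by simp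
  then show ?thesis using that S B C Y LY by blast
qed

text \<open>One step of reading off coefficients: multiplication by \<open>z\<close> makes the
  leading coefficient \<open>a 0\<close> a limit, and its removal leaves an expansion of the same
  kind, shifted by one.\<close>

lemma expansion_shift:
  fixes a :: "nat \<Rightarrow> complex"
  assumes "eventually (\<lambda>z. (\<lambda>l. a l / z ^ Suc l) sums g z) at_infinity"
  shows "((\<lambda>z. z * g z) \<longlongrightarrow> a 0) at_infinity"
    and "eventually (\<lambda>z. (\<lambda>l. a (Suc l) / z ^ Suc l) sums (z * g z - a 0)) at_infinity"
proof -
  from assms obtain b where b: "\<And>z. b \<le> cmod z \<Longrightarrow> (\<lambda>l. a l / z ^ Suc l) sums g z"
    unfolding eventually_at_infinity by blast
  define r where "r = max b 1"
  have zg: "(\<lambda>l. a l / z ^ l) sums (z * g z)" if "r \<le> cmod z" for z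
  proof -
    have "z \<noteq> 0" using that by (auto simp: r_def)
    have "(\<lambda>l. z * (a l / z ^ Suc l)) sums (z * g z)"
      using that by (intro sums_mult b) (simp add: r_def)
    then show ?thesis using \<open>z \<noteq> 0\<close> by simp
  qed
  \<comment> \<open>The function \<open>z g(z)\<close> in the variable \<open>w = 1/z\<close>,
    completed at \<open>w = 0\<close> by the constant term of its power series, so that continuity
    of power series at \<open>0\<close> gives the limit.\<close>
  define h where "h w = (if w = 0 then a 0 else inverse w * g (inverse w))" for w
  have "(h \<longlongrightarrow> a 0) (at 0)"
  proof (rule powser_limit_0)
    show "0 < inverse r" by (simp add: r_def)
    fix w :: complex assume w: "norm w < inverse r"
    show "(\<lambda>n. a n * w ^ n) sums h w"
    proof (cases "w = 0")
      case True
      then show ?thesis using powser_sums_zero[of a] by (simp add: h_def)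
    next
      case False
      have "inverse (inverse r) \<le> inverse (cmod w)"
        using w False by (intro le_imp_inverse_le) auto
      then have "r \<le> cmod (inverse w)" by (simp add: norm_inverse)
      from zg[OF this] False show ?thesis by (simp add: h_def field_simps)
    qed
  qed
  moreover have l: "filterlim (\<lambda>x::complex. inverse x) (at 0) at_infinity"
    by (simp add: filterlim_inverse_at_iff filterlim_ident)
  ultimately have "((\<lambda>z. h (inverse z)) \<longlongrightarrow> a 0) at_infinity" by (rule filterlim_compose)
  moreover have "eventually (\<lambda>z. h (inverse z) = z * g z) at_infinity"
    unfolding eventually_at_infinity by (rule exI[of _ 1]) (auto simp: h_def)
  ultimately show "((\<lambda>z. z * g z) \<longlongrightarrow> a 0) at_infinity" by (simp add: tendsto_cong)
  have "(\<lambda>l. a (Suc l) / z ^ Suc l) sums (z * g z - a 0)" if "r \<le> cmod z" for z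
    using zg[OF that] by (subst sums_Suc_iff) simp
  then show "eventually (\<lambda>z. (\<lambda>l. a (Suc l) / z ^ Suc l) sums (z * g z - a 0)) at_infinity"
    unfolding eventually_at_infinity by blast
qed

lemma pow_mat_comm:
  assumes S: "S \<in> carrier_mat d d"
  shows "S * S ^\<^sub>m l = S ^\<^sub>m l * S"
proof (induction l)
  case (Suc l)
  have "S * (S ^\<^sub>m l * S) = S * S ^\<^sub>m l * S"
    by (rule assoc_mult_mat[OF S pow_carrier_mat[OF S] S, symmetric])
  then show ?case using Suc by simp
qed (use S in simp)

text \<open>Multiplication by \<open>z\<close> amounts to replacing the output matrix
  \<open>C\<close> by \<open>C * S\<close>, up to the constant \<open>C * B\<close>.\<close>

lemma realization_step:
  assumes S: "S \<in> carrier_mat d d" and Y: "Y \<in> carrier_mat d m" and B: "B \<in> carrier_mat d m"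
    and eq: "rat_z \<cdot>\<^sub>m Y = rmat_const S * Y + rmat_const B"
    and C: "C \<in> carrier_mat p d"
  shows "rat_z \<cdot>\<^sub>m (rmat_const C * Y) = rmat_const (C * S) * Y + rmat_const (C * B)"
proof -
  have c: "rmat_const C \<in> carrier_mat p d" "rmat_const S \<in> carrier_mat d d" "rmat_const B \<in> carrier_mat d m"
    using C S B by simp_all
  have "rat_z \<cdot>\<^sub>m (rmat_const C * Y) = rmat_const C * (rat_z \<cdot>\<^sub>m Y)"
    using mult_smult_distrib[OF c(1) Y] by simp
  also have "\<dots> = rmat_const C * (rmat_const S * Y) + rmat_const C * rmat_const B"
    unfolding eq by (rule mult_add_distrib_mat[OF c(1) mult_carrier_mat[OF c(2) Y] c(3)])
  also have "\<dots> = rmat_const (C * S) * Y + rmat_const (C * B)"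
    unfolding rmat_const_mult[OF C S] rmat_const_mult[OF C B] assoc_mult_mat[OF c(1) c(2) Y] ..
  finally show ?thesis .
qed

text \<open>The coefficient of \<open>1/z\<close> in \<open>C Y\<close> is the limit of
  \<open>z C Y = (C S) Y + C B\<close>, that is \<open>C B\<close>, because \<open>Y\<close> decays.
  Once it is removed, the shifted coefficients belong to the output matrix \<open>C * S\<close>;
  hence the induction generalizes over \<open>C\<close> and \<open>c\<close>.\<close>

lemma markov_parameters:
  assumes S: "S \<in> carrier_mat d d" and Y: "Y \<in> carrier_mat d m" and B: "B \<in> carrier_mat d m"
    and eq: "rat_z \<cdot>\<^sub>m Y = rmat_const S * Y + rmat_const B"
    and C: "C \<in> carrier_mat p d"
    and ex: "\<forall>i<p. \<forall>j<m. \<forall>\<^sub>F z in at_infinity.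
        (\<lambda>l. c l $$ (i, j) / z ^ Suc l) sums rat_eval ((rmat_const C * Y) $$ (i, j)) z"
    and ij: "i < p" "j < m"
  shows "c l $$ (i, j) = (C * S ^\<^sub>m l * B) $$ (i, j)"
proof -
  have step: "rat_z * (rmat_const C * Y) $$ (i, j) =
      (rmat_const (C * S) * Y) $$ (i, j) + rat_const ((C * B) $$ (i, j))"
    if C: "C \<in> carrier_mat p d" for C
  proof -
    have "(rat_z \<cdot>\<^sub>m (rmat_const C * Y)) $$ (i, j) = (rmat_const (C * S) * Y + rmat_const (C * B)) $$ (i, j)"
      by (simp only: realization_step[OF S Y B eq C])
    then show ?thesis using C S Y B ij by simp
  qed
  have ev: "eventually (\<lambda>x. x * rat_eval ((rmat_const C * Y) $$ (i, j)) x =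
      rat_eval ((rmat_const (C * S) * Y) $$ (i, j)) x + (C * B) $$ (i, j)) at_infinity"
    if C: "C \<in> carrier_mat p d" for C
    using eventually_regular_at_infinity[of "(rmat_const C * Y) $$ (i, j)"]
      eventually_regular_at_infinity[of "(rmat_const (C * S) * Y) $$ (i, j)"]
  proof eventually_elim
    case (elim x)
    have "rat_eval (rat_z * (rmat_const C * Y) $$ (i, j)) x =
        rat_eval ((rmat_const (C * S) * Y) $$ (i, j) + rat_const ((C * B) $$ (i, j))) x"
      by (simp only: step[OF C])
    then show ?case using elim by (simp only: mult_at(2) add_at(2) rat_z_at const_at)
  qed
  have first: "c 0 $$ (i, j) = (C * B) $$ (i, j)"
    if C: "C \<in> carrier_mat p d"
      and ex: "\<forall>\<^sub>F z in at_infinity. (\<lambda>l. c l $$ (i, j) / z ^ Suc l) sums rat_eval ((rmat_const C * Y) $$ (i, j)) z"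
    for C c
  proof -
    have CS: "C * S \<in> carrier_mat p d" using C S by auto
    have "(rat_eval ((rmat_const (C * S) * Y) $$ (i, j)) \<longlongrightarrow> 0) at_infinity"
      by (rule const_mult_tendsto_0[OF CS Y pencil_solution_tendsto_0[OF S Y B eq] ij]) (use ij in auto)
    then have "((\<lambda>x. rat_eval ((rmat_const (C * S) * Y) $$ (i, j)) x + (C * B) $$ (i, j)) \<longlongrightarrow>
        0 + (C * B) $$ (i, j)) at_infinity"
      by (intro tendsto_add tendsto_const)
    then have "((\<lambda>x. x * rat_eval ((rmat_const C * Y) $$ (i, j)) x) \<longlongrightarrow> (C * B) $$ (i, j)) at_infinity"
      using tendsto_cong[OF ev[OF C]] by simp
    from tendsto_unique[OF at_infinity_neq_bot expansion_shift(1)[OF ex] this] show ?thesis .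
  qed
  have ex: "\<forall>\<^sub>F z in at_infinity. (\<lambda>l. c l $$ (i, j) / z ^ Suc l) sums rat_eval ((rmat_const C * Y) $$ (i, j)) z"
    using ex ij by simp
  show ?thesis using C ex
  proof (induction l arbitrary: C c)
    case 0
    then show ?case using first S by simp
  next
    case (Suc l)
    have CS: "C * S \<in> carrier_mat p d" using Suc.prems S by auto
    have c0: "c 0 $$ (i, j) = (C * B) $$ (i, j)" using first Suc.prems by blast
    have "\<forall>\<^sub>F z in at_infinity. (\<lambda>l. c (Suc l) $$ (i, j) / z ^ Suc l) sums
        rat_eval ((rmat_const (C * S) * Y) $$ (i, j)) z"
      using expansion_shift(2)[OF Suc.prems(2)] ev[OF Suc.prems(1)]
      by eventually_elim (simp add: c0)
    from Suc.IH[OF CS, of "\<lambda>l. c (Suc l)", OF this]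
    have "c (Suc l) $$ (i, j) = (C * S * S ^\<^sub>m l * B) $$ (i, j)" .
    also have "C * S * S ^\<^sub>m l = C * (S ^\<^sub>m l * S)"
      unfolding pow_mat_comm[OF S, symmetric]
      by (rule assoc_mult_mat[OF Suc.prems(1) S pow_carrier_mat[OF S]])
    finally show ?case by simp
  qed
qed

section \<open>Constant matrices\<close>

interpretation cnj: comm_ring_hom cnj
  by unfold_locales simp_all

lemma mat_adjoint_eq: "mat_adjoint (A :: complex mat) = map_mat cnj (A\<^sup>T)"
  by (rule eq_matI) (auto simp: mat_adjoint_def mat_of_rows_def)

lemma adjoint_dims [simp]:
  "dim_row (mat_adjoint (A :: complex mat)) = dim_col A"
  "dim_col (mat_adjoint (A :: complex mat)) = dim_row A"
  by (simp_all add: mat_adjoint_eq)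

lemma adjoint_index [simp]:
  "i < dim_col A \<Longrightarrow> j < dim_row A \<Longrightarrow> mat_adjoint (A :: complex mat) $$ (i, j) = cnj (A $$ (j, i))"
  by (simp add: mat_adjoint_eq)

lemma adjoint_carrier [simp]:
  "mat_adjoint (A :: complex mat) \<in> carrier_mat n k \<longleftrightarrow> A \<in> carrier_mat k n"
  by (simp only: carrier_mat_def mem_Collect_eq adjoint_dims conj_commute)

lemma adjoint_adjoint [simp]: "mat_adjoint (mat_adjoint A) = (A :: complex mat)"
  by (rule eq_matI) simp_all

lemma adjoint_mult:
  fixes A B :: "complex mat"
  assumes "A \<in> carrier_mat n k" "B \<in> carrier_mat k l"
  shows "mat_adjoint (A * B) = mat_adjoint B * mat_adjoint A"
  unfolding mat_adjoint_eq transpose_mult[OF assms]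
  by (rule cnj.mat_hom_mult[of _ l k _ n]) (use assms in simp_all)

lemma map_mat_cnj_adjoint: "map_mat cnj (mat_adjoint A) = A\<^sup>T"
  and transpose_adjoint: "(mat_adjoint A)\<^sup>T = map_mat cnj A" for A :: "complex mat"
  by (rule eq_matI; simp)+

lemma det_adjoint:
  assumes "A \<in> carrier_mat n n"
  shows "det (mat_adjoint A) = cnj (det (A :: complex mat))"
proof -
  have "det (mat_adjoint A) = cnj (det (A\<^sup>T))"
    unfolding mat_adjoint_eq by (rule cnj.hom_det)
  then show ?thesis by (simp add: det_transpose[OF assms])
qed

lemma inverse_if_det_nonzero:
  fixes A :: "'a :: field mat"
  assumes A: "A \<in> carrier_mat n n" and "det A \<noteq> 0"
  obtains B where "B \<in> carrier_mat n n" "A * B = 1\<^sub>m n" "B * A = 1\<^sub>m n"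
  using det_non_zero_imp_unit[OF assms, of "()"] that
  by (auto simp: Units_def ring_mat_def)

lemma det_nonzero_if_right_inverse:
  fixes A :: "'a :: field mat"
  assumes "A \<in> carrier_mat n n" "B \<in> carrier_mat n n" "A * B = 1\<^sub>m n"
  shows "det A \<noteq> 0"
  using det_mult[OF assms(1,2)] assms(3) by auto

lemma det_nonzero_mult_vec_0:
  fixes A :: "'a :: field mat"
  assumes "A \<in> carrier_mat n n" "det A \<noteq> 0" "v \<in> carrier_vec n" "A *\<^sub>v v = 0\<^sub>v n"
  shows "v = 0\<^sub>v n"
  using assms det_0_iff_vec_prod_zero_field[OF assms(1)] by auto

text \<open>The \<open>the\<close> in \<open>rmat_inverse\<close> is harmless here: a nonzero
  determinant makes \<open>mat_inverse\<close> return a value.\<close>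

lemma rmat_inverse:
  assumes A: "A \<in> carrier_mat n n" and "det A \<noteq> 0"
  shows "rmat_inverse A \<in> carrier_mat n n" "A * rmat_inverse A = 1\<^sub>m n" "rmat_inverse A * A = 1\<^sub>m n"
proof -
  obtain B where "mat_inverse A = Some B"
    using mat_inverse(1)[OF A, of "()"] det_non_zero_imp_unit[OF assms, of "()"] by (cases "mat_inverse A") auto
  then show "rmat_inverse A \<in> carrier_mat n n" "A * rmat_inverse A = 1\<^sub>m n" "rmat_inverse A * A = 1\<^sub>m n"
    using mat_inverse(2)[OF A] by (auto simp: rmat_inverse_def)
qed

text \<open>A known solution of \<open>A Y = B\<close> replaces the inverse, so that transfer
  functions are found without computing inverses of pencils.\<close>

lemma rmat_inverse_mult:
  assumes A: "A \<in> carrier_mat n n" and d: "det A \<noteq> 0" and Y: "Y \<in> carrier_mat n k" and e: "A * Y = B"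
  shows "rmat_inverse A * B = Y"
  unfolding e[symmetric] assoc_mult_mat[OF rmat_inverse(1)[OF A d] A Y, symmetric] rmat_inverse(3)[OF A d]
  by (rule left_mult_one_mat[OF Y])

lemma det_rmat_poly:
  "det (rmat_poly P) = to_fract (det P)"
  unfolding rmat_poly_def by (rule to_fract_hom.hom_det)

lemma det_pmat_eval:
  "det (pmat_eval P x) = poly (det P) x"
  unfolding pmat_eval_def by (rule comm_ring_hom.hom_det) (unfold_locales, simp_all)

lemma full_col_rankI:
  assumes M: "M \<in> carrier_mat n k"
    and inj: "\<And>v. v \<in> carrier_vec k \<Longrightarrow> M *\<^sub>v v = 0\<^sub>v n \<Longrightarrow> v = 0\<^sub>v k"
  shows "full_col_rank M"
proof -
  interpret vec_space "TYPE(complex)" n .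
  have unit: "M *\<^sub>v unit_vec k i = col M i" if "i < k" for i
    using that M by (intro eq_vecI) auto
  \<comment> \<open>The rank concerns the set of columns, so repetitions must be excluded
    separately; two equal columns would put the difference of two unit vectors into the
    kernel.\<close>
  have "distinct (cols M)"
  proof (unfold distinct_conv_nth, intro allI impI)
    fix i j assume ij: "i < length (cols M)" "j < length (cols M)" "i \<noteq> j"
    then have k: "i < k" "j < k" using M by auto
    show "cols M ! i \<noteq> cols M ! j"
    proof
      assume "cols M ! i = cols M ! j"
      then have "M *\<^sub>v unit_vec k i = M *\<^sub>v unit_vec k j" using unit k M by simp
      then have "M *\<^sub>v (unit_vec k i - unit_vec k j) = 0\<^sub>v n"
        using M by (subst mult_minus_distrib_mat_vec[of _ n k]) auto
      then have "unit_vec k i - unit_vec k j = (0\<^sub>v k :: complex vec)" by (intro inj) auto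
      then have "(unit_vec k i - unit_vec k j :: complex vec) $ i = 0\<^sub>v k $ i" by (rule arg_cong)
      then show False using k ij by simp
    qed
  qed
  moreover have "lin_indpt (set (cols M))"
  proof
    assume "lin_dep (set (cols M))"
    from lin_depE[OF M this calculation] obtain v where "v \<in> carrier_vec k" "v \<noteq> 0\<^sub>v k" "M *\<^sub>v v = 0\<^sub>v n"
      by blast
    then show False using inj by blast
  qed
  ultimately have "rank M = k" using lin_indpt_full_rank[OF M] by blast
  then show ?thesis using M by (simp add: full_col_rank_def mat_rank_def)
qed

text \<open>If \<open>M\<close> has no left null vector then \<open>M M\<^sup>*\<close> is injective, hence invertible, so the columns
  of \<open>M\<close> span the whole space.\<close>

lemma full_row_rankI:
  assumes M: "M \<in> carrier_mat n k"
    and inj: "\<And>v. v \<in> carrier_vec n \<Longrightarrow> M\<^sup>T *\<^sub>v v = 0\<^sub>v k \<Longrightarrow> v = 0\<^sub>v n"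
  shows "full_row_rank M"
proof -
  interpret vec_space "TYPE(complex)" n .
  let ?G = "M * mat_adjoint M"
  have Ma: "mat_adjoint M \<in> carrier_mat k n" using M by simp
  have G: "?G \<in> carrier_mat n n" by (rule mult_carrier_mat[OF M Ma])
  have "det ?G \<noteq> 0"
  proof
    assume "det ?G = 0"
    then obtain v where v: "v \<in> carrier_vec n" "v \<noteq> 0\<^sub>v n" "?G *\<^sub>v v = 0\<^sub>v n"
      using det_0_iff_vec_prod_zero_field[OF G] by blast
    define w where "w = mat_adjoint M *\<^sub>v v"
    have w: "w \<in> carrier_vec k" using mult_mat_vec_carrier[OF Ma v(1)] by (simp add: w_def)
    have Mw: "M *\<^sub>v w = 0\<^sub>v n" using v(3) assoc_mult_mat_vec[OF M Ma v(1)] by (simp add: w_def)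
    have cw: "conjugate w = M\<^sup>T *\<^sub>v conjugate v"
      using M v(1) by (intro eq_vecI) (auto simp: w_def scalar_prod_def)
    \<comment> \<open>The squared norm of \<open>w\<close>, the adjoint of \<open>M\<close> applied
      to \<open>v\<close>; moving \<open>M\<close> to the other side produces
      \<open>M *\<^sub>v w\<close>, which is zero.\<close>
    have "w \<bullet> conjugate w = (M\<^sup>T *\<^sub>v conjugate v) \<bullet> w"
      unfolding cw using comm_scalar_prod[OF w] M v(1) by simp
    also have "\<dots> = conjugate v \<bullet> (M *\<^sub>v w)"
      using transpose_vec_mult_scalar[OF M w, of "conjugate v"] v(1) by simp
    also have "\<dots> = 0" using v(1) by (simp add: Mw)
    finally have "w = 0\<^sub>v k" using conjugate_square_eq_0_vec[OF w] by simp
    then have "conjugate w = 0\<^sub>v k" by simp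
    then have "M\<^sup>T *\<^sub>v conjugate v = 0\<^sub>v k" using cw by simp
    then have "conjugate v = 0\<^sub>v n" using inj[of "conjugate v"] v(1) by simp
    then show False using v(2) by (metis conjugate_id conjugate_zero_vec)
  qed
  then obtain B where B: "B \<in> carrier_mat n n" "?G * B = 1\<^sub>m n" using inverse_if_det_nonzero[OF G] by metis
  have "u \<in> span (set (cols M))" if u: "u \<in> carrier_vec n" for u
  proof -
    define w where "w = mat_adjoint M *\<^sub>v (B *\<^sub>v u)"
    have w: "w \<in> carrier_vec k"
      unfolding w_def by (rule mult_mat_vec_carrier[OF Ma mult_mat_vec_carrier[OF B(1) u]])
    have "M *\<^sub>v w = (?G * B) *\<^sub>v u"
      unfolding w_def using assoc_mult_mat_vec[OF M Ma mult_mat_vec_carrier[OF B(1) u]]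
        assoc_mult_mat_vec[OF G B(1) u] by simp
    then have "u = M *\<^sub>v w" using u B by simp
    then show ?thesis
      using col_space_eq[OF M] w M u by (auto simp: col_space_def)
  qed
  then have full: "span (set (cols M)) = carrier_vec n"
    using span_closed[of "set (cols M)"] cols_dim[of M] M by auto
  have whole: "vs (carrier_vec n) = V" by (simp add: module_vec_def)
  have "rank M = n" unfolding rank_def full whole by (rule dim_is_n)
  then show ?thesis using M by (simp add: full_row_rank_def mat_rank_def)
qed

section \<open>Block Hankel matrices\<close>

text \<open>The observability matrix, with blocks \<open>C\<close>, \<open>C S\<close>,
  \<open>C S^2\<close> and so on. The controllability matrix is written as the transpose of the
  observability matrix of the transposed system, so each fact about observability serves
  twice.\<close>

definition obs_mat :: "nat \<Rightarrow> nat \<Rightarrow> complex mat \<Rightarrow> complex mat \<Rightarrow> complex mat" where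
  "obs_mat k m C S = mat (k * m) (dim_col C) (\<lambda>(i, j). (C * S ^\<^sub>m (i div m)) $$ (i mod m, j))"

lemma obs_mat_carrier [simp]:
  "C \<in> carrier_mat p d \<Longrightarrow> obs_mat k m C S \<in> carrier_mat (k * m) d"
  by (simp add: obs_mat_def)

lemma row_obs_mat:
  assumes "S \<in> carrier_mat d d" "C \<in> carrier_mat m d" "i < k * m"
  shows "row (obs_mat k m C S) i = row (C * S ^\<^sub>m (i div m)) (i mod m)"
proof -
  define A where "A = C * S ^\<^sub>m (i div m)"
  have A: "A \<in> carrier_mat m d"
    unfolding A_def by (rule mult_carrier_mat[OF assms(2) pow_carrier_mat[OF assms(1)]])
  have "i mod m < m" using assms(3) by (cases m) auto
  then have "row (obs_mat k m C S) i $ j = row A (i mod m) $ j" if "j < d" for j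
    using A assms that by (simp add: obs_mat_def A_def[symmetric])
  then show ?thesis
    unfolding A_def[symmetric] using A assms by (intro eq_vecI) (auto simp: obs_mat_def)
qed

lemma pow_mat_add:
  assumes S: "S \<in> carrier_mat d d"
  shows "S ^\<^sub>m a * S ^\<^sub>m b = S ^\<^sub>m (a + b)"
proof (induction b)
  case 0
  then show ?case using S pow_carrier_mat[OF S, of a] by simp
next
  case (Suc b)
  have "S ^\<^sub>m a * (S ^\<^sub>m b * S) = S ^\<^sub>m a * S ^\<^sub>m b * S"
    by (rule assoc_mult_mat[OF pow_carrier_mat[OF S] pow_carrier_mat[OF S] S, symmetric])
  then show ?case by (simp add: Suc)
qed

lemma transpose_pow_mat:
  assumes S: "S \<in> carrier_mat d d"
  shows "S\<^sup>T ^\<^sub>m a = (S ^\<^sub>m a :: 'a :: comm_semiring_1 mat)\<^sup>T"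
proof (induction a)
  case 0
  then show ?case using S by simp
next
  case (Suc a)
  have "(S ^\<^sub>m Suc a)\<^sup>T = (S * S ^\<^sub>m a)\<^sup>T"
    using pow_mat_add[OF S, of 1 a] S by simp
  also have "\<dots> = (S ^\<^sub>m a)\<^sup>T * S\<^sup>T"
    by (rule transpose_mult[OF S pow_carrier_mat[OF S]])
  finally show ?case by (simp add: Suc)
qed

lemma col_transpose_obs_mat:
  assumes S: "S \<in> carrier_mat d d" and B: "B \<in> carrier_mat d m" and j: "j < k * m"
  shows "col ((obs_mat k m (B\<^sup>T) (S\<^sup>T))\<^sup>T) j =
    col (S ^\<^sub>m (j div m) * B) (j mod m)"
proof -
  have m: "0 < m" using j by (cases m) auto
  have o: "obs_mat k m (B\<^sup>T) (S\<^sup>T) \<in> carrier_mat (k * m) d" using B by simp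
  have "col ((obs_mat k m (B\<^sup>T) (S\<^sup>T))\<^sup>T) j =
      row (obs_mat k m (B\<^sup>T) (S\<^sup>T)) j"
    using o j by (intro col_transpose) auto
  also have "\<dots> = row (B\<^sup>T * S\<^sup>T ^\<^sub>m (j div m)) (j mod m)"
    using S B j by (intro row_obs_mat[of _ d]) auto
  also have "\<dots> = row ((S ^\<^sub>m (j div m) * B)\<^sup>T) (j mod m)"
    unfolding transpose_pow_mat[OF S] transpose_mult[OF pow_carrier_mat[OF S] B] ..
  also have "\<dots> = col (S ^\<^sub>m (j div m) * B) (j mod m)"
    using m B by (intro row_transpose) auto
  finally show ?thesis .
qed

text \<open>With blocks counted from \<open>0\<close>, the block in place \<open>(a, b)\<close> is
  \<open>C S^(a+b) B\<close>, which splits into \<open>C S^a\<close> times \<open>S^b B\<close>: one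
  factor depends on the block row only, the other on the block column only. The shift inserts one
  more \<open>S\<close> in the middle.\<close>

lemma block_hankel_factorization:
  fixes k :: nat
  assumes S: "S \<in> carrier_mat d d" and B: "B \<in> carrier_mat d m" and C: "C \<in> carrier_mat m d"
    and c: "\<And>l. c (Suc l) = C * S ^\<^sub>m l * B"
  defines "Co \<equiv> (obs_mat k m (B\<^sup>T) (S\<^sup>T))\<^sup>T"
  shows "block_hankel m k 0 c = obs_mat k m C S * Co"
    and "block_hankel m k 1 c = obs_mat k m C S * S * Co"
proof -
  have Ob: "obs_mat k m C S \<in> carrier_mat (k * m) d" using C by simp
  have Co: "Co \<in> carrier_mat d (k * m)" using B by (simp add: Co_def)
  note p = pow_carrier_mat[OF S]
  have entry: "row (C * S ^\<^sub>m a) i' \<bullet> col (S ^\<^sub>m b * B) j' = (C * S ^\<^sub>m (a + b) * B) $$ (i', j')"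
    if "i' < m" "j' < m" for a b i' j'
  proof -
    have "C * S ^\<^sub>m (a + b) * B = C * (S ^\<^sub>m a * S ^\<^sub>m b) * B" by (simp add: pow_mat_add[OF S])
    also have "C * (S ^\<^sub>m a * S ^\<^sub>m b) = C * S ^\<^sub>m a * S ^\<^sub>m b"
      by (rule assoc_mult_mat[OF C p p, symmetric])
    also have "C * S ^\<^sub>m a * S ^\<^sub>m b * B = C * S ^\<^sub>m a * (S ^\<^sub>m b * B)"
      by (rule assoc_mult_mat[OF mult_carrier_mat[OF C p] p B])
    finally show ?thesis using that B C S by simp
  qed
  have md: "i mod m < m" if "i < k * m" for i using that by (cases m) auto
  show "block_hankel m k 0 c = obs_mat k m C S * Co"
  proof (rule eq_matI)
    fix i j assume "i < dim_row (obs_mat k m C S * Co)" "j < dim_col (obs_mat k m C S * Co)"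
    then have ij: "i < k * m" "j < k * m" using Ob Co by simp_all
    then have "(obs_mat k m C S * Co) $$ (i, j) = row (C * S ^\<^sub>m (i div m)) (i mod m) \<bullet> col (S ^\<^sub>m (j div m) * B) (j mod m)"
      using Ob Co row_obs_mat[OF S C ij(1)] col_transpose_obs_mat[OF S B ij(2)] by (simp add: Co_def)
    also have "\<dots> = c (Suc (i div m + j div m)) $$ (i mod m, j mod m)"
      unfolding c by (rule entry[OF md[OF ij(1)] md[OF ij(2)]])
    finally show "block_hankel m k 0 c $$ (i, j) = (obs_mat k m C S * Co) $$ (i, j)"
      using ij by (simp add: block_hankel_def)
  qed (use Ob Co in \<open>simp_all add: block_hankel_def\<close>)
  have ObS: "obs_mat k m C S * S \<in> carrier_mat (k * m) d" by (rule mult_carrier_mat[OF Ob S])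
  have row_ObS: "row (obs_mat k m C S * S) i = row (C * S ^\<^sub>m Suc (i div m)) (i mod m)" if i: "i < k * m" for i
  proof (rule eq_vecI)
    fix j assume "j < dim_vec (row (C * S ^\<^sub>m Suc (i div m)) (i mod m))"
    then have j: "j < d" using S by simp
    have "row (obs_mat k m C S * S) i $ j = row (C * S ^\<^sub>m (i div m)) (i mod m) \<bullet> col S j"
      using Ob S i j row_obs_mat[OF S C i] by simp
    also have "\<dots> = (C * S ^\<^sub>m (i div m) * S) $$ (i mod m, j)"
      using C S i j md[OF i] by simp
    also have "C * S ^\<^sub>m (i div m) * S = C * S ^\<^sub>m Suc (i div m)"
      using assoc_mult_mat[OF C p S] by simp
    finally show "row (obs_mat k m C S * S) i $ j = row (C * S ^\<^sub>m Suc (i div m)) (i mod m) $ j"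
      using C S j md[OF i] by simp
  qed (use S in simp)
  show "block_hankel m k 1 c = obs_mat k m C S * S * Co"
  proof (rule eq_matI)
    fix i j assume "i < dim_row (obs_mat k m C S * S * Co)" "j < dim_col (obs_mat k m C S * S * Co)"
    then have ij: "i < k * m" "j < k * m" using Ob Co by simp_all
    then have "(obs_mat k m C S * S * Co) $$ (i, j) = row (obs_mat k m C S * S) i \<bullet> col Co j"
      by (intro index_mult_mat) (use Ob Co in simp_all)
    also have "\<dots> = row (C * S ^\<^sub>m Suc (i div m)) (i mod m) \<bullet> col (S ^\<^sub>m (j div m) * B) (j mod m)"
      unfolding row_ObS[OF ij(1)] Co_def col_transpose_obs_mat[OF S B ij(2)] ..
    also have "\<dots> = c (Suc (Suc (i div m) + j div m)) $$ (i mod m, j mod m)"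
      unfolding c by (rule entry[OF md[OF ij(1)] md[OF ij(2)]])
    finally show "block_hankel m k 1 c $$ (i, j) = (obs_mat k m C S * S * Co) $$ (i, j)"
      using ij by (simp add: block_hankel_def)
  qed (use Ob Co in \<open>simp_all add: block_hankel_def\<close>)
qed

text \<open>On an eigenvector every power of \<open>S\<close> acts as a scalar, so one that
  \<open>C\<close> kills is killed by all the blocks. With a left inverse of the observability
  matrix this becomes the Hautus test \<open>observable\<close>.\<close>

lemma unobservable_eigenvector:
  assumes S: "S \<in> carrier_mat d d" and C: "C \<in> carrier_mat m d"
    and w: "w \<in> carrier_vec d" "S *\<^sub>v w = x \<cdot>\<^sub>v w" "C *\<^sub>v w = 0\<^sub>v m"
  shows "obs_mat k m C S *\<^sub>v w = 0\<^sub>v (k * m)"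
proof -
  have pow: "S ^\<^sub>m a *\<^sub>v w = x ^ a \<cdot>\<^sub>v w" for a
  proof (induction a)
    case (Suc a)
    have "S ^\<^sub>m Suc a *\<^sub>v w = S ^\<^sub>m a *\<^sub>v (S *\<^sub>v w)"
      using assoc_mult_mat_vec[OF pow_carrier_mat[OF S] S w(1)] by simp
    also have "\<dots> = x \<cdot>\<^sub>v (S ^\<^sub>m a *\<^sub>v w)"
      unfolding w(2) by (rule mult_mat_vec[OF pow_carrier_mat[OF S] w(1)])
    finally show ?case using w(1) by (simp add: Suc smult_smult_assoc)
  qed (use S w(1) in simp)
  have z: "(C * S ^\<^sub>m a) *\<^sub>v w = 0\<^sub>v m" for a
  proof -
    have "(C * S ^\<^sub>m a) *\<^sub>v w = x ^ a \<cdot>\<^sub>v (C *\<^sub>v w)"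
      using assoc_mult_mat_vec[OF C pow_carrier_mat[OF S] w(1)] mult_mat_vec[OF C w(1)] by (simp add: pow)
    also have "\<dots> = 0\<^sub>v m" unfolding w(3) by (intro eq_vecI) auto
    finally show ?thesis .
  qed
  show ?thesis
  proof (rule eq_vecI)
    fix i assume "i < dim_vec (0\<^sub>v (k * m) :: complex vec)"
    then have i: "i < k * m" by simp
    then have m: "i mod m < m" by (cases m) auto
    have "(obs_mat k m C S *\<^sub>v w) $ i = row (C * S ^\<^sub>m (i div m)) (i mod m) \<bullet> w"
      using i row_obs_mat[OF S C i] by (simp add: obs_mat_def)
    also have "\<dots> = ((C * S ^\<^sub>m (i div m)) *\<^sub>v w) $ (i mod m)"
      using m C by simp
    finally show "(obs_mat k m C S *\<^sub>v w) $ i = 0\<^sub>v (k * m) $ i" using z i m by simp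
  qed (simp add: obs_mat_def)
qed

lemma observable:
  assumes S: "S \<in> carrier_mat d d" and C: "C \<in> carrier_mat m d"
    and Lo: "Lo \<in> carrier_mat d (k * m)" "Lo * obs_mat k m C S = 1\<^sub>m d"
    and w: "w \<in> carrier_vec d" "S *\<^sub>v w = x \<cdot>\<^sub>v w" "C *\<^sub>v w = 0\<^sub>v m"
  shows "w = 0\<^sub>v d"
proof -
  have Ob: "obs_mat k m C S \<in> carrier_mat (k * m) d" using C by simp
  have "w = (Lo * obs_mat k m C S) *\<^sub>v w" using Lo w by simp
  also have "\<dots> = Lo *\<^sub>v (obs_mat k m C S *\<^sub>v w)" by (rule assoc_mult_mat_vec[OF Lo(1) Ob w(1)])
  also have "\<dots> = 0\<^sub>v d"
    unfolding unobservable_eigenvector[OF S C w] using Lo(1) by (intro eq_vecI) auto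
  finally show ?thesis .
qed

section \<open>Regular points of rational matrices and observability\<close>

definition mat_regular_at :: "complex \<Rightarrow> ratfun mat \<Rightarrow> bool" where
  "mat_regular_at x G \<longleftrightarrow> (\<forall>i<dim_row G. \<forall>j<dim_col G. regular_at x (G $$ (i, j)))"

lemma mat_regularI:
  assumes "G \<in> carrier_mat p m" "\<And>i j. i < p \<Longrightarrow> j < m \<Longrightarrow> regular_at x (G $$ (i, j))"
  shows "mat_regular_at x G"
  unfolding mat_regular_at_def carrier_matD[OF assms(1)] by (intro allI impI assms(2))

lemma mat_regularD:
  assumes "mat_regular_at x G" "G \<in> carrier_mat p m" "i < p" "j < m"
  shows "regular_at x (G $$ (i, j))"
  using assms(1,3,4) unfolding mat_regular_at_def carrier_matD[OF assms(2)] by simp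

lemma mat_regular_const_mult:
  assumes C: "C \<in> carrier_mat p d" and Y: "Y \<in> carrier_mat d m" "mat_regular_at x Y"
  shows "mat_regular_at x (rmat_const C * Y)"
    and "rmat_eval (rmat_const C * Y) x = C * rmat_eval Y x"
proof -
  have 1: "(rmat_const C * Y) $$ (i, j) = (\<Sum>u<d. rat_const (C $$ (i, u)) * Y $$ (u, j))" if "i < p" "j < m" for i j
    using that C Y by (simp add: scalar_prod_def atLeast0LessThan)
  have 2: "regular_at x (Y $$ (u, j))" if "u < d" "j < m" for u j
    by (rule mat_regularD[OF Y(2,1) that])
  show "mat_regular_at x (rmat_const C * Y)"
  proof (rule mat_regularI[OF mult_carrier_mat[OF _ Y(1)]])
    show "rmat_const C \<in> carrier_mat p d" using C by simp
    fix i j assume ij: "i < p" "j < m"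
    show "regular_at x ((rmat_const C * Y) $$ (i, j))"
      unfolding 1[OF ij] by (rule const_combination_at(1)) (use 2 ij in simp)
  qed
  show "rmat_eval (rmat_const C * Y) x = C * rmat_eval Y x"
  proof (rule eq_matI)
    fix i j assume "i < dim_row (C * rmat_eval Y x)" "j < dim_col (C * rmat_eval Y x)"
    then have ij: "i < p" "j < m" using C Y by auto
    have "rat_eval ((rmat_const C * Y) $$ (i, j)) x = (\<Sum>u<d. C $$ (i, u) * rat_eval (Y $$ (u, j)) x)"
      unfolding 1[OF ij] by (rule const_combination_at(2)) (use 2 ij in simp)
    then show "rmat_eval (rmat_const C * Y) x $$ (i, j) = (C * rmat_eval Y x) $$ (i, j)"
      using ij C Y by (simp add: scalar_prod_def atLeast0LessThan)
  qed (use C Y in simp_all)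
qed

text \<open>If \<open>C Y\<close> has no pole at \<open>x\<close>, then neither has \<open>C S\<^sup>l Y\<close>, because
  \<open>C S\<^sup>l\<^sup>+\<^sup>1 Y = z C S\<^sup>l Y - C S\<^sup>l B\<close>.\<close>

lemma regular_by_observability:
  assumes S: "S \<in> carrier_mat d d" and C: "C \<in> carrier_mat m d" and Y: "Y \<in> carrier_mat d n"
    and B: "B \<in> carrier_mat d n"
    and eq: "rat_z \<cdot>\<^sub>m Y = rmat_const S * Y + rmat_const B"
    and Lo: "Lo \<in> carrier_mat d (k * m)" "Lo * obs_mat k m C S = 1\<^sub>m d"
    and reg: "mat_regular_at x (rmat_const C * Y)"
  shows "mat_regular_at x Y"
proof -
  note p = pow_carrier_mat[OF S]
  have step: "rmat_const (A * S) * Y = rat_z \<cdot>\<^sub>m (rmat_const A * Y) - rmat_const (A * B)"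
    if A: "A \<in> carrier_mat m d" for A
  proof -
    have "b = a - e" if "a = b + e" "b \<in> carrier_mat m n" "e \<in> carrier_mat m n" for a b e :: "ratfun mat"
      using that by (intro eq_matI) auto
    moreover have "rmat_const (A * S) * Y \<in> carrier_mat m n"
      by (rule mult_carrier_mat[OF _ Y]) (use A S in simp)
    moreover have "rmat_const (A * B) \<in> carrier_mat m n" using A B by simp
    ultimately show ?thesis using realization_step[OF S Y B eq A] by metis
  qed
  have pows: "mat_regular_at x (rmat_const (C * S ^\<^sub>m l) * Y)" for l
  proof (induction l)
    case 0
    then show ?case using reg S C by simp
  next
    case (Suc l)
    let ?A = "C * S ^\<^sub>m l"
    have A: "?A \<in> carrier_mat m d" by (rule mult_carrier_mat[OF C p])
    have "C * S ^\<^sub>m Suc l = ?A * S" using assoc_mult_mat[OF C p S] by simp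
    then have e: "rmat_const (C * S ^\<^sub>m Suc l) * Y = rat_z \<cdot>\<^sub>m (rmat_const ?A * Y) - rmat_const (?A * B)"
      using step[OF A] by simp
    have AB: "?A * B \<in> carrier_mat m n" by (rule mult_carrier_mat[OF A B])
    have AY: "rmat_const ?A * Y \<in> carrier_mat m n" by (rule mult_carrier_mat[OF _ Y]) (use A in simp)
    show ?case
    proof (rule mat_regularI[OF mult_carrier_mat[OF _ Y]])
      show "rmat_const (C * S ^\<^sub>m Suc l) \<in> carrier_mat m d"
        using mult_carrier_mat[OF C pow_carrier_mat[OF S, of "Suc l"]] by simp
      fix i j assume ij: "i < m" "j < n"
      have "regular_at x ((rmat_const ?A * Y) $$ (i, j))"
        by (rule mat_regularD[OF Suc AY ij])
      moreover have "(rmat_const (C * S ^\<^sub>m Suc l) * Y) $$ (i, j) =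
          rat_z * (rmat_const ?A * Y) $$ (i, j) - rat_const ((?A * B) $$ (i, j))"
      proof -
        have "(rat_z \<cdot>\<^sub>m a - rmat_const b) $$ (i, j) = rat_z * a $$ (i, j) - rat_const (b $$ (i, j))"
          if "a \<in> carrier_mat m n" "b \<in> carrier_mat m n" for a b
          using that ij by simp
        then show ?thesis unfolding e using AY AB .
      qed
      ultimately show "regular_at x ((rmat_const (C * S ^\<^sub>m Suc l) * Y) $$ (i, j))"
        by simp
    qed
  qed
  let ?O = "obs_mat k m C S"
  have Ob: "?O \<in> carrier_mat (k * m) d" using C by simp
  have OY: "rmat_const ?O * Y \<in> carrier_mat (k * m) n"
    by (rule mult_carrier_mat[OF _ Y]) (use Ob in simp)
  have "mat_regular_at x (rmat_const ?O * Y)"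
  proof (rule mat_regularI[OF OY])
    fix i j assume ij: "i < k * m" "j < n"
    then have m: "i mod m < m" by (cases m) auto
    have "(rmat_const ?O * Y) $$ (i, j) = (rmat_const (C * S ^\<^sub>m (i div m)) * Y) $$ (i mod m, j)"
      using ij m C S Y Ob by (simp add: scalar_prod_def obs_mat_def)
    then show "regular_at x ((rmat_const ?O * Y) $$ (i, j))"
      using pows[of "i div m"] m ij C Y by (simp add: mat_regular_at_def)
  qed
  \<comment> \<open>The left inverse recovers \<open>Y\<close> as a constant combination of the
    stacked outputs, which have just been shown to be regular.\<close>
  then have "mat_regular_at x (rmat_const Lo * (rmat_const ?O * Y))"
    by (rule mat_regular_const_mult(1)[OF Lo(1) OY])
  also have "rmat_const Lo * (rmat_const ?O * Y) = rmat_const (Lo * ?O) * Y"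
    unfolding rmat_const_mult[OF Lo(1) Ob]
    by (rule assoc_mult_mat[OF _ _ Y, symmetric, of _ d "k * m"]) (use Lo Ob in simp_all)
  also have "\<dots> = Y" using Lo(2) Y by simp
  finally show ?thesis .
qed

section \<open>Compression by unitary matrices and change of basis\<close>

lemma col_append_left:
  assumes "A \<in> carrier_mat n r" "B \<in> carrier_mat n s" "j < r"
  shows "col (A @\<^sub>c B) j = col A j"
  using assms by (intro eq_vecI) (auto simp: append_cols_def)

lemma append_cols_carrier:
  "A \<in> carrier_mat n r \<Longrightarrow> B \<in> carrier_mat n s \<Longrightarrow> A @\<^sub>c B \<in> carrier_mat n (r + s)"
  by (rule carrier_matI) (simp_all add: append_cols_def)

text \<open>Multiplying the compression identity by \<open>U1 @\<^sub>c U2\<close> from the left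
  undoes its adjoint; what remains is compared in the first \<open>r\<close> columns, where the zero
  blocks remove \<open>U2\<close>.\<close>

lemma unitary_compression:
  fixes H :: "complex mat"
  assumes U: "U1 \<in> carrier_mat n r" "U2 \<in> carrier_mat n s" "unitary_mat (U1 @\<^sub>c U2)"
    and V: "V1 \<in> carrier_mat n r" "V2 \<in> carrier_mat n s"
    and H: "H \<in> carrier_mat n n" and D: "D \<in> carrier_mat r r"
    and comp: "mat_adjoint (U1 @\<^sub>c U2) * H * (V1 @\<^sub>c V2) =
      four_block_mat D (0\<^sub>m r s) (0\<^sub>m s r) (0\<^sub>m s s)"
  shows "H * V1 = U1 * D"
proof -
  let ?U = "U1 @\<^sub>c U2" and ?V = "V1 @\<^sub>c V2"
  have cU: "?U \<in> carrier_mat n (r + s)" and cV: "?V \<in> carrier_mat n (r + s)"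
    using U V by (auto intro: append_cols_carrier)
  have n: "n = r + s" using U(3) cU by (auto simp: unitary_mat_def square_mat.simps)
  have Ua: "mat_adjoint ?U \<in> carrier_mat (r + s) n" using cU by simp
  have UU: "?U * mat_adjoint ?U = 1\<^sub>m n"
    using U(3) cU by (simp add: unitary_mat_def inverts_mat_def)
  have "?U * (mat_adjoint ?U * H * ?V) = H * ?V"
  proof -
    have "?U * (mat_adjoint ?U * H * ?V) = ?U * (mat_adjoint ?U * (H * ?V))"
      unfolding assoc_mult_mat[OF Ua H cV] ..
    also have "\<dots> = ?U * mat_adjoint ?U * (H * ?V)"
      by (rule assoc_mult_mat[OF cU Ua mult_carrier_mat[OF H cV], symmetric])
    finally show ?thesis unfolding UU by (simp add: left_mult_one_mat[OF mult_carrier_mat[OF H cV]])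
  qed
  then have HV: "H * ?V = ?U * four_block_mat D (0\<^sub>m r s) (0\<^sub>m s r) (0\<^sub>m s s)"
    unfolding comp by simp
  have "?U * four_block_mat D (0\<^sub>m r s) (0\<^sub>m s r) (0\<^sub>m s s) =
      four_block_mat (U1 * D + U2 * 0\<^sub>m s r) (U1 * 0\<^sub>m r s + U2 * 0\<^sub>m s s)
        (0\<^sub>m 0 r * D + 0\<^sub>m 0 s * 0\<^sub>m s r) (0\<^sub>m 0 r * 0\<^sub>m r s + 0\<^sub>m 0 s * 0\<^sub>m s s)"
    unfolding append_cols_def
    using mult_four_block_mat[OF U(1,2) zero_carrier_mat zero_carrier_mat D zero_carrier_mat zero_carrier_mat zero_carrier_mat,
      of 0 s] U by simp
  then have UD: "(?U * four_block_mat D (0\<^sub>m r s) (0\<^sub>m s r) (0\<^sub>m s s)) $$ (i, j) = (U1 * D) $$ (i, j)"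
    if "i < n" "j < r" for i j
    using that U D by (simp add: index_mat_four_block(1))
  show ?thesis
  proof (rule eq_matI)
    fix i j assume "i < dim_row (U1 * D)" "j < dim_col (U1 * D)"
    then have ij: "i < n" "j < r" using U D by simp_all
    have "(H * V1) $$ (i, j) = row H i \<bullet> col V1 j" using H V ij by simp
    also have "\<dots> = row H i \<bullet> col ?V j" unfolding col_append_left[OF V ij(2)] ..
    also have "\<dots> = (H * ?V) $$ (i, j)" using H cV ij by simp
    also have "\<dots> = (U1 * D) $$ (i, j)"
      unfolding HV by (rule UD[OF ij])
    finally show "(H * V1) $$ (i, j) = (U1 * D) $$ (i, j)" .
  qed (use H V U D in simp_all)
qed

lemma first_rows_carrier [simp]: "A \<in> carrier_mat n r \<Longrightarrow> first_rows m A \<in> carrier_mat m r"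
  by (simp add: first_rows_def)

lemma first_rows_mult:
  assumes "A \<in> carrier_mat n r" "B \<in> carrier_mat r s" "m \<le> n"
  shows "first_rows m (A * B) = first_rows m A * B"
proof (rule eq_matI)
  fix i j assume "i < dim_row (first_rows m A * B)" "j < dim_col (first_rows m A * B)"
  then have ij: "i < m" "j < s" using assms by (simp_all add: first_rows_def)
  moreover have "row (first_rows m A) i = row A i"
    using ij assms by (intro eq_vecI) (simp_all add: first_rows_def)
  ultimately show "first_rows m (A * B) $$ (i, j) = (first_rows m A * B) $$ (i, j)"
    using assms by (simp add: first_rows_def)
qed (use assms in \<open>simp_all add: first_rows_def\<close>)

text \<open>The block with exponent \<open>0\<close>. This is how \<open>C\<close>, and by
  transposition \<open>B\<close>, is recovered from the factors of the Hankel matrix.\<close>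

lemma first_rows_obs_mat:
  assumes "S \<in> carrier_mat d d" "C \<in> carrier_mat m d" "k \<ge> 1"
  shows "first_rows m (obs_mat k m C S) = C"
proof (rule eq_matI)
  fix i j assume "i < dim_row C" "j < dim_col C"
  then have ij: "i < m" "j < d" using assms by simp_all
  then have "i < k * m" using assms(3) by (metis less_le_trans mult_le_mono1 mult_1)
  then show "first_rows m (obs_mat k m C S) $$ (i, j) = C $$ (i, j)"
    using ij assms by (simp add: first_rows_def obs_mat_def)
qed (use assms in \<open>simp_all add: first_rows_def obs_mat_def\<close>)

lemma shifted_congruence:
  fixes T1 S T2 :: "complex mat"
  assumes "T1 \<in> carrier_mat d d" "S \<in> carrier_mat d d" "T2 \<in> carrier_mat d d"
  shows "x \<cdot>\<^sub>m (T1 * T2) - T1 * S * T2 = T1 * (x \<cdot>\<^sub>m 1\<^sub>m d - S) * T2"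
proof -
  have "T1 * (x \<cdot>\<^sub>m 1\<^sub>m d - S) = x \<cdot>\<^sub>m T1 - T1 * S"
    using assms by (simp add: mult_minus_distrib_mat[of _ d d _ d] mult_smult_distrib[of _ d d _ d])
  then show ?thesis
    using assms by (simp add: minus_mult_distrib_mat[of _ d d _ _ d] mult_smult_assoc_mat[of _ d d _ d])
qed

text \<open>Substituting \<open>w = T2 v\<close> and cancelling \<open>T1\<close> turns a null
  vector of the pencil into an eigenvector of \<open>S\<close> killed by \<open>C\<close>. With
  transposes, and \<open>T1\<close> and \<open>T2\<close> in exchanged roles, the same lemma gives
  controllability.\<close>

lemma pencil_observable:
  assumes T: "T1 \<in> carrier_mat d d" "T2 \<in> carrier_mat d d" "det T1 \<noteq> 0" "det T2 \<noteq> 0"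
    and S: "S \<in> carrier_mat d d" and C: "C \<in> carrier_mat m d"
    and Lo: "Lo \<in> carrier_mat d (k * m)" "Lo * obs_mat k m C S = 1\<^sub>m d"
    and v: "v \<in> carrier_vec d" "(x \<cdot>\<^sub>m (T1 * T2) - T1 * S * T2) *\<^sub>v v = 0\<^sub>v d" "(C * T2) *\<^sub>v v = 0\<^sub>v m"
  shows "v = 0\<^sub>v d"
proof -
  define w where "w = T2 *\<^sub>v v"
  have w: "w \<in> carrier_vec d" unfolding w_def by (rule mult_mat_vec_carrier[OF T(2) v(1)])
  have X: "x \<cdot>\<^sub>m 1\<^sub>m d - S \<in> carrier_mat d d" using S by (intro minus_carrier_mat)
  have "T1 *\<^sub>v ((x \<cdot>\<^sub>m 1\<^sub>m d - S) *\<^sub>v w) = 0\<^sub>v d"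
    using v(2) unfolding shifted_congruence[OF T(1) S T(2)] w_def
      assoc_mult_mat_vec[OF mult_carrier_mat[OF T(1) X] T(2) v(1)]
      assoc_mult_mat_vec[OF T(1) X w[unfolded w_def]] .
  then have "(x \<cdot>\<^sub>m 1\<^sub>m d - S) *\<^sub>v w = 0\<^sub>v d"
    by (rule det_nonzero_mult_vec_0[OF T(1,3) mult_mat_vec_carrier[OF X w]])
  then have e1: "(x \<cdot>\<^sub>m 1\<^sub>m d) *\<^sub>v w - S *\<^sub>v w = 0\<^sub>v d"
    using minus_mult_distrib_mat_vec[of "x \<cdot>\<^sub>m 1\<^sub>m d" d d S w] S w by simp
  have e2: "(x \<cdot>\<^sub>m 1\<^sub>m d) *\<^sub>v w = x \<cdot>\<^sub>v w"
  proof (rule eq_vecI)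
    fix i assume "i < dim_vec (x \<cdot>\<^sub>v w)"
    then have i: "i < d" using w by simp
    then have "row (x \<cdot>\<^sub>m 1\<^sub>m d) i = x \<cdot>\<^sub>v unit_vec d i" by (intro eq_vecI) simp_all
    then show "((x \<cdot>\<^sub>m 1\<^sub>m d) *\<^sub>v w) $ i = (x \<cdot>\<^sub>v w) $ i"
      using i w scalar_prod_left_unit[OF w i] by simp
  qed (use w in simp)
  have r: "b = a" if "a - b = 0\<^sub>v d" "a \<in> carrier_vec d" "b \<in> carrier_vec d" for a b :: "complex vec"
  proof (rule eq_vecI)
    fix i assume i: "i < dim_vec a"
    have "a $ i - b $ i = (a - b) $ i" using that(2,3) i by simp
    also have "\<dots> = 0" using that(2) i unfolding that(1) by simp
    finally show "b $ i = a $ i" by simp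
  qed (use that in simp)
  have Sw: "S *\<^sub>v w = x \<cdot>\<^sub>v w"
    by (rule r[OF e1[unfolded e2] _ mult_mat_vec_carrier[OF S w]]) (use w in simp)
  have Cw: "C *\<^sub>v w = 0\<^sub>v m" using v(3) unfolding w_def assoc_mult_mat_vec[OF C T(2) v(1)] .
  have "w = 0\<^sub>v d" by (rule observable[OF S C Lo w Sw Cw])
  then show ?thesis using det_nonzero_mult_vec_0[OF T(2,4) v(1)] by (simp add: w_def)
qed

text \<open>The determinant is the characteristic polynomial, which is monic.\<close>

lemma det_lin_pencil_one:
  assumes S: "S \<in> carrier_mat d d"
  shows "det (lin_pencil (1\<^sub>m d) S) \<noteq> 0"
proof -
  have "lin_pencil (1\<^sub>m d) S = char_poly_matrix S"
  proof (rule eq_matI)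
    fix i j assume "i < dim_row (char_poly_matrix S)" "j < dim_col (char_poly_matrix S)"
    then have "i < d" "j < d" using S by (simp_all add: char_poly_matrix_def)
    then show "lin_pencil (1\<^sub>m d) S $$ (i, j) = char_poly_matrix S $$ (i, j)"
      using S by (cases "i = j") (simp_all add: lin_pencil_def char_poly_matrix_def)
  qed (use S in \<open>simp_all add: lin_pencil_def char_poly_matrix_def\<close>)
  then have "det (lin_pencil (1\<^sub>m d) S) = char_poly S" by (simp add: char_poly_def)
  then show ?thesis using degree_monic_char_poly[OF S] by auto
qed

lemma mat_regular_transpose: "mat_regular_at x G \<Longrightarrow> mat_regular_at x (G\<^sup>T)"
  by (simp add: mat_regular_at_def)

lemma rmat_const_transpose: "rmat_const (A\<^sup>T) = (rmat_const A)\<^sup>T"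
  by (rule eq_matI) auto

lemma transpose_lin_pencil:
  assumes "S \<in> carrier_mat d d"
  shows "(rmat_poly (lin_pencil (1\<^sub>m d) S))\<^sup>T = rmat_poly (lin_pencil (1\<^sub>m d) (S\<^sup>T))"
  unfolding lin_pencil_def using assms by (intro eq_matI) simp_all

text \<open>No eigenvalue of a minimal realization is cancelled: applying \<open>regular_by_observability\<close>
  first to the realization and then to its transpose shows that the resolvent is regular wherever
  the transfer function is.\<close>

lemma regular_point_not_eigenvalue:
  assumes S: "S \<in> carrier_mat d d" and B: "B \<in> carrier_mat d n" and C: "C \<in> carrier_mat m d"
    and Y: "Y \<in> carrier_mat d n"
    and LY: "rmat_poly (lin_pencil (1\<^sub>m d) S) * Y = rmat_const B"
    and Lo: "Lo \<in> carrier_mat d (k * m)" "Lo * obs_mat k m C S = 1\<^sub>m d"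
    and Lc: "Lc \<in> carrier_mat d (k * n)" "Lc * obs_mat k n (B\<^sup>T) (S\<^sup>T) = 1\<^sub>m d"
    and reg: "mat_regular_at x (rmat_const C * Y)"
  shows "det (x \<cdot>\<^sub>m 1\<^sub>m d - S) \<noteq> 0"
proof -
  let ?P = "rmat_poly (lin_pencil (1\<^sub>m d) S)"
  have P: "?P \<in> carrier_mat d d" using S by simp
  have "det ?P \<noteq> 0" using det_lin_pencil_one[OF S] by (simp add: det_rmat_poly)
  with P obtain Z where Z: "Z \<in> carrier_mat d d" "?P * Z = 1\<^sub>m d" "Z * ?P = 1\<^sub>m d"
    by (rule inverse_if_det_nonzero)
  have St: "S\<^sup>T \<in> carrier_mat d d" and Bt: "B\<^sup>T \<in> carrier_mat n d"
    and Zt: "Z\<^sup>T \<in> carrier_mat d d" and Bc: "rmat_const B \<in> carrier_mat d n"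
    using S B Z by simp_all
  have regY: "mat_regular_at x Y"
    by (rule regular_by_observability[OF S C Y B pencil_solution_entry[OF S Y B LY] Lo reg])
  have "Z * rmat_const B = Z * ?P * Y"
    unfolding LY[symmetric] by (rule assoc_mult_mat[OF Z(1) P Y, symmetric])
  then have ZB: "Z * rmat_const B = Y" unfolding Z(3) using Y by simp
  have "rmat_poly (lin_pencil (1\<^sub>m d) (S\<^sup>T)) * Z\<^sup>T = (Z * ?P)\<^sup>T"
    unfolding transpose_mult[OF Z(1) P] transpose_lin_pencil[OF S] ..
  then have "rmat_poly (lin_pencil (1\<^sub>m d) (S\<^sup>T)) * Z\<^sup>T = rmat_const (1\<^sub>m d)"
    unfolding Z(3) by simp
  from pencil_solution_entry[OF St Zt one_carrier_mat this]
  have eq: "rat_z \<cdot>\<^sub>m Z\<^sup>T = rmat_const (S\<^sup>T) * Z\<^sup>T + rmat_const (1\<^sub>m d)" .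
  \<comment> \<open>The transposed resolvent is the state of the system with state matrix
    \<open>S\<^sup>T\<close>, identity input and output \<open>B\<^sup>T\<close>; its output is the
    transpose of \<open>Y\<close>, already known to be regular.\<close>
  have "rmat_const (B\<^sup>T) * Z\<^sup>T = Y\<^sup>T"
    unfolding ZB[symmetric] transpose_mult[OF Z(1) Bc] rmat_const_transpose ..
  then have "mat_regular_at x (rmat_const (B\<^sup>T) * Z\<^sup>T)"
    using mat_regular_transpose[OF regY] by simp
  then have regZ: "mat_regular_at x (Z\<^sup>T)"
    by (rule regular_by_observability[OF St Bt Zt one_carrier_mat eq Lc])
  \<comment> \<open>A regular resolvent may be evaluated at \<open>x\<close>, and its value there
    inverts \<open>x - S\<^sup>T\<close>.\<close>
  define W where "W = rmat_eval (Z\<^sup>T) x"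
  have W: "W \<in> carrier_mat d d" unfolding W_def using Zt by simp
  have SW: "S\<^sup>T * W = rmat_eval (rmat_const (S\<^sup>T) * Z\<^sup>T) x"
    unfolding W_def by (rule mat_regular_const_mult(2)[OF St Zt regZ, symmetric])
  note regSZ = mat_regular_const_mult(1)[OF St Zt regZ]
  have xW: "x \<cdot>\<^sub>m W = S\<^sup>T * W + 1\<^sub>m d"
  proof (rule eq_matI)
    fix i j assume "i < dim_row (S\<^sup>T * W + 1\<^sub>m d)" "j < dim_col (S\<^sup>T * W + 1\<^sub>m d)"
    then have ij: "i < d" "j < d" by simp_all
    have SZ: "rmat_const (S\<^sup>T) * Z\<^sup>T \<in> carrier_mat d d"
      by (rule mult_carrier_mat[OF _ Zt]) (use St in simp)
    have r1: "regular_at x (Z\<^sup>T $$ (i, j))" using regZ Z(1) ij by (simp add: mat_regular_at_def)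
    have r2: "regular_at x ((rmat_const (S\<^sup>T) * Z\<^sup>T) $$ (i, j))"
      using regSZ[unfolded mat_regular_at_def carrier_matD[OF SZ]] ij by blast
    have "rat_z * Z\<^sup>T $$ (i, j) = (rat_z \<cdot>\<^sub>m Z\<^sup>T) $$ (i, j)"
      by (rule index_smult_mat(1)[symmetric]) (use carrier_matD[OF Zt] ij in simp_all)
    also have "\<dots> = (rmat_const (S\<^sup>T) * Z\<^sup>T) $$ (i, j) + rmat_const (1\<^sub>m d) $$ (i, j)"
      unfolding eq by (rule index_add_mat(1)) (use ij in simp_all)
    also have "rmat_const (1\<^sub>m d) $$ (i, j) = rat_const (1\<^sub>m d $$ (i, j))"
      using ij by (intro rmat_indices) simp_all
    finally have e: "rat_z * Z\<^sup>T $$ (i, j) =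
        (rmat_const (S\<^sup>T) * Z\<^sup>T) $$ (i, j) + rat_const (1\<^sub>m d $$ (i, j))" .
    have "(x \<cdot>\<^sub>m W) $$ (i, j) = x * rat_eval (Z\<^sup>T $$ (i, j)) x"
      unfolding W_def using ij carrier_matD[OF Zt] by simp
    also have "\<dots> = rat_eval (rat_z * Z\<^sup>T $$ (i, j)) x"
      by (simp only: mult_at(2)[OF rat_z_at(1) r1] rat_z_at(2))
    also have "\<dots> = rat_eval ((rmat_const (S\<^sup>T) * Z\<^sup>T) $$ (i, j)) x + 1\<^sub>m d $$ (i, j)"
      by (simp only: e add_at(2)[OF r2 const_at(1)] const_at(2))
    also have "rat_eval ((rmat_const (S\<^sup>T) * Z\<^sup>T) $$ (i, j)) x = (S\<^sup>T * W) $$ (i, j)"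
      unfolding SW by (rule rmat_indices(5)[symmetric]) (use carrier_matD[OF SZ] ij in simp_all)
    also have "(S\<^sup>T * W) $$ (i, j) + 1\<^sub>m d $$ (i, j) = (S\<^sup>T * W + 1\<^sub>m d) $$ (i, j)"
      by (rule index_add_mat(1)[symmetric]) (use ij in simp_all)
    finally show "(x \<cdot>\<^sub>m W) $$ (i, j) = (S\<^sup>T * W + 1\<^sub>m d) $$ (i, j)" .
  qed (use W in simp_all)
  have "(x \<cdot>\<^sub>m 1\<^sub>m d - S\<^sup>T) * W = x \<cdot>\<^sub>m W - S\<^sup>T * W"
    using St W by (simp add: minus_mult_distrib_mat[of _ d d _ _ d] mult_smult_assoc_mat[of _ d d _ d])
  also have "\<dots> = 1\<^sub>m d"
  proof -
    have "a + 1\<^sub>m d - a = 1\<^sub>m d" if "a \<in> carrier_mat d d" for a :: "complex mat"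
      using that by (intro eq_matI) auto
    then show ?thesis unfolding xW using mult_carrier_mat[OF St W] .
  qed
  finally have inv: "(x \<cdot>\<^sub>m 1\<^sub>m d - S\<^sup>T) * W = 1\<^sub>m d" .
  have Xt: "x \<cdot>\<^sub>m 1\<^sub>m d - S\<^sup>T \<in> carrier_mat d d" using St by (intro minus_carrier_mat)
  have X: "x \<cdot>\<^sub>m 1\<^sub>m d - S \<in> carrier_mat d d" using S by (intro minus_carrier_mat)
  have "(x \<cdot>\<^sub>m 1\<^sub>m d - S)\<^sup>T = x \<cdot>\<^sub>m 1\<^sub>m d - S\<^sup>T"
    using S by (intro eq_matI) auto
  then show ?thesis
    using det_nonzero_if_right_inverse[OF Xt W inv] det_transpose[OF X] by simp
qed

text \<open>The abstract state-space data are expressed through the Hankel data. \<open>T1\<close>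
  and \<open>T2\<close> carry the pencil \<open>z - S\<close> to \<open>z E - F\<close>, and the
  first block row and block column of the factorization identify the transformed output and input as
  \<open>Cc\<close> and \<open>Bc\<close>. Minimality and the location of the eigenvalues are then
  inherited from the abstract realization.\<close>

lemma hankel_realization:
  fixes E :: "complex mat"
  assumes Rin: "Rin \<in> carrier_mat m m" "strictly_proper Rin" "has_total_polar_degree Rin r"
    and ex: "expansion_at_infinity Rin c" and k: "k \<ge> 1"
    and U: "U \<in> carrier_mat (k * m) r" and V: "V \<in> carrier_mat (k * m) r"
    and HV: "block_hankel m k 0 c * V = U * E"
    and UH: "mat_adjoint U * block_hankel m k 0 c = E * mat_adjoint V"
    and E: "E \<in> carrier_mat r r" "E = mat_adjoint U * block_hankel m k 0 c * V" "det E \<noteq> 0"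
    and F: "F = mat_adjoint U * block_hankel m k 1 c * V"
    and Bc: "Bc = E * mat_adjoint (first_rows m V)" and Cc: "Cc = first_rows m U * E"
  obtains Y where "Y \<in> carrier_mat r m"
    "rmat_poly (lin_pencil E F) * Y = rmat_const Bc" "Rin = rmat_const Cc * Y"
    "\<forall>x v. v \<in> carrier_vec r \<longrightarrow> (x \<cdot>\<^sub>m E - F) *\<^sub>v v = 0\<^sub>v r \<longrightarrow> Cc *\<^sub>v v = 0\<^sub>v m \<longrightarrow> v = 0\<^sub>v r"
    "\<forall>x v. v \<in> carrier_vec r \<longrightarrow> (x \<cdot>\<^sub>m E - F)\<^sup>T *\<^sub>v v = 0\<^sub>v r \<longrightarrow>
       Bc\<^sup>T *\<^sub>v v = 0\<^sub>v m \<longrightarrow> v = 0\<^sub>v r"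
    "\<forall>x. mat_regular_at x Rin \<longrightarrow> det (x \<cdot>\<^sub>m E - F) \<noteq> 0"
proof -
  from Rin(3,1,2) obtain S B C Y where S: "S \<in> carrier_mat r r" and B: "B \<in> carrier_mat r m"
    and C: "C \<in> carrier_mat m r" and Y: "Y \<in> carrier_mat r m"
    and LY: "rmat_poly (lin_pencil (1\<^sub>m r) S) * Y = rmat_const B" and CY: "Rin = rmat_const C * Y"
    by (rule strictly_proper_realization)
  have c: "c (Suc l) = C * S ^\<^sub>m l * B" for l
  proof (rule eq_matI)
    fix i j assume "i < dim_row (C * S ^\<^sub>m l * B)" "j < dim_col (C * S ^\<^sub>m l * B)"
    then have ij: "i < m" "j < m" using B C by simp_all
    show "c (Suc l) $$ (i, j) = (C * S ^\<^sub>m l * B) $$ (i, j)"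
    proof (rule markov_parameters[OF S Y B pencil_solution_entry[OF S Y B LY] C _ ij, of "\<lambda>l. c (Suc l)"])
      show "\<forall>i<m. \<forall>j<m. \<forall>\<^sub>F z in at_infinity.
          (\<lambda>l. c (Suc l) $$ (i, j) / z ^ Suc l) sums rat_eval ((rmat_const C * Y) $$ (i, j)) z"
        using ex[unfolded expansion_at_infinity_def carrier_matD[OF Rin(1)]] unfolding CY by blast
    qed
  next
    have "c (Suc l) \<in> carrier_mat m m"
      using ex[unfolded expansion_at_infinity_def carrier_matD[OF Rin(1)]] by simp
    then show "dim_row (c (Suc l)) = dim_row (C * S ^\<^sub>m l * B)" "dim_col (c (Suc l)) = dim_col (C * S ^\<^sub>m l * B)"
      using B C by simp_all
  qed
  define Ob where "Ob = obs_mat k m C S"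
  define Oc where "Oc = obs_mat k m (B\<^sup>T) (S\<^sup>T)"
  define Co where "Co = Oc\<^sup>T"
  have Ob: "Ob \<in> carrier_mat (k * m) r" and Oc: "Oc \<in> carrier_mat (k * m) r"
    using C B by (simp_all add: Ob_def Oc_def)
  then have Co: "Co \<in> carrier_mat r (k * m)" by (simp add: Co_def)
  have H: "block_hankel m k 0 c = Ob * Co" "block_hankel m k 1 c = Ob * S * Co"
    unfolding Ob_def Co_def Oc_def by (rule block_hankel_factorization[OF S B C c])+
  have Ua: "mat_adjoint U \<in> carrier_mat r (k * m)" and Va: "mat_adjoint V \<in> carrier_mat r (k * m)"
    using U V by simp_all
  define T1 where "T1 = mat_adjoint U * Ob"
  define T2 where "T2 = Co * V"
  have T1: "T1 \<in> carrier_mat r r" unfolding T1_def by (rule mult_carrier_mat[OF Ua Ob])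
  have T2: "T2 \<in> carrier_mat r r" unfolding T2_def by (rule mult_carrier_mat[OF Co V])
  have ET: "E = T1 * T2"
    unfolding E(2) H(1) T1_def T2_def assoc_mult_mat[OF Ua Ob Co, symmetric]
    by (rule assoc_mult_mat[OF mult_carrier_mat[OF Ua Ob] Co V])
  have FT: "F = T1 * S * T2"
  proof -
    have "mat_adjoint U * (Ob * S * Co) = mat_adjoint U * (Ob * S) * Co"
      by (rule assoc_mult_mat[OF Ua mult_carrier_mat[OF Ob S] Co, symmetric])
    also have "mat_adjoint U * (Ob * S) = T1 * S"
      unfolding T1_def by (rule assoc_mult_mat[OF Ua Ob S, symmetric])
    finally show ?thesis
      unfolding F H(2) T2_def using assoc_mult_mat[OF mult_carrier_mat[OF T1 S] Co V] by simp
  qed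
  have dT: "det T1 \<noteq> 0" "det T2 \<noteq> 0" using E(3) det_mult[OF T1 T2] by (simp_all add: ET)
  obtain I1 where I1: "I1 \<in> carrier_mat r r" "T1 * I1 = 1\<^sub>m r" "I1 * T1 = 1\<^sub>m r"
    by (rule inverse_if_det_nonzero[OF T1 dT(1)])
  obtain I2 where I2: "I2 \<in> carrier_mat r r" "T2 * I2 = 1\<^sub>m r" "I2 * T2 = 1\<^sub>m r"
    by (rule inverse_if_det_nonzero[OF T2 dT(2)])
  \<comment> \<open>From \<open>Ob Co V = U E = U T1 T2\<close> the factor \<open>T2 = Co V\<close>
    is cancelled; dually, \<open>T1\<close> is cancelled to obtain \<open>CoV\<close>.\<close>
  have ObU: "Ob = U * T1"
  proof -
    have "Ob * T2 = U * T1 * T2"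
      using HV unfolding H(1) ET assoc_mult_mat[OF Ob Co V] T2_def[symmetric] assoc_mult_mat[OF U T1 T2] .
    then have "Ob * T2 * I2 = U * T1 * T2 * I2" by simp
    then show ?thesis
      unfolding assoc_mult_mat[OF Ob T2 I2(1)] assoc_mult_mat[OF mult_carrier_mat[OF U T1] T2 I2(1)] I2(2)
        right_mult_one_mat[OF Ob] right_mult_one_mat[OF mult_carrier_mat[OF U T1]] .
  qed
  have CoV: "Co = T2 * mat_adjoint V"
  proof -
    have "T1 * Co = T1 * (T2 * mat_adjoint V)"
      using UH unfolding H(1) ET assoc_mult_mat[OF Ua Ob Co, symmetric] T1_def[symmetric] assoc_mult_mat[OF T1 T2 Va] .
    then have "I1 * (T1 * Co) = I1 * (T1 * (T2 * mat_adjoint V))" by simp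
    then show ?thesis
      unfolding assoc_mult_mat[OF I1(1) T1 Co, symmetric]
        assoc_mult_mat[OF I1(1) T1 mult_carrier_mat[OF T2 Va], symmetric] I1(3)
        left_mult_one_mat[OF Co] left_mult_one_mat[OF mult_carrier_mat[OF T2 Va]] .
  qed
  have mk: "m \<le> k * m" using k by (cases k) auto
  have fU: "first_rows m U \<in> carrier_mat m r" and fV: "mat_adjoint (first_rows m V) \<in> carrier_mat r m"
    using U V by simp_all
  have CU: "C = first_rows m U * T1"
    using first_rows_obs_mat[OF S C k] first_rows_mult[OF U T1 mk] unfolding Ob_def[symmetric] ObU by simp
  \<comment> \<open>The first block column of \<open>Co\<close> is \<open>B\<close>; it is read off
    after transposition, as the first block row of \<open>Oc\<close>.\<close>
  have BV: "B = T2 * mat_adjoint (first_rows m V)"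
  proof -
    have V': "(mat_adjoint V)\<^sup>T \<in> carrier_mat (k * m) r" using V by simp
    have "B\<^sup>T = first_rows m Oc"
      unfolding Oc_def by (rule first_rows_obs_mat[symmetric, OF _ _ k]) (use S B in simp_all)
    also have "Oc = (mat_adjoint V)\<^sup>T * T2\<^sup>T"
      using arg_cong[OF CoV, of transpose_mat] transpose_mult[OF T2 Va] by (simp add: Co_def)
    also have "first_rows m \<dots> = first_rows m ((mat_adjoint V)\<^sup>T) * T2\<^sup>T"
      by (rule first_rows_mult[OF V' _ mk]) (use T2 in simp)
    also have "first_rows m ((mat_adjoint V)\<^sup>T) = (mat_adjoint (first_rows m V))\<^sup>T"
      unfolding transpose_adjoint
    proof (rule eq_matI)
      fix i j assume "i < dim_row (map_mat cnj (first_rows m V))" "j < dim_col (map_mat cnj (first_rows m V))"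
      then have "i < m" "j < r" using V by (simp_all add: first_rows_def)
      then show "first_rows m (map_mat cnj V) $$ (i, j) = map_mat cnj (first_rows m V) $$ (i, j)"
        using V less_le_trans[OF \<open>i < m\<close> mk] by (simp add: first_rows_def)
    qed (simp_all add: first_rows_def)
    also have "\<dots> * T2\<^sup>T = (T2 * mat_adjoint (first_rows m V))\<^sup>T"
      by (rule transpose_mult[OF T2 fV, symmetric])
    finally show ?thesis by (metis transpose_transpose)
  qed
  have CcT: "Cc = C * T2"
    unfolding Cc ET CU by (rule assoc_mult_mat[OF fU T1 T2, symmetric])
  have BcT: "Bc = T1 * B"
    unfolding Bc ET BV by (rule assoc_mult_mat[OF T1 T2 fV])
  \<comment> \<open>\<open>T1\<close> is the adjoint of \<open>U\<close> times \<open>Ob\<close>, so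
    its inverse times that adjoint undoes \<open>Ob\<close>. Likewise \<open>V * I2\<close> is a
    right inverse of \<open>Co\<close>, whose transpose is the left inverse required next.\<close>
  have Lo: "I1 * mat_adjoint U \<in> carrier_mat r (k * m)" "I1 * mat_adjoint U * obs_mat k m C S = 1\<^sub>m r"
    using mult_carrier_mat[OF I1(1) Ua] assoc_mult_mat[OF I1(1) Ua Ob] I1(3)
    by (simp_all add: T1_def Ob_def)
  have Lc: "(V * I2)\<^sup>T \<in> carrier_mat r (k * m)"
    "(V * I2)\<^sup>T * obs_mat k m (B\<^sup>T) (S\<^sup>T) = 1\<^sub>m r"
  proof -
    have VI: "V * I2 \<in> carrier_mat (k * m) r" by (rule mult_carrier_mat[OF V I2(1)])
    then show "(V * I2)\<^sup>T \<in> carrier_mat r (k * m)" by simp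
    have "(Co * (V * I2))\<^sup>T = (V * I2)\<^sup>T * Oc"
      using transpose_mult[OF Co VI] unfolding Co_def transpose_transpose .
    moreover have "Co * (V * I2) = 1\<^sub>m r"
      unfolding assoc_mult_mat[OF Co V I2(1), symmetric] T2_def[symmetric] by (rule I2(2))
    ultimately show "(V * I2)\<^sup>T * obs_mat k m (B\<^sup>T) (S\<^sup>T) = 1\<^sub>m r"
      by (simp add: Oc_def)
  qed
  have cT: "rmat_const T1 \<in> carrier_mat r r" "rmat_const T2 \<in> carrier_mat r r" "rmat_const I2 \<in> carrier_mat r r"
    using T1 T2 I2 by simp_all
  define L where "L = rmat_poly (lin_pencil (1\<^sub>m r) S)"
  have L: "L \<in> carrier_mat r r" unfolding L_def using S by simp
  have lp: "lin_pencil (1\<^sub>m r) S \<in> carrier_mat r r" using S by simp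
  have pen: "rmat_poly (lin_pencil E F) = rmat_const T1 * L * rmat_const T2"
  proof -
    have p: "pmat_const T1 \<in> carrier_mat r r" "pmat_const T2 \<in> carrier_mat r r" using T1 T2 by simp_all
    show ?thesis
      unfolding ET FT lin_pencil_congruence[OF T1 S T2] rmat_poly_mult[OF mult_carrier_mat[OF p(1) lp] p(2)]
        rmat_poly_mult[OF p(1) lp] L_def by simp
  qed
  \<comment> \<open>The state in the new coordinates: \<open>T2\<close> restores \<open>Y\<close>,
    after which \<open>T1\<close> turns the input \<open>B\<close> into \<open>Bc\<close>.\<close>
  define Y' where "Y' = rmat_const I2 * Y"
  have Y': "Y' \<in> carrier_mat r m" unfolding Y'_def by (rule mult_carrier_mat[OF cT(3) Y])
  have TY: "rmat_const T2 * Y' = Y"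
  proof -
    have "rmat_const T2 * rmat_const I2 = 1\<^sub>m r" using rmat_const_mult[OF T2 I2(1)] by (simp add: I2(2))
    then show ?thesis
      unfolding Y'_def assoc_mult_mat[OF cT(2,3) Y, symmetric] using left_mult_one_mat[OF Y] by simp
  qed
  show ?thesis
  proof (rule that[OF Y'], goal_cases)
    case 1
    have "rmat_poly (lin_pencil E F) * Y' = rmat_const T1 * L * Y"
      unfolding pen assoc_mult_mat[OF mult_carrier_mat[OF cT(1) L] cT(2) Y'] TY ..
    also have "\<dots> = rmat_const T1 * rmat_const B"
      unfolding assoc_mult_mat[OF cT(1) L Y] LY[folded L_def] ..
    finally show ?case
      unfolding BcT rmat_const_mult[OF T1 B] .
  next
    case 2
    have "rmat_const Cc * Y' = rmat_const C * (rmat_const T2 * Y')"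
      unfolding CcT rmat_const_mult[OF C T2] by (rule assoc_mult_mat[OF _ cT(2) Y']) (use C in simp)
    then show ?case unfolding TY CY ..
  next
    case 3
    show ?case
    proof (intro allI impI)
      fix x v assume v: "v \<in> carrier_vec r" "(x \<cdot>\<^sub>m E - F) *\<^sub>v v = 0\<^sub>v r" "Cc *\<^sub>v v = 0\<^sub>v m"
      show "v = 0\<^sub>v r"
        by (rule pencil_observable[OF T1 T2 dT S C Lo v(1) v(2)[unfolded ET FT] v(3)[unfolded CcT]])
    qed
  next
    case 4
    show ?case
    proof (intro allI impI)
      fix x v assume v: "v \<in> carrier_vec r" "(x \<cdot>\<^sub>m E - F)\<^sup>T *\<^sub>v v = 0\<^sub>v r" "Bc\<^sup>T *\<^sub>v v = 0\<^sub>v m"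
      have t: "T1\<^sup>T \<in> carrier_mat r r" "T2\<^sup>T \<in> carrier_mat r r"
        "S\<^sup>T \<in> carrier_mat r r" "B\<^sup>T \<in> carrier_mat m r"
        using T1 T2 S B by simp_all
      have d: "det (T1\<^sup>T) \<noteq> 0" "det (T2\<^sup>T) \<noteq> 0"
        using dT by (simp_all add: det_transpose[OF T1] det_transpose[OF T2])
      have "(x \<cdot>\<^sub>m E - F)\<^sup>T = x \<cdot>\<^sub>m E\<^sup>T - F\<^sup>T"
      proof -
        have "(x \<cdot>\<^sub>m a - b)\<^sup>T = x \<cdot>\<^sub>m a\<^sup>T - b\<^sup>T"
          if "a \<in> carrier_mat r r" "b \<in> carrier_mat r r" for a b :: "complex mat"
          using that by (intro eq_matI) auto
        then show ?thesis using E(1) mult_carrier_mat[OF mult_carrier_mat[OF T1 S] T2, folded FT] .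
      qed
      also have "E\<^sup>T = T2\<^sup>T * T1\<^sup>T" unfolding ET by (rule transpose_mult[OF T1 T2])
      also have "F\<^sup>T = T2\<^sup>T * S\<^sup>T * T1\<^sup>T"
        unfolding FT transpose_mult[OF mult_carrier_mat[OF T1 S] T2] transpose_mult[OF T1 S]
        by (rule assoc_mult_mat[OF t(2,3,1), symmetric])
      finally have 1: "(x \<cdot>\<^sub>m (T2\<^sup>T * T1\<^sup>T) - T2\<^sup>T * S\<^sup>T * T1\<^sup>T) *\<^sub>v v = 0\<^sub>v r"
        using v(2) by simp
      have 2: "(B\<^sup>T * T1\<^sup>T) *\<^sub>v v = 0\<^sub>v m"
        using v(3) unfolding BcT transpose_mult[OF T1 B] .
      show "v = 0\<^sub>v r"
        by (rule pencil_observable[OF t(2,1) d(2,1) t(3,4) Lc v(1) 1 2])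
    qed
  next
    case 5
    show ?case
    proof (intro allI impI)
      fix x assume "mat_regular_at x Rin"
      then have "det (x \<cdot>\<^sub>m 1\<^sub>m r - S) \<noteq> 0"
        unfolding CY by (rule regular_point_not_eigenvalue[OF S B C Y LY Lo Lc])
      moreover have X: "x \<cdot>\<^sub>m 1\<^sub>m r - S \<in> carrier_mat r r" using S by (intro minus_carrier_mat)
      ultimately show "det (x \<cdot>\<^sub>m E - F) \<noteq> 0"
        unfolding ET FT shifted_congruence[OF T1 S T2] det_mult[OF mult_carrier_mat[OF T1 X] T2] det_mult[OF T1 X]
        using dT by simp
    qed
  qed
qed

section \<open>The para-Hermitian decomposition\<close>

lemma rmat_star_carrier: "G \<in> carrier_mat n k \<Longrightarrow> rmat_star G \<in> carrier_mat k n"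
  by (simp add: rmat_star_def)

lemma rmat_star_index:
  "G \<in> carrier_mat n k \<Longrightarrow> i < k \<Longrightarrow> j < n \<Longrightarrow> rmat_star G $$ (i, j) = rat_cnj (G $$ (j, i))"
  by (simp add: rmat_star_def)

lemma rmat_recip_carrier: "G \<in> carrier_mat n k \<Longrightarrow> rmat_recip G \<in> carrier_mat n k"
  by (simp add: rmat_recip_def)

lemma rmat_recip_index:
  "G \<in> carrier_mat n k \<Longrightarrow> i < n \<Longrightarrow> j < k \<Longrightarrow> rmat_recip G $$ (i, j) = rat_recip (G $$ (i, j))"
  by (simp add: rmat_recip_def)

lemma rat_cnj_tendsto_0:
  assumes "(rat_eval r \<longlongrightarrow> 0) at_infinity"
  shows "(rat_eval (rat_cnj r) \<longlongrightarrow> 0) at_infinity"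
proof -
  have c: "filterlim cnj at_infinity at_infinity"
    unfolding filterlim_iff eventually_at_infinity by (metis complex_mod_cnj)
  have "((\<lambda>x. cnj (rat_eval r (cnj x))) \<longlongrightarrow> cnj 0) at_infinity"
    by (intro tendsto_cnj filterlim_compose[OF assms c])
  moreover have "eventually (\<lambda>x. regular_at (cnj x) r) at_infinity"
    using c eventually_regular_at_infinity by (rule eventually_compose_filterlim[rotated])
  then have "eventually (\<lambda>x. cnj (rat_eval r (cnj x)) = rat_eval (rat_cnj r) x) at_infinity"
    by eventually_elim (simp add: rat_cnj_at)
  ultimately show ?thesis by (simp add: tendsto_cong)
qed

text \<open>The difference \<open>R\<^sub>i\<^sub>n\<^sup>*(z) - R\<^sub>o\<^sub>u\<^sub>t(1/z)\<close> has all its poles inside the unit disk, but it also equals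
  \<open>R\<^sub>i\<^sub>n(1/z) - R\<^sub>o\<^sub>u\<^sub>t\<^sup>*(z) + R\<^sub>0 - R\<^sub>0\<^sup>*\<close>, whose poles lie outside. Hence it is entire, and it
  vanishes at infinity.\<close>

lemma para_hermitian_parts:
  assumes R: "para_hermitian R"
    and dec: "Rin \<in> carrier_mat m m" "Rout \<in> carrier_mat m m" "R0 \<in> carrier_mat m m"
      "R = Rin + Rout + rmat_const R0"
    and Rin: "strictly_proper Rin" "\<And>x. has_pole Rin x \<Longrightarrow> cmod x < 1"
    and Rout: "rmat_eval Rout 0 = 0\<^sub>m m m" "\<And>x. has_pole Rout x \<Longrightarrow> cmod x > 1"
  shows "Rout = rmat_recip (rmat_star Rin)" "mat_adjoint R0 = R0"
proof -
  have cR: "R \<in> carrier_mat m m" unfolding dec(4) using dec by simp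
  have Rij: "R $$ (i, j) = Rin $$ (i, j) + Rout $$ (i, j) + rat_const (R0 $$ (i, j))" if "i < m" "j < m" for i j
    unfolding dec(4) using dec(1-3) that by simp
  have sym: "rat_cnj (R $$ (j, i)) = rat_recip (R $$ (i, j))" if "i < m" "j < m" for i j
  proof -
    have "rmat_star R $$ (i, j) = rmat_recip R $$ (i, j)" using R by (simp add: para_hermitian_def)
    then show ?thesis using that by (simp add: rmat_star_index[OF cR] rmat_recip_index[OF cR])
  qed
  have key: "rat_cnj (Rin $$ (j, i)) = rat_recip (Rout $$ (i, j)) \<and> R0 $$ (i, j) = cnj (R0 $$ (j, i))"
    if ij: "i < m" "j < m" for i j
  proof -
    define a where "a = Rin $$ (i, j)"
    define a' where "a' = Rin $$ (j, i)"
    define b where "b = Rout $$ (i, j)"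
    define b' where "b' = Rout $$ (j, i)"
    have "\<not> has_pole Rin x" if "cmod x \<ge> 1" for x using Rin(2)[of x] that by auto
    then have ra: "regular_at x a" "regular_at x a'" if "cmod x \<ge> 1" for x
      using that ij dec(1) unfolding has_pole_iff a_def a'_def by auto
    have "\<not> has_pole Rout x" if "cmod x \<le> 1" for x using Rout(2)[of x] that by auto
    then have rb: "regular_at x b" "regular_at x b'" if "cmod x \<le> 1" for x
      using that ij dec(2) unfolding has_pole_iff b_def b'_def by auto
    have la: "(rat_eval a \<longlongrightarrow> 0) at_infinity" "(rat_eval a' \<longlongrightarrow> 0) at_infinity"
      using Rin(1) ij dec(1) unfolding strictly_proper_def a_def a'_def by auto
    have "rmat_eval Rout 0 $$ (i, j) = 0" "rmat_eval Rout 0 $$ (j, i) = 0"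
      using ij by (simp_all add: Rout(1))
    then have b0: "rat_eval b 0 = 0" "rat_eval b' 0 = 0"
      using ij dec(2) by (simp_all add: b_def b'_def)
    define s where "s = rat_cnj a' - rat_recip b"
    define t where "t = rat_recip a - rat_cnj b'"
    have st: "s = t + rat_const (R0 $$ (i, j) - cnj (R0 $$ (j, i)))"
      using sym[OF ij] unfolding Rij[OF ij] Rij[OF ij(2,1)]
      by (simp add: s_def t_def a_def a'_def b_def b'_def rat_cnj.hom_add rat_recip.hom_add
          rat_const.hom_minus algebra_simps)
    have rt0: "regular_at 0 (rat_recip a)" "rat_eval (rat_recip a) 0 = 0"
      by (rule rat_recip_at_0[OF la(1)])+
    have rc0: "regular_at 0 (rat_cnj b')" "rat_eval (rat_cnj b') 0 = 0"
      using rat_cnj_at[of 0 b'] rb(2)[of 0] b0 by simp_all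
    have "regular_at x s" for x
    proof (cases "cmod x \<ge> 1")
      case True
      then have "x \<noteq> 0" by auto
      have "regular_at x (rat_cnj a')" by (rule rat_cnj_at) (use ra True in simp)
      moreover have "regular_at x (rat_recip b)"
      proof (rule rat_recip_at[OF \<open>x \<noteq> 0\<close>])
        have "cmod (1 / x) \<le> 1" using True \<open>x \<noteq> 0\<close> by (simp add: norm_divide divide_le_eq)
        then show "regular_at (1 / x) b" by (rule rb)
      qed
      ultimately show ?thesis by (simp add: s_def)
    next
      case False
      have "regular_at x (rat_cnj b')" by (rule rat_cnj_at) (use rb False in simp)
      moreover have "regular_at x (rat_recip a)"
      proof (cases "x = 0")
        case True
        then show ?thesis using rt0 by simp
      next
        case nz: False
        show ?thesis
        proof (rule rat_recip_at[OF nz])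
          have "1 \<le> cmod (1 / x)" using False nz by (simp add: norm_divide le_divide_eq)
          then show "regular_at (1 / x) a" by (rule ra)
        qed
      qed
      ultimately show ?thesis by (simp add: st t_def)
    qed
    moreover have "(rat_eval s \<longlongrightarrow> 0) at_infinity"
    proof -
      have "((\<lambda>x. rat_eval (rat_cnj a') x - rat_eval (rat_recip b) x) \<longlongrightarrow> 0 - 0) at_infinity"
        by (intro tendsto_diff rat_cnj_tendsto_0 rat_recip_tendsto_0 la b0 rb) simp
      moreover have "eventually (\<lambda>x. rat_eval (rat_cnj a') x - rat_eval (rat_recip b) x = rat_eval s x) at_infinity"
        using eventually_regular_at_infinity[of "rat_cnj a'"] eventually_regular_at_infinity[of "rat_recip b"]
        by eventually_elim (simp add: s_def)
      ultimately show ?thesis by (simp add: tendsto_cong)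
    qed
    ultimately have s0: "s = 0" by (rule entire_tendsto_0_imp_0)
    \<comment> \<open>Both terms of \<open>t\<close> vanish at \<open>0\<close>, so evaluating
      \<open>s = 0\<close> there leaves exactly the deviation of \<open>R0\<close> from being
      Hermitian.\<close>
    have "rat_eval s 0 = R0 $$ (i, j) - cnj (R0 $$ (j, i))"
      unfolding st t_def using rt0 rc0 by simp
    then have "R0 $$ (i, j) = cnj (R0 $$ (j, i))" unfolding s0 by simp
    then show ?thesis using s0 by (simp add: s_def a'_def b_def)
  qed
  have c: "rmat_recip (rmat_star Rin) \<in> carrier_mat m m"
    by (intro rmat_recip_carrier rmat_star_carrier dec)
  show "Rout = rmat_recip (rmat_star Rin)"
  proof (rule eq_matI)
    fix i j assume "i < dim_row (rmat_recip (rmat_star Rin))" "j < dim_col (rmat_recip (rmat_star Rin))"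
    then have ij: "i < m" "j < m" using carrier_matD[OF c] by simp_all
    have "Rout $$ (i, j) = rat_recip (rat_cnj (Rin $$ (j, i)))"
      using key[OF ij] by simp
    then show "Rout $$ (i, j) = rmat_recip (rmat_star Rin) $$ (i, j)"
      using ij by (simp add: rmat_recip_index[OF rmat_star_carrier[OF dec(1)]] rmat_star_index[OF dec(1)])
  next
    show "dim_row Rout = dim_row (rmat_recip (rmat_star Rin))" "dim_col Rout = dim_col (rmat_recip (rmat_star Rin))"
      unfolding carrier_matD[OF c] using dec(2) by simp_all
  qed
  show "mat_adjoint R0 = R0"
  proof (rule eq_matI)
    fix i j assume "i < dim_row R0" "j < dim_col R0"
    then have ij: "i < m" "j < m" using dec(3) by simp_all
    then have "mat_adjoint R0 $$ (i, j) = cnj (R0 $$ (j, i))" using dec(3) by simp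
    also have "\<dots> = R0 $$ (i, j)" by (rule conjunct2[OF key[OF ij], symmetric])
    finally show "mat_adjoint R0 $$ (i, j) = R0 $$ (i, j)" .
  qed (use dec(3) in simp_all)
qed

section \<open>Reversal combined with conjugate transposition\<close>

lemma rmat_dual_mult:
  assumes "A \<in> carrier_mat n k" "B \<in> carrier_mat k l"
  shows "rmat_recip (rmat_star (A * B)) = rmat_recip (rmat_star B) * rmat_recip (rmat_star A)"
  unfolding rmat_recip_def rmat_star_def transpose_mult[OF assms]
  by (subst rat_cnj.mat_hom_mult[of _ l k _ n])
    (use assms in \<open>simp_all add: rat_recip.mat_hom_mult[of _ l k _ n]\<close>)

lemma rmat_dual_const: "rmat_recip (rmat_star (rmat_const A)) = rmat_const (mat_adjoint A)"
  by (rule eq_matI) (simp_all add: rmat_recip_def rmat_star_def)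

text \<open>The dual of \<open>z E - F\<close>, multiplied by \<open>z\<close> to clear the
  denominator that the substitution of \<open>1/z\<close> creates; see
  \<open>rmat_dual_lin_pencil\<close>.\<close>

definition dual_pencil :: "complex mat \<Rightarrow> complex mat \<Rightarrow> complex poly mat" where
  "dual_pencil E F = pmat_const (mat_adjoint E) - [:0, 1:] \<cdot>\<^sub>m pmat_const (mat_adjoint F)"

lemma dual_pencil_carrier: "E \<in> carrier_mat n k \<Longrightarrow> F \<in> carrier_mat n k \<Longrightarrow> dual_pencil E F \<in> carrier_mat k n"
  unfolding dual_pencil_def by (rule minus_carrier_mat) simp

lemma pmat_eval_dual_pencil:
  assumes "E \<in> carrier_mat n k" "F \<in> carrier_mat n k"
  shows "pmat_eval (dual_pencil E F) x = mat_adjoint E - x \<cdot>\<^sub>m mat_adjoint F"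
  using assms unfolding dual_pencil_def by (intro eq_matI) simp_all

lemma rmat_dual_lin_pencil:
  assumes "E \<in> carrier_mat n k" "F \<in> carrier_mat n k"
  shows "rat_z \<cdot>\<^sub>m rmat_recip (rmat_star (rmat_poly (lin_pencil E F))) = rmat_poly (dual_pencil E F)"
proof (rule eq_matI)
  fix i j assume "i < dim_row (rmat_poly (dual_pencil E F))" "j < dim_col (rmat_poly (dual_pencil E F))"
  then have ij: "i < k" "j < n" using assms by (simp_all add: dual_pencil_def)
  have "rmat_poly (lin_pencil E F) $$ (j, i) = rat_z * rat_const (E $$ (j, i)) - rat_const (F $$ (j, i))"
    unfolding rmat_lin_pencil[OF assms] using assms ij by simp
  then have "(rat_z \<cdot>\<^sub>m rmat_recip (rmat_star (rmat_poly (lin_pencil E F)))) $$ (i, j) =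
      rat_z * (rat_recip (rat_cnj (rat_z * rat_const (E $$ (j, i)) - rat_const (F $$ (j, i)))))"
    using ij assms by (simp add: rmat_recip_def rmat_star_def lin_pencil_def)
  also have "\<dots> = rat_const (cnj (E $$ (j, i))) - rat_z * rat_const (cnj (F $$ (j, i)))"
    by (simp add: rat_cnj.hom_minus rat_cnj.hom_mult rat_recip.hom_minus rat_recip.hom_mult field_simps)
  also have "\<dots> = rmat_poly (dual_pencil E F) $$ (i, j)"
    using ij assms by (simp add: dual_pencil_def rat_const_def rat_z_def flip: to_fract_mult to_fract_diff)
  finally show "(rat_z \<cdot>\<^sub>m rmat_recip (rmat_star (rmat_poly (lin_pencil E F)))) $$ (i, j) =
      rmat_poly (dual_pencil E F) $$ (i, j)" .
qed (use assms in \<open>simp_all add: dual_pencil_def rmat_recip_def rmat_star_def lin_pencil_def\<close>)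

text \<open>Dualizing reverses products, so \<open>P Y = B\<close> becomes an equation with the dual
  of \<open>P\<close> on the right. Multiplying it by \<open>z\<close> produces the polynomial
  \<open>dual_pencil\<close>, at the price of the factor \<open>z\<close> on the adjoint of
  \<open>B\<close>; input and output change places.\<close>

lemma dual_realization:
  assumes E: "E \<in> carrier_mat r r" and F: "F \<in> carrier_mat r r" and B: "B \<in> carrier_mat r m"
    and C: "C \<in> carrier_mat m r" and Y: "Y \<in> carrier_mat r m"
    and EY: "rmat_poly (lin_pencil E F) * Y = rmat_const B"
    and d: "det (dual_pencil E F) \<noteq> 0"
  shows "rmat_recip (rmat_star (rmat_const C * Y)) =
    (rat_z \<cdot>\<^sub>m rmat_const (mat_adjoint B)) * rmat_inverse (rmat_poly (dual_pencil E F)) * rmat_const (mat_adjoint C)"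
proof -
  let ?D = "\<lambda>G. rmat_recip (rmat_star G)"
  define P where "P = rmat_poly (lin_pencil E F)"
  define Q where "Q = rmat_poly (dual_pencil E F)"
  have P: "P \<in> carrier_mat r r" using E F by (simp add: P_def)
  have Q: "Q \<in> carrier_mat r r" using dual_pencil_carrier[OF E F] by (simp add: Q_def)
  have DY: "?D Y \<in> carrier_mat m r" and DP: "?D P \<in> carrier_mat r r"
    by (intro rmat_recip_carrier rmat_star_carrier Y P)+
  have dQ: "det Q \<noteq> 0" using d by (simp add: Q_def det_rmat_poly)
  have "?D Y * ?D P = rmat_const (mat_adjoint B)"
    unfolding rmat_dual_mult[OF P Y, symmetric] EY[folded P_def] by (rule rmat_dual_const)
  then have "?D Y * (rat_z \<cdot>\<^sub>m ?D P) = rat_z \<cdot>\<^sub>m rmat_const (mat_adjoint B)"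
    unfolding mult_smult_distrib[OF DY DP] by simp
  then have "?D Y * Q = rat_z \<cdot>\<^sub>m rmat_const (mat_adjoint B)"
    unfolding P_def Q_def rmat_dual_lin_pencil[OF E F] .
  then have "?D Y * Q * rmat_inverse Q = (rat_z \<cdot>\<^sub>m rmat_const (mat_adjoint B)) * rmat_inverse Q" by simp
  then have DYe: "?D Y = (rat_z \<cdot>\<^sub>m rmat_const (mat_adjoint B)) * rmat_inverse Q"
    unfolding assoc_mult_mat[OF DY Q rmat_inverse(1)[OF Q dQ]] rmat_inverse(2)[OF Q dQ] right_mult_one_mat[OF DY] .
  have "?D (rmat_const C * Y) = ?D Y * ?D (rmat_const C)"
    by (rule rmat_dual_mult[OF _ Y]) (use C in simp)
  then show ?thesis unfolding DYe rmat_dual_const Q_def .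
qed

section \<open>Block pencils\<close>

lemma map_four_block_mat:
  assumes "A \<in> carrier_mat n1 k1" "B \<in> carrier_mat n1 k2" "C \<in> carrier_mat n2 k1" "D \<in> carrier_mat n2 k2"
  shows "map_mat f (four_block_mat A B C D) =
    four_block_mat (map_mat f A) (map_mat f B) (map_mat f C) (map_mat f D)"
  using assms by (intro eq_matI) simp_all


lemma map_append_rows:
  assumes "A \<in> carrier_mat n1 k" "B \<in> carrier_mat n2 k"
  shows "map_mat f (A @\<^sub>r B) = map_mat f A @\<^sub>r map_mat f B"
  using assms unfolding append_rows_def by (intro eq_matI) simp_all

lemma map_append_cols:
  assumes "A \<in> carrier_mat n k1" "B \<in> carrier_mat n k2"
  shows "map_mat f (A @\<^sub>c B) = map_mat f A @\<^sub>c map_mat f B"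
  using assms unfolding append_cols_def by (intro eq_matI) simp_all

lemma transpose_append_cols:
  assumes "A \<in> carrier_mat n k1" "B \<in> carrier_mat n k2"
  shows "(A @\<^sub>c B)\<^sup>T = A\<^sup>T @\<^sub>r B\<^sup>T"
  using assms unfolding append_cols_def append_rows_def by (intro eq_matI) simp_all

lemma transpose_append_rows:
  assumes "A \<in> carrier_mat n1 k" "B \<in> carrier_mat n2 k"
  shows "(A @\<^sub>r B)\<^sup>T = A\<^sup>T @\<^sub>c B\<^sup>T"
  using assms unfolding append_cols_def append_rows_def by (intro eq_matI) simp_all

lemma append_cols_mult_append_rows:
  assumes A: "A \<in> carrier_mat m r" and B: "B \<in> carrier_mat m s" and C: "C \<in> carrier_mat r n" and D: "D \<in> carrier_mat s n"
  shows "(A @\<^sub>c B) * (C @\<^sub>r D) = A * C + B * D"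
proof -
  have "(A @\<^sub>c B) * (C @\<^sub>r D) = four_block_mat (A * C + B * D) (A * 0\<^sub>m r 0 + B * 0\<^sub>m s 0)
      (0\<^sub>m 0 r * C + 0\<^sub>m 0 s * D) (0\<^sub>m 0 r * 0\<^sub>m r 0 + 0\<^sub>m 0 s * 0\<^sub>m s 0)"
    using mult_four_block_mat[OF A B zero_carrier_mat zero_carrier_mat C zero_carrier_mat D zero_carrier_mat, of 0 0]
    unfolding append_cols_def append_rows_def carrier_matD[OF A] carrier_matD[OF B] carrier_matD[OF C] carrier_matD[OF D] .
  also have "\<dots> = A * C + B * D"
  proof -
    have "four_block_mat X (A * 0\<^sub>m r 0 + B * 0\<^sub>m s 0) (0\<^sub>m 0 r * C + 0\<^sub>m 0 s * D)
        (0\<^sub>m 0 r * 0\<^sub>m r 0 + 0\<^sub>m 0 s * 0\<^sub>m s 0) = X" if "X \<in> carrier_mat m n" for X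
      using that by (intro eq_matI) simp_all
    then show ?thesis using add_carrier_mat[OF mult_carrier_mat[OF B D]] .
  qed
  finally show ?thesis .
qed

text \<open>The antidiagonal blocks cross the two components, so a system of this shape is solved
  one component at a time.\<close>

lemma antidiagonal_mult_append_rows:
  assumes M: "M \<in> carrier_mat r r" and N: "N \<in> carrier_mat r r" and X: "X1 \<in> carrier_mat r n" "X2 \<in> carrier_mat r n"
  shows "four_block_mat (0\<^sub>m r r) M N (0\<^sub>m r r) * (X1 @\<^sub>r X2) = (M * X2) @\<^sub>r (N * X1)"
proof -
  have "four_block_mat (0\<^sub>m r r) M N (0\<^sub>m r r) * (X1 @\<^sub>r X2) =
      four_block_mat (0\<^sub>m r r * X1 + M * X2) (0\<^sub>m r r * 0\<^sub>m r 0 + M * 0\<^sub>m r 0)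
       (N * X1 + 0\<^sub>m r r * X2) (N * 0\<^sub>m r 0 + 0\<^sub>m r r * 0\<^sub>m r 0)"
    using mult_four_block_mat[OF zero_carrier_mat M N zero_carrier_mat X(1) zero_carrier_mat X(2) zero_carrier_mat, of 0]
    unfolding append_rows_def carrier_matD[OF X(1)] carrier_matD[OF X(2)] .
  also have "0\<^sub>m r r * X1 + M * X2 = M * X2"
    unfolding left_mult_zero_mat[OF X(1)] by (rule left_add_zero_mat[OF mult_carrier_mat[OF M X(2)]])
  also have "N * X1 + 0\<^sub>m r r * X2 = N * X1"
    unfolding left_mult_zero_mat[OF X(2)] by (rule right_add_zero_mat[OF mult_carrier_mat[OF N X(1)]])
  also have "four_block_mat (M * X2) (0\<^sub>m r r * 0\<^sub>m r 0 + M * 0\<^sub>m r 0) (N * X1) (N * 0\<^sub>m r 0 + 0\<^sub>m r r * 0\<^sub>m r 0) =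
      (M * X2) @\<^sub>r (N * X1)"
    using M N X unfolding append_rows_def by (intro eq_matI) simp_all
  finally show ?thesis .
qed

lemma append_vec_0D:
  assumes "a @\<^sub>v b = 0\<^sub>v (n + k)" "a \<in> carrier_vec n" "b \<in> carrier_vec k"
  shows "a = 0\<^sub>v n" "b = 0\<^sub>v k"
proof -
  have "a @\<^sub>v b = 0\<^sub>v n @\<^sub>v 0\<^sub>v k" unfolding assms(1) by (intro eq_vecI) auto
  then have "a = 0\<^sub>v n \<and> b = 0\<^sub>v k" using append_vec_eq[OF assms(2) zero_carrier_vec] by simp
  then show "a = 0\<^sub>v n" "b = 0\<^sub>v k" by simp_all
qed

lemma null_append_rows:
  fixes A :: "complex mat"
  assumes A: "A \<in> carrier_mat n k" and C: "C \<in> carrier_mat q k" and v: "v \<in> carrier_vec k"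
    and null: "(- A @\<^sub>r C) *\<^sub>v v = 0\<^sub>v (n + q)"
  shows "A *\<^sub>v v = 0\<^sub>v n" "C *\<^sub>v v = 0\<^sub>v q"
proof -
  have nA: "- A \<in> carrier_mat n k" using A by simp
  have "(- A *\<^sub>v v) @\<^sub>v (C *\<^sub>v v) = 0\<^sub>v (n + q)"
    using null unfolding mat_mult_append[OF nA C v] .
  note z = append_vec_0D[OF this mult_mat_vec_carrier[OF nA v] mult_mat_vec_carrier[OF C v]]
  show "C *\<^sub>v v = 0\<^sub>v q" by (rule z(2))
  show "A *\<^sub>v v = 0\<^sub>v n"
  proof (rule eq_vecI)
    fix i assume "i < dim_vec (0\<^sub>v n :: complex vec)"
    then have i: "i < n" by simp
    have "(A *\<^sub>v v) $ i = - ((- A *\<^sub>v v) $ i)"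
      using A v i by (simp add: scalar_prod_def sum_negf)
    then show "(A *\<^sub>v v) $ i = 0\<^sub>v n $ i" using i by (simp add: z(1))
  qed (use A in simp)
qed

lemma uminus_append_rows_carrier:
  fixes A :: "complex mat"
  assumes "A \<in> carrier_mat n k" "C \<in> carrier_mat q k"
  shows "- A @\<^sub>r C \<in> carrier_mat (n + q) k"
  using assms by (intro carrier_append_rows) simp_all

lemma full_col_rank_append_rows:
  assumes A: "A \<in> carrier_mat n k" and C: "C \<in> carrier_mat q k"
    and inj: "\<And>v. v \<in> carrier_vec k \<Longrightarrow> A *\<^sub>v v = 0\<^sub>v n \<Longrightarrow> C *\<^sub>v v = 0\<^sub>v q \<Longrightarrow> v = 0\<^sub>v k"
  shows "full_col_rank (- A @\<^sub>r C)"
proof (rule full_col_rankI[OF uminus_append_rows_carrier[OF A C]])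
  fix v assume v: "v \<in> carrier_vec k" "(- A @\<^sub>r C) *\<^sub>v v = 0\<^sub>v (n + q)"
  show "v = 0\<^sub>v k" by (rule inj[OF v(1) null_append_rows[OF A C v]])
qed

text \<open>Left null vectors are treated as null vectors of the transpose, so that
  \<open>null_append_rows\<close> serves rows and columns alike.\<close>

lemma full_row_rank_append_cols:
  assumes A: "A \<in> carrier_mat k n" and B: "B \<in> carrier_mat k q"
    and inj: "\<And>v. v \<in> carrier_vec k \<Longrightarrow> A\<^sup>T *\<^sub>v v = 0\<^sub>v n \<Longrightarrow> B\<^sup>T *\<^sub>v v = 0\<^sub>v q \<Longrightarrow> v = 0\<^sub>v k"
  shows "full_row_rank (- A @\<^sub>c B)"
proof (rule full_row_rankI[OF append_cols_carrier[OF _ B]])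
  show nA: "- A \<in> carrier_mat k n" using A by simp
  have tA: "A\<^sup>T \<in> carrier_mat n k" and tB: "B\<^sup>T \<in> carrier_mat q k" using A B by simp_all
  fix v assume v: "v \<in> carrier_vec k" "(- A @\<^sub>c B)\<^sup>T *\<^sub>v v = 0\<^sub>v (n + q)"
  have "(- A)\<^sup>T = - A\<^sup>T" using A by (intro eq_matI) simp_all
  then have "(- A\<^sup>T @\<^sub>r B\<^sup>T) *\<^sub>v v = 0\<^sub>v (n + q)"
    using v(2) unfolding transpose_append_cols[OF nA B] by simp
  from inj[OF v(1) null_append_rows[OF tA tB v(1) this]] show "v = 0\<^sub>v k" .
qed

lemma split_carrier_vec:
  assumes "v \<in> carrier_vec (r + s)"
  obtains v1 v2 where "v1 \<in> carrier_vec r" "v2 \<in> carrier_vec s" "v = v1 @\<^sub>v v2"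
  using that[of "vec_first v r" "vec_last v s"] vec_first_last_append[OF assms] by simp

lemma antidiagonal_null:
  fixes M N :: "complex mat"
  assumes M: "M \<in> carrier_mat r r" and N: "N \<in> carrier_mat r r" and v: "v1 \<in> carrier_vec r" "v2 \<in> carrier_vec r"
    and null: "four_block_mat (0\<^sub>m r r) M N (0\<^sub>m r r) *\<^sub>v (v1 @\<^sub>v v2) = 0\<^sub>v (r + r)"
  shows "M *\<^sub>v v2 = 0\<^sub>v r" "N *\<^sub>v v1 = 0\<^sub>v r"
proof -
  have z: "0\<^sub>m r r *\<^sub>v a = 0\<^sub>v r" if "a \<in> carrier_vec r" for a :: "complex vec"
    using that by (intro eq_vecI) (simp_all add: scalar_prod_def)
  have "four_block_mat (0\<^sub>m r r) M N (0\<^sub>m r r) *\<^sub>v (v1 @\<^sub>v v2) =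
      (0\<^sub>m r r *\<^sub>v v1 + M *\<^sub>v v2) @\<^sub>v (N *\<^sub>v v1 + 0\<^sub>m r r *\<^sub>v v2)"
    by (rule four_block_mat_mult_vec[OF zero_carrier_mat M N zero_carrier_mat v])
  then have "(M *\<^sub>v v2) @\<^sub>v (N *\<^sub>v v1) = 0\<^sub>v (r + r)"
    unfolding null z[OF v(1)] z[OF v(2)] left_zero_vec[OF mult_mat_vec_carrier[OF M v(2)]]
      right_zero_vec[OF mult_mat_vec_carrier[OF N v(1)]] by (rule sym)
  from append_vec_0D[OF this mult_mat_vec_carrier[OF M v(2)] mult_mat_vec_carrier[OF N v(1)]]
  show "M *\<^sub>v v2 = 0\<^sub>v r" "N *\<^sub>v v1 = 0\<^sub>v r" .
qed

lemma append_cols_mult_vec: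
  fixes A B :: "complex mat"
  assumes A: "A \<in> carrier_mat m r" and B: "B \<in> carrier_mat m s" and v: "v1 \<in> carrier_vec r" "v2 \<in> carrier_vec s"
  shows "(A @\<^sub>c B) *\<^sub>v (v1 @\<^sub>v v2) = A *\<^sub>v v1 + B *\<^sub>v v2"
proof -
  have "(A @\<^sub>c B) *\<^sub>v (v1 @\<^sub>v v2) = (A *\<^sub>v v1 + B *\<^sub>v v2) @\<^sub>v (0\<^sub>m 0 r *\<^sub>v v1 + 0\<^sub>m 0 s *\<^sub>v v2)"
    unfolding append_cols_def carrier_matD[OF A] carrier_matD[OF B]
    by (rule four_block_mat_mult_vec[OF A B zero_carrier_mat zero_carrier_mat v])
  also have "\<dots> = A *\<^sub>v v1 + B *\<^sub>v v2"
  proof -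
    have "x @\<^sub>v (0\<^sub>m 0 r *\<^sub>v v1 + 0\<^sub>m 0 s *\<^sub>v v2) = x" for x by (intro eq_vecI) simp_all
    then show ?thesis .
  qed
  finally show ?thesis .
qed

text \<open>The two halves of a null vector are coupled through the output equation alone. Whoever
  applies this has to show that one half vanishes by itself, and then uses the output for the
  other.\<close>

lemma antidiagonal_full_col_rank:
  fixes M N :: "complex mat"
  assumes M: "M \<in> carrier_mat r r" and N: "N \<in> carrier_mat r r" and C: "C1 \<in> carrier_mat m r" "C2 \<in> carrier_mat m r"
    and inj: "\<And>v1 v2. v1 \<in> carrier_vec r \<Longrightarrow> v2 \<in> carrier_vec r \<Longrightarrow> M *\<^sub>v v2 = 0\<^sub>v r \<Longrightarrow> N *\<^sub>v v1 = 0\<^sub>v r \<Longrightarrow>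
      C1 *\<^sub>v v1 + C2 *\<^sub>v v2 = 0\<^sub>v m \<Longrightarrow> v1 = 0\<^sub>v r \<and> v2 = 0\<^sub>v r"
  shows "full_col_rank (- four_block_mat (0\<^sub>m r r) M N (0\<^sub>m r r) @\<^sub>r (C1 @\<^sub>c C2))"
proof (rule full_col_rank_append_rows)
  show "four_block_mat (0\<^sub>m r r) M N (0\<^sub>m r r) \<in> carrier_mat (r + r) (r + r)"
    by (rule four_block_carrier_mat) simp_all
  show "C1 @\<^sub>c C2 \<in> carrier_mat m (r + r)" by (rule append_cols_carrier[OF C])
  fix v :: "complex vec"
  assume v: "v \<in> carrier_vec (r + r)" and 1: "four_block_mat (0\<^sub>m r r) M N (0\<^sub>m r r) *\<^sub>v v = 0\<^sub>v (r + r)"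
    and 2: "(C1 @\<^sub>c C2) *\<^sub>v v = 0\<^sub>v m"
  obtain v1 v2 where c: "v1 \<in> carrier_vec r" "v2 \<in> carrier_vec r" and vv: "v = v1 @\<^sub>v v2"
    by (rule split_carrier_vec[OF v])
  have "v1 = 0\<^sub>v r \<and> v2 = 0\<^sub>v r"
    using inj[OF c antidiagonal_null[OF M N c 1[unfolded vv]]] 2
    unfolding vv append_cols_mult_vec[OF C c] by blast
  then show "v = 0\<^sub>v (r + r)" unfolding vv by (intro eq_vecI) auto
qed

lemma antidiagonal_full_row_rank:
  fixes M N :: "complex mat"
  assumes M: "M \<in> carrier_mat r r" and N: "N \<in> carrier_mat r r" and B: "B1 \<in> carrier_mat r m" "B2 \<in> carrier_mat r m"
    and inj: "\<And>v1 v2. v1 \<in> carrier_vec r \<Longrightarrow> v2 \<in> carrier_vec r \<Longrightarrow>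
      N\<^sup>T *\<^sub>v v2 = 0\<^sub>v r \<Longrightarrow> M\<^sup>T *\<^sub>v v1 = 0\<^sub>v r \<Longrightarrow>
      B1\<^sup>T *\<^sub>v v1 + B2\<^sup>T *\<^sub>v v2 = 0\<^sub>v m \<Longrightarrow> v1 = 0\<^sub>v r \<and> v2 = 0\<^sub>v r"
  shows "full_row_rank (- four_block_mat (0\<^sub>m r r) M N (0\<^sub>m r r) @\<^sub>c (B1 @\<^sub>r B2))"
proof (rule full_row_rank_append_cols)
  show "four_block_mat (0\<^sub>m r r) M N (0\<^sub>m r r) \<in> carrier_mat (r + r) (r + r)"
    by (rule four_block_carrier_mat) simp_all
  show "B1 @\<^sub>r B2 \<in> carrier_mat (r + r) m" by (rule carrier_append_rows[OF B])
  have tr: "(four_block_mat (0\<^sub>m r r) M N (0\<^sub>m r r))\<^sup>T =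
      four_block_mat (0\<^sub>m r r) (N\<^sup>T) (M\<^sup>T) (0\<^sub>m r r)"
    using M N by (intro eq_matI) simp_all
  have t: "M\<^sup>T \<in> carrier_mat r r" "N\<^sup>T \<in> carrier_mat r r"
    "B1\<^sup>T \<in> carrier_mat m r" "B2\<^sup>T \<in> carrier_mat m r" using M N B by simp_all
  fix v :: "complex vec"
  assume v: "v \<in> carrier_vec (r + r)"
    and 1: "(four_block_mat (0\<^sub>m r r) M N (0\<^sub>m r r))\<^sup>T *\<^sub>v v = 0\<^sub>v (r + r)"
    and 2: "(B1 @\<^sub>r B2)\<^sup>T *\<^sub>v v = 0\<^sub>v m"
  obtain v1 v2 where c: "v1 \<in> carrier_vec r" "v2 \<in> carrier_vec r" and vv: "v = v1 @\<^sub>v v2"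
    by (rule split_carrier_vec[OF v])
  have "v1 = 0\<^sub>v r \<and> v2 = 0\<^sub>v r"
    using inj[OF c antidiagonal_null[OF t(2,1) c 1[unfolded vv tr]]] 2
    unfolding vv transpose_append_rows[OF B] append_cols_mult_vec[OF t(3,4) c] by blast
  then show "v = 0\<^sub>v (r + r)" unfolding vv by (intro eq_vecI) auto
qed

section \<open>Pencils by their entries, and palindromic pencils\<close>

lemma is_pencilI:
  assumes "\<And>i j. i < dim_row P \<Longrightarrow> j < dim_col P \<Longrightarrow> \<exists>a b. P $$ (i, j) = [:a, b:]"
  shows "is_pencil P"
proof -
  have "P = [:0, 1:] \<cdot>\<^sub>m pmat_const (pmat_coeff P 1) + pmat_const (pmat_coeff P 0)"
  proof (rule eq_matI)
    fix i j assume "i < dim_row ([:0, 1:] \<cdot>\<^sub>m pmat_const (pmat_coeff P 1) + pmat_const (pmat_coeff P 0))"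
      "j < dim_col ([:0, 1:] \<cdot>\<^sub>m pmat_const (pmat_coeff P 1) + pmat_const (pmat_coeff P 0))"
    then have ij: "i < dim_row P" "j < dim_col P" by (simp_all add: pmat_coeff_def)
    from assms[OF this] obtain a b where "P $$ (i, j) = [:a, b:]" by blast
    then show "P $$ (i, j) = ([:0, 1:] \<cdot>\<^sub>m pmat_const (pmat_coeff P 1) + pmat_const (pmat_coeff P 0)) $$ (i, j)"
      using ij by (simp add: pmat_coeff_def)
  qed (simp_all add: pmat_coeff_def)
  moreover have "pmat_coeff P l \<in> carrier_mat (dim_row P) (dim_col P)" for l
    by (simp add: pmat_coeff_def)
  ultimately show ?thesis unfolding is_pencil_def by blast
qed

lemma is_pencil_entry:
  assumes "is_pencil P" "i < dim_row P" "j < dim_col P"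
  shows "\<exists>a b. P $$ (i, j) = [:a, b:]"
proof -
  from assms(1) obtain L1 L0 where L: "L1 \<in> carrier_mat (dim_row P) (dim_col P)"
    "L0 \<in> carrier_mat (dim_row P) (dim_col P)" "P = [:0, 1:] \<cdot>\<^sub>m pmat_const L1 + pmat_const L0"
    unfolding is_pencil_def by blast
  have "([:0, 1:] \<cdot>\<^sub>m pmat_const L1 + pmat_const L0) $$ (i, j) = [:L0 $$ (i, j), L1 $$ (i, j):]"
    using L(1,2) assms(2,3) by simp
  then show ?thesis using L(3) by metis
qed

lemma is_pencil_four_block:
  assumes d: "A \<in> carrier_mat n1 k1" "B \<in> carrier_mat n1 k2" "C \<in> carrier_mat n2 k1" "D \<in> carrier_mat n2 k2"
    and p: "is_pencil A" "is_pencil B" "is_pencil C" "is_pencil D"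
  shows "is_pencil (four_block_mat A B C D)"
proof (rule is_pencilI)
  fix i j assume "i < dim_row (four_block_mat A B C D)" "j < dim_col (four_block_mat A B C D)"
  then have "i < n1 + n2" "j < k1 + k2" using d by simp_all
  then show "\<exists>a b. four_block_mat A B C D $$ (i, j) = [:a, b:]"
    using d is_pencil_entry[OF p(1), of i j] is_pencil_entry[OF p(2), of i "j - k1"]
      is_pencil_entry[OF p(3), of "i - n1" j] is_pencil_entry[OF p(4), of "i - n1" "j - k1"]
    by (cases "i < n1"; cases "j < k1") simp_all
qed

text \<open>The polynomial form of \<open>rev1\<close> after \<open>rmat_star\<close>, restricted to
  pencils: the two coefficient matrices are exchanged and replaced by their adjoints. Palindromicity
  becomes a fixed-point equation that can be checked block by block without rational
  functions.\<close>

definition revstar :: "complex poly mat \<Rightarrow> complex poly mat" where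
  "revstar P = mat (dim_col P) (dim_row P)
     (\<lambda>(i, j). [:cnj (coeff (P $$ (j, i)) 1), cnj (coeff (P $$ (j, i)) 0):])"

lemma revstar_four_block:
  assumes "A \<in> carrier_mat n1 k1" "B \<in> carrier_mat n1 k2" "C \<in> carrier_mat n2 k1" "D \<in> carrier_mat n2 k2"
  shows "revstar (four_block_mat A B C D) = four_block_mat (revstar A) (revstar C) (revstar B) (revstar D)"
  using assms by (intro eq_matI) (simp_all add: revstar_def)

lemma revstar_append_rows:
  assumes "A \<in> carrier_mat n1 k" "B \<in> carrier_mat n2 k"
  shows "revstar (A @\<^sub>r B) = revstar A @\<^sub>c revstar B"
  using assms unfolding append_rows_def append_cols_def by (intro eq_matI) (simp_all add: revstar_def)

lemma revstar_append_cols: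
  assumes "A \<in> carrier_mat n k1" "B \<in> carrier_mat n k2"
  shows "revstar (A @\<^sub>c B) = revstar A @\<^sub>r revstar B"
  using assms unfolding append_rows_def append_cols_def by (intro eq_matI) (simp_all add: revstar_def)

lemma star_palindromicI:
  assumes P: "P \<in> carrier_mat n n" "is_pencil P" and r: "revstar P = P"
  shows "star_palindromic P"
proof -
  have lin: "to_fract [:a, b:] = rat_const a + rat_z * rat_const b" for a b
    by (simp add: rat_const_def rat_z_def flip: to_fract_add to_fract_mult)
  have "rev1 (rmat_star (rmat_poly P)) = rmat_poly (revstar P)"
  proof (rule eq_matI)
    fix i j assume "i < dim_row (rmat_poly (revstar P))" "j < dim_col (rmat_poly (revstar P))"
    then have ij: "i < n" "j < n" using P by (simp_all add: revstar_def)
    obtain a b where ab: "P $$ (j, i) = [:a, b:]" using is_pencil_entry[OF P(2), of j i] P(1) ij by auto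
    have "rev1 (rmat_star (rmat_poly P)) $$ (i, j) = rat_z * rat_recip (rat_cnj (to_fract (P $$ (j, i))))"
      using P(1) ij by (simp add: rev1_def rmat_recip_def rmat_star_def)
    also have "\<dots> = rat_z * rat_const (cnj a) + rat_const (cnj b)"
      unfolding ab lin
      by (simp add: rat_cnj.hom_add rat_cnj.hom_mult rat_recip.hom_add rat_recip.hom_mult field_simps)
    also have "\<dots> = to_fract [:cnj b, cnj a:]" unfolding lin by (rule add.commute)
    also have "\<dots> = rmat_poly (revstar P) $$ (i, j)"
      using P(1) ij ab by (simp add: revstar_def)
    finally show "rev1 (rmat_star (rmat_poly P)) $$ (i, j) = rmat_poly (revstar P) $$ (i, j)" .
  qed (use P(1) in \<open>simp_all add: rev1_def rmat_recip_def rmat_star_def revstar_def\<close>)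
  then show ?thesis using P by (simp add: star_palindromic_def r square_mat.simps)
qed

section \<open>Strong minimality\<close>

lemma smult_mat_mult_vec:
  fixes A :: "complex mat"
  assumes "A \<in> carrier_mat n k" "v \<in> carrier_vec k"
  shows "(a \<cdot>\<^sub>m A) *\<^sub>v v = a \<cdot>\<^sub>v (A *\<^sub>v v)"
  using assms by (intro eq_vecI) (simp_all add: scalar_prod_def sum_distrib_left mult.assoc)

lemma smult_vec_eq_0D:
  fixes v :: "complex vec"
  assumes "a \<cdot>\<^sub>v v = 0\<^sub>v n" "a \<noteq> 0" "v \<in> carrier_vec n"
  shows "v = 0\<^sub>v n"
proof (rule eq_vecI)
  fix i assume i: "i < dim_vec (0\<^sub>v n :: complex vec)"
  then have "a * v $ i = (a \<cdot>\<^sub>v v) $ i" using assms(3) by simp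
  also have "\<dots> = 0" using i unfolding assms(1) by simp
  finally show "v $ i = 0\<^sub>v n $ i" using i assms(2) by simp
qed (use assms(3) in simp)

lemma mult_mat_zero_vec:
  fixes A :: "complex mat"
  shows "A \<in> carrier_mat n k \<Longrightarrow> A *\<^sub>v 0\<^sub>v k = 0\<^sub>v n"
  by (intro eq_vecI) (simp_all add: scalar_prod_def)

lemma conjugate_mult_vec:
  fixes A :: "complex mat"
  assumes "A \<in> carrier_mat n k" "v \<in> carrier_vec k"
  shows "conjugate (A *\<^sub>v v) = map_mat cnj A *\<^sub>v conjugate v"
  using assms by (intro eq_vecI) (simp_all add: scalar_prod_def)

lemma conjugate_vec_eq_0D:
  fixes v :: "complex vec"
  assumes "conjugate v = 0\<^sub>v n"
  shows "v = 0\<^sub>v n"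
  using arg_cong[OF assms, of conjugate] by simp

lemma det_smult_complex: "A \<in> carrier_mat n n \<Longrightarrow> det (a \<cdot>\<^sub>m A) = a ^ n * det (A :: complex mat)"
  using det_smult[of a A] by simp

text \<open>What the rest of the argument uses about the Hankel pencil \<open>z E - F\<close>: the
  Hautus conditions at every finite point, an invertible leading coefficient, and a spectrum in the
  open unit disk. Here \<open>B\<close> and \<open>C\<close> become \<open>Bc\<close> and
  \<open>Cc\<close>, the latter containing the factor \<open>E\<close>.\<close>

locale stable_minimal_system =
  fixes r m :: nat and E F B C :: "complex mat"
  assumes E: "E \<in> carrier_mat r r" and F: "F \<in> carrier_mat r r"
    and B: "B \<in> carrier_mat r m" and C: "C \<in> carrier_mat m r"
    and det_E: "det E \<noteq> 0"
    and obs: "\<And>x v. v \<in> carrier_vec r \<Longrightarrow> (x \<cdot>\<^sub>m E - F) *\<^sub>v v = 0\<^sub>v r \<Longrightarrow> C *\<^sub>v v = 0\<^sub>v m \<Longrightarrow> v = 0\<^sub>v r"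
    and ctrl: "\<And>x v. v \<in> carrier_vec r \<Longrightarrow> (x \<cdot>\<^sub>m E - F)\<^sup>T *\<^sub>v v = 0\<^sub>v r \<Longrightarrow>
       B\<^sup>T *\<^sub>v v = 0\<^sub>v m \<Longrightarrow> v = 0\<^sub>v r"
    and stable: "\<And>x. cmod x \<ge> 1 \<Longrightarrow> det (x \<cdot>\<^sub>m E - F) \<noteq> 0"
begin

lemma pencil_at: "x \<cdot>\<^sub>m E - F \<in> carrier_mat r r"
  by (rule minus_carrier_mat[OF F])

definition dual_at :: "complex \<Rightarrow> complex mat" where
  "dual_at x = mat_adjoint E - x \<cdot>\<^sub>m mat_adjoint F"

lemma dual_at_carrier: "dual_at x \<in> carrier_mat r r"
  unfolding dual_at_def by (rule minus_carrier_mat) (simp add: F)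

lemma dual_at_0: "dual_at 0 = mat_adjoint E"
  unfolding dual_at_def using E F by (intro eq_matI) simp_all

text \<open>Reflection in the unit circle: singular points \<open>x\<close> of the dual pencil
  correspond to singular points \<open>1 / cnj x\<close> of the original one. Stability inside the
  circle thus becomes invertibility of the dual on the closed disk, the point \<open>0\<close> being
  covered by \<open>det_E\<close>.\<close>

lemma dual_at_nonzero:
  assumes "x \<noteq> 0"
  shows "dual_at x = x \<cdot>\<^sub>m mat_adjoint (inverse (cnj x) \<cdot>\<^sub>m E - F)"
  unfolding dual_at_def using E F assms by (intro eq_matI) (simp_all add: algebra_simps)

lemma det_dual_at:
  assumes "cmod x \<le> 1"
  shows "det (dual_at x) \<noteq> 0"
proof (cases "x = 0")
  case True
  then show ?thesis using det_E by (simp add: dual_at_0 det_adjoint[OF E])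
next
  case False
  then have "1 \<le> cmod (inverse (cnj x))"
    using assms by (simp add: norm_inverse one_le_inverse)
  from stable[OF this] False show ?thesis
    unfolding dual_at_nonzero[OF False]
    by (subst det_smult_complex[of _ r]) (simp_all add: pencil_at det_adjoint[OF pencil_at])
qed

text \<open>Conjugation converts null vectors of the dual at \<open>x\<close> into left null vectors
  of the original at the reflected point, so observability of the dual rests on controllability of
  the original. \<open>dual_left_null\<close> is the converse pairing.\<close>

lemma dual_null:
  assumes x: "x \<noteq> 0" and v: "v \<in> carrier_vec r" "dual_at x *\<^sub>v v = 0\<^sub>v r"
  shows "(inverse (cnj x) \<cdot>\<^sub>m E - F)\<^sup>T *\<^sub>v conjugate v = 0\<^sub>v r"
proof -
  let ?M = "inverse (cnj x) \<cdot>\<^sub>m E - F"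
  have c: "mat_adjoint ?M \<in> carrier_mat r r" using pencil_at by simp
  have "x \<cdot>\<^sub>v (mat_adjoint ?M *\<^sub>v v) = 0\<^sub>v r"
    using v(2) unfolding dual_at_nonzero[OF x] smult_mat_mult_vec[OF c v(1)] .
  then have "mat_adjoint ?M *\<^sub>v v = 0\<^sub>v r" by (rule smult_vec_eq_0D[OF _ x mult_mat_vec_carrier[OF c v(1)]])
  then show ?thesis
    using conjugate_mult_vec[OF c v(1)] unfolding map_mat_cnj_adjoint by simp
qed

lemma dual_left_null:
  assumes x: "x \<noteq> 0" and v: "v \<in> carrier_vec r" "(dual_at x)\<^sup>T *\<^sub>v v = 0\<^sub>v r"
  shows "(inverse (cnj x) \<cdot>\<^sub>m E - F) *\<^sub>v conjugate v = 0\<^sub>v r"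
proof -
  let ?M = "inverse (cnj x) \<cdot>\<^sub>m E - F"
  have c: "map_mat cnj ?M \<in> carrier_mat r r" using pencil_at by simp
  have "(x \<cdot>\<^sub>m mat_adjoint ?M)\<^sup>T = x \<cdot>\<^sub>m (mat_adjoint ?M)\<^sup>T"
    by (intro eq_matI) simp_all
  then have "x \<cdot>\<^sub>v (map_mat cnj ?M *\<^sub>v v) = 0\<^sub>v r"
    using v(2) unfolding dual_at_nonzero[OF x] transpose_adjoint smult_mat_mult_vec[OF c v(1), symmetric] by simp
  then have 1: "map_mat cnj ?M *\<^sub>v v = 0\<^sub>v r" by (rule smult_vec_eq_0D[OF _ x mult_mat_vec_carrier[OF c v(1)]])
  have "map_mat cnj (map_mat cnj ?M) = ?M" by (intro eq_matI) simp_all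
  then show ?thesis using conjugate_mult_vec[OF c v(1)] unfolding 1 by simp
qed

lemma conjugate_adjoint_null:
  fixes X :: "complex mat"
  assumes "X \<in> carrier_mat n k" "v \<in> carrier_vec n" "mat_adjoint X *\<^sub>v v = 0\<^sub>v k"
  shows "X\<^sup>T *\<^sub>v conjugate v = 0\<^sub>v k"
proof -
  have "mat_adjoint X \<in> carrier_mat k n" using assms(1) by simp
  from conjugate_mult_vec[OF this assms(2)] show ?thesis
    unfolding assms(3) map_mat_cnj_adjoint by simp
qed

lemma conjugate_transpose_adjoint_null:
  fixes X :: "complex mat"
  assumes "X \<in> carrier_mat n k" "v \<in> carrier_vec k" "(mat_adjoint X)\<^sup>T *\<^sub>v v = 0\<^sub>v n"
  shows "X *\<^sub>v conjugate v = 0\<^sub>v n"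
proof -
  have c: "map_mat cnj X \<in> carrier_mat n k" using assms(1) by simp
  have "map_mat cnj (map_mat cnj X) = X" by (intro eq_matI) simp_all
  then show ?thesis
    using conjugate_mult_vec[OF c assms(2)] assms(3) unfolding transpose_adjoint by simp
qed

text \<open>The output matrix of the dual carries a factor \<open>z\<close> and says nothing at
  \<open>x = 0\<close>, hence the guarded hypothesis. At that point the dual pencil is the adjoint
  of \<open>E\<close> and already injective.\<close>

lemma dual_obs:
  assumes v: "v \<in> carrier_vec r" "dual_at x *\<^sub>v v = 0\<^sub>v r" "x \<noteq> 0 \<Longrightarrow> mat_adjoint B *\<^sub>v v = 0\<^sub>v m"
  shows "v = 0\<^sub>v r"
proof (cases "x = 0")
  case True
  then show ?thesis using det_nonzero_mult_vec_0[OF dual_at_carrier det_dual_at v(1,2)] by simp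
next
  case False
  have "conjugate v = 0\<^sub>v r"
    by (rule ctrl[OF _ dual_null[OF False v(1,2)] conjugate_adjoint_null[OF B v(1) v(3)[OF False]]])
      (use v(1) in simp)
  then show ?thesis by (rule conjugate_vec_eq_0D)
qed

lemma dual_ctrl:
  assumes v: "v \<in> carrier_vec r" "(dual_at x)\<^sup>T *\<^sub>v v = 0\<^sub>v r"
    "(mat_adjoint C)\<^sup>T *\<^sub>v v = 0\<^sub>v m"
  shows "v = 0\<^sub>v r"
proof (cases "x = 0")
  case True
  have t: "(dual_at x)\<^sup>T \<in> carrier_mat r r" using dual_at_carrier by simp
  have "det ((dual_at x)\<^sup>T) \<noteq> 0"
    using det_dual_at[of x] True by (simp add: det_transpose[OF dual_at_carrier])
  then show ?thesis by (rule det_nonzero_mult_vec_0[OF t _ v(1,2)])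
next
  case False
  have "conjugate v = 0\<^sub>v r"
    by (rule obs[OF _ dual_left_null[OF False v(1,2)] conjugate_transpose_adjoint_null[OF C v(1,3)]])
      (use v(1) in simp)
  then show ?thesis by (rule conjugate_vec_eq_0D)
qed

lemma left_null_at:
  assumes "1 \<le> cmod x" "v \<in> carrier_vec r" "(x \<cdot>\<^sub>m E - F)\<^sup>T *\<^sub>v v = 0\<^sub>v r"
  shows "v = 0\<^sub>v r"
proof (rule det_nonzero_mult_vec_0[OF _ _ assms(2,3)])
  show "(x \<cdot>\<^sub>m E - F)\<^sup>T \<in> carrier_mat r r" using pencil_at by simp
  show "det ((x \<cdot>\<^sub>m E - F)\<^sup>T) \<noteq> 0"
    using stable[OF assms(1)] by (simp add: det_transpose[OF pencil_at])
qed

lemma left_null_dual_at: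
  assumes "cmod x \<le> 1" "v \<in> carrier_vec r" "(dual_at x)\<^sup>T *\<^sub>v v = 0\<^sub>v r"
  shows "v = 0\<^sub>v r"
proof (rule det_nonzero_mult_vec_0[OF _ _ assms(2,3)])
  show "(dual_at x)\<^sup>T \<in> carrier_mat r r" using dual_at_carrier by simp
  show "det ((dual_at x)\<^sup>T) \<noteq> 0"
    using det_dual_at[OF assms(1)] by (simp add: det_transpose[OF dual_at_carrier])
qed

lemma full_row_rank_at:
  "full_row_rank (- four_block_mat (0\<^sub>m r r) (x \<cdot>\<^sub>m E - F) (dual_at x) (0\<^sub>m r r) @\<^sub>c
     (B @\<^sub>r ((1 + x) \<cdot>\<^sub>m mat_adjoint C)))"
proof (rule antidiagonal_full_row_rank[OF pencil_at dual_at_carrier B])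
  have C': "mat_adjoint C \<in> carrier_mat r m" using C by simp
  then show "(1 + x) \<cdot>\<^sub>m mat_adjoint C \<in> carrier_mat r m" by simp
  have Bt: "B\<^sup>T \<in> carrier_mat m r" and Ct: "(mat_adjoint C)\<^sup>T \<in> carrier_mat m r"
    using B C by simp_all
  have tC: "((1 + x) \<cdot>\<^sub>m mat_adjoint C)\<^sup>T = (1 + x) \<cdot>\<^sub>m (mat_adjoint C)\<^sup>T"
    by (intro eq_matI) simp_all
  fix v1 v2 :: "complex vec"
  assume v: "v1 \<in> carrier_vec r" "v2 \<in> carrier_vec r"
    and 1: "(dual_at x)\<^sup>T *\<^sub>v v2 = 0\<^sub>v r" and 2: "(x \<cdot>\<^sub>m E - F)\<^sup>T *\<^sub>v v1 = 0\<^sub>v r"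
    and 3: "B\<^sup>T *\<^sub>v v1 + ((1 + x) \<cdot>\<^sub>m mat_adjoint C)\<^sup>T *\<^sub>v v2 = 0\<^sub>v m"
  have 3: "B\<^sup>T *\<^sub>v v1 + (1 + x) \<cdot>\<^sub>v ((mat_adjoint C)\<^sup>T *\<^sub>v v2) = 0\<^sub>v m"
    using 3 unfolding tC smult_mat_mult_vec[OF Ct v(2)] .
  show "v1 = 0\<^sub>v r \<and> v2 = 0\<^sub>v r"
  \<comment> \<open>The circle, and with it \<open>-1\<close>, goes to the case that ends with the
    unweighted matrix \<open>B\<close>. The weight \<open>1 + x\<close> is cancelled only for
    \<open>cmod x > 1\<close>.\<close>
  proof (cases "cmod x \<le> 1")
    case True
    have v2: "v2 = 0\<^sub>v r" by (rule left_null_dual_at[OF True v(2) 1])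
    have "(1 + x) \<cdot>\<^sub>v 0\<^sub>v m = (0\<^sub>v m :: complex vec)" by (intro eq_vecI) simp_all
    then have "B\<^sup>T *\<^sub>v v1 = 0\<^sub>v m"
      using 3 right_zero_vec[OF mult_mat_vec_carrier[OF Bt v(1)]] unfolding v2 mult_mat_zero_vec[OF Ct] by simp
    then show ?thesis using ctrl[OF v(1) 2] v2 by simp
  next
    case False
    have v1: "v1 = 0\<^sub>v r" by (rule left_null_at[OF _ v(1) 2]) (use False in simp)
    have c: "(mat_adjoint C)\<^sup>T *\<^sub>v v2 \<in> carrier_vec m" by (rule mult_mat_vec_carrier[OF Ct v(2)])
    have nz: "1 + x \<noteq> 0" using False by (metis add_eq_0_iff norm_minus_cancel norm_one order_refl)
    have "(1 + x) \<cdot>\<^sub>v ((mat_adjoint C)\<^sup>T *\<^sub>v v2) = 0\<^sub>v m"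
      using 3 left_zero_vec[of "(1 + x) \<cdot>\<^sub>v ((mat_adjoint C)\<^sup>T *\<^sub>v v2)" m] c
      unfolding v1 mult_mat_zero_vec[OF Bt] by simp
    then have "(mat_adjoint C)\<^sup>T *\<^sub>v v2 = 0\<^sub>v m" by (rule smult_vec_eq_0D[OF _ nz c])
    then show ?thesis using dual_ctrl[OF v(2) 1] v1 by simp
  qed
qed

lemma full_col_rank_at:
  "full_col_rank (- four_block_mat (0\<^sub>m r r) (x \<cdot>\<^sub>m E - F) (dual_at x) (0\<^sub>m r r) @\<^sub>r
     ((x \<cdot>\<^sub>m mat_adjoint B) @\<^sub>c ((1 + x) \<cdot>\<^sub>m C)))"
proof (rule antidiagonal_full_col_rank[OF pencil_at dual_at_carrier])
  have B': "mat_adjoint B \<in> carrier_mat m r" using B by simp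
  then show "x \<cdot>\<^sub>m mat_adjoint B \<in> carrier_mat m r" "(1 + x) \<cdot>\<^sub>m C \<in> carrier_mat m r" using C by simp_all
  fix v1 v2 :: "complex vec"
  assume v: "v1 \<in> carrier_vec r" "v2 \<in> carrier_vec r"
    and 1: "(x \<cdot>\<^sub>m E - F) *\<^sub>v v2 = 0\<^sub>v r" and 2: "dual_at x *\<^sub>v v1 = 0\<^sub>v r"
    and 3: "(x \<cdot>\<^sub>m mat_adjoint B) *\<^sub>v v1 + ((1 + x) \<cdot>\<^sub>m C) *\<^sub>v v2 = 0\<^sub>v m"
  have 3: "x \<cdot>\<^sub>v (mat_adjoint B *\<^sub>v v1) + (1 + x) \<cdot>\<^sub>v (C *\<^sub>v v2) = 0\<^sub>v m"
    using 3 unfolding smult_mat_mult_vec[OF B' v(1)] smult_mat_mult_vec[OF C v(2)] .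
  have c: "mat_adjoint B *\<^sub>v v1 \<in> carrier_vec m" "C *\<^sub>v v2 \<in> carrier_vec m"
    by (rule mult_mat_vec_carrier[OF B' v(1)], rule mult_mat_vec_carrier[OF C v(2)])
  have z: "a \<cdot>\<^sub>v 0\<^sub>v m = (0\<^sub>v m :: complex vec)" for a by (intro eq_vecI) simp_all
  show "v1 = 0\<^sub>v r \<and> v2 = 0\<^sub>v r"
  \<comment> \<open>The weights are now \<open>x\<close> on the dual half and \<open>1 + x\<close>
    on the other. On and outside the circle only \<open>x\<close> must be nonzero, strictly inside
    only \<open>1 + x\<close>; so neither \<open>0\<close> nor \<open>-1\<close> does harm.\<close>
  proof (cases "cmod x \<ge> 1")
    case True
    have v2: "v2 = 0\<^sub>v r" by (rule det_nonzero_mult_vec_0[OF pencil_at stable[OF True] v(2) 1])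
    have nz: "x \<noteq> 0" using True by auto
    have "x \<cdot>\<^sub>v (mat_adjoint B *\<^sub>v v1) = 0\<^sub>v m"
      using 3 right_zero_vec[of "x \<cdot>\<^sub>v (mat_adjoint B *\<^sub>v v1)" m] c
      unfolding v2 mult_mat_zero_vec[OF C] z by simp
    then have "mat_adjoint B *\<^sub>v v1 = 0\<^sub>v m" by (rule smult_vec_eq_0D[OF _ nz c(1)])
    then show ?thesis using dual_obs[OF v(1) 2] v2 by simp
  next
    case False
    then have v1: "v1 = 0\<^sub>v r"
      using det_nonzero_mult_vec_0[OF dual_at_carrier det_dual_at v(1) 2] by simp
    have nz: "1 + x \<noteq> 0" using False by (metis add_eq_0_iff norm_minus_cancel norm_one order_refl)
    have "(1 + x) \<cdot>\<^sub>v (C *\<^sub>v v2) = 0\<^sub>v m"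
      using 3 left_zero_vec[of "(1 + x) \<cdot>\<^sub>v (C *\<^sub>v v2)" m] c
      unfolding v1 mult_mat_zero_vec[OF B'] z by simp
    then have "C *\<^sub>v v2 = 0\<^sub>v m" by (rule smult_vec_eq_0D[OF _ nz c(2)])
    then show ?thesis using obs[OF v(2) 1] v1 by simp
  qed
qed

text \<open>The Hautus test at \<open>0\<close>. It enters the analysis at infinity because the
  leading coefficient of the dual pencil is minus the adjoint of \<open>F\<close>.\<close>

lemma uminus_F_null:
  assumes "v \<in> carrier_vec r" "(- F) *\<^sub>v v = 0\<^sub>v r" "C *\<^sub>v v = 0\<^sub>v m"
  shows "v = 0\<^sub>v r"
proof -
  have "0 \<cdot>\<^sub>m E - F = - F" using E F by (intro eq_matI) simp_all
  then show ?thesis using obs[OF assms(1) _ assms(3), of 0] assms(2) by simp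
qed

lemma uminus_F_left_null:
  assumes "v \<in> carrier_vec r" "(- F)\<^sup>T *\<^sub>v v = 0\<^sub>v r" "B\<^sup>T *\<^sub>v v = 0\<^sub>v m"
  shows "v = 0\<^sub>v r"
proof -
  have "0 \<cdot>\<^sub>m E - F = - F" using E F by (intro eq_matI) simp_all
  then show ?thesis using ctrl[OF assms(1) _ assms(3), of 0] assms(2) by simp
qed

text \<open>Invertibility of \<open>E\<close> removes one half of a left null vector. The other is
  governed by \<open>F\<close> and \<open>C\<close>; the leading coefficient of \<open>1 + z\<close>
  keeps the adjoint of \<open>C\<close> in the input at infinity, where the constant block
  \<open>B\<close> has disappeared.\<close>

lemma full_row_rank_at_infinity:
  "full_row_rank (- four_block_mat (0\<^sub>m r r) E (mat_adjoint (- F)) (0\<^sub>m r r) @\<^sub>c (0\<^sub>m r m @\<^sub>r mat_adjoint C))"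
proof (rule antidiagonal_full_row_rank[OF E _ zero_carrier_mat])
  have nF: "- F \<in> carrier_mat r r" using F by simp
  then show "mat_adjoint (- F) \<in> carrier_mat r r" "mat_adjoint C \<in> carrier_mat r m" using C by simp_all
  have Et: "E\<^sup>T \<in> carrier_mat r r" "det (E\<^sup>T) \<noteq> 0"
    using E det_E by (simp_all add: det_transpose[OF E])
  have Ct: "(mat_adjoint C)\<^sup>T \<in> carrier_mat m r" using C by simp
  fix v1 v2 :: "complex vec"
  assume v: "v1 \<in> carrier_vec r" "v2 \<in> carrier_vec r"
    and 1: "(mat_adjoint (- F))\<^sup>T *\<^sub>v v2 = 0\<^sub>v r" and 2: "E\<^sup>T *\<^sub>v v1 = 0\<^sub>v r"
    and 3: "(0\<^sub>m r m)\<^sup>T *\<^sub>v v1 + (mat_adjoint C)\<^sup>T *\<^sub>v v2 = 0\<^sub>v m"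
  have v1: "v1 = 0\<^sub>v r" by (rule det_nonzero_mult_vec_0[OF Et v(1) 2])
  have z: "(0\<^sub>m r m)\<^sup>T \<in> carrier_mat m r" by simp
  have 4: "(mat_adjoint C)\<^sup>T *\<^sub>v v2 = 0\<^sub>v m"
    using 3 left_zero_vec[OF mult_mat_vec_carrier[OF Ct v(2)]] unfolding v1 mult_mat_zero_vec[OF z] by simp
  have "conjugate v2 = 0\<^sub>v r"
    by (rule uminus_F_null[OF _ conjugate_transpose_adjoint_null[OF nF v(2) 1]
          conjugate_transpose_adjoint_null[OF C v(2) 4]]) (use v in simp)
  then have "v2 = 0\<^sub>v r" by (rule conjugate_vec_eq_0D)
  with v1 show "v1 = 0\<^sub>v r \<and> v2 = 0\<^sub>v r" by (rule conjI)
qed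

lemma full_col_rank_at_infinity:
  "full_col_rank (- four_block_mat (0\<^sub>m r r) E (mat_adjoint (- F)) (0\<^sub>m r r) @\<^sub>r (mat_adjoint B @\<^sub>c C))"
proof (rule antidiagonal_full_col_rank[OF E _ _ C])
  have nF: "- F \<in> carrier_mat r r" using F by simp
  then show "mat_adjoint (- F) \<in> carrier_mat r r" "mat_adjoint B \<in> carrier_mat m r" using B by simp_all
  then have B': "mat_adjoint B \<in> carrier_mat m r" by simp
  fix v1 v2 :: "complex vec"
  assume v: "v1 \<in> carrier_vec r" "v2 \<in> carrier_vec r"
    and 1: "E *\<^sub>v v2 = 0\<^sub>v r" and 2: "mat_adjoint (- F) *\<^sub>v v1 = 0\<^sub>v r"
    and 3: "mat_adjoint B *\<^sub>v v1 + C *\<^sub>v v2 = 0\<^sub>v m"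
  have v2: "v2 = 0\<^sub>v r" by (rule det_nonzero_mult_vec_0[OF E det_E v(2) 1])
  have 4: "mat_adjoint B *\<^sub>v v1 = 0\<^sub>v m"
    using 3 right_zero_vec[OF mult_mat_vec_carrier[OF B' v(1)]] unfolding v2 mult_mat_zero_vec[OF C] by simp
  have "conjugate v1 = 0\<^sub>v r"
    by (rule uminus_F_left_null[OF _ conjugate_adjoint_null[OF nF v(1) 2] conjugate_adjoint_null[OF B v(1) 4]])
      (use v in simp)
  then have "v1 = 0\<^sub>v r" by (rule conjugate_vec_eq_0D)
  then show "v1 = 0\<^sub>v r \<and> v2 = 0\<^sub>v r" using v2 by (rule conjI)
qed

end

lemma pmat_eval_smult_const: "pmat_eval (p \<cdot>\<^sub>m pmat_const X) x = poly p x \<cdot>\<^sub>m X"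
  by (intro eq_matI) simp_all

lemma pmat_eval_const: "pmat_eval (pmat_const X) x = X"
  by (intro eq_matI) simp_all

lemma rmat_poly_smult_const: "rmat_poly (p \<cdot>\<^sub>m pmat_const X) = to_fract p \<cdot>\<^sub>m rmat_const X"
  unfolding rmat_poly_smult rmat_poly_const ..

lemma is_pencil_const: "is_pencil (pmat_const X)"
  by (rule is_pencilI) simp

lemma is_pencil_smult_const: "is_pencil ([:a, b:] \<cdot>\<^sub>m pmat_const X)"
  by (rule is_pencilI) simp

lemma is_pencil_zero: "is_pencil (0\<^sub>m n k)"
  by (rule is_pencilI) simp

lemma is_pencil_lin_pencil:
  assumes "E \<in> carrier_mat n k" "F \<in> carrier_mat n k"
  shows "is_pencil (lin_pencil E F)"
  by (rule is_pencilI) (use assms in \<open>simp add: lin_pencil_def\<close>)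

lemma is_pencil_dual_pencil:
  assumes "E \<in> carrier_mat n k" "F \<in> carrier_mat n k"
  shows "is_pencil (dual_pencil E F)"
  by (rule is_pencilI) (use assms in \<open>simp add: dual_pencil_def\<close>)

lemma is_pencil_append_rows:
  assumes "A \<in> carrier_mat n1 k" "B \<in> carrier_mat n2 k" "is_pencil A" "is_pencil B"
  shows "is_pencil (A @\<^sub>r B)"
  unfolding append_rows_def carrier_matD[OF assms(1)] carrier_matD[OF assms(2)]
  by (rule is_pencil_four_block[OF assms(1) zero_carrier_mat assms(2) zero_carrier_mat assms(3)
        is_pencil_zero assms(4) is_pencil_zero])

lemma is_pencil_append_cols:
  assumes "A \<in> carrier_mat n k1" "B \<in> carrier_mat n k2" "is_pencil A" "is_pencil B"
  shows "is_pencil (A @\<^sub>c B)"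
  unfolding append_cols_def carrier_matD[OF assms(1)] carrier_matD[OF assms(2)]
  by (rule is_pencil_four_block[OF assms(1,2) zero_carrier_mat zero_carrier_mat assms(3,4)
        is_pencil_zero is_pencil_zero])

lemma det_nonzero_if_eval:
  assumes "det (pmat_eval P x) \<noteq> 0"
  shows "det P \<noteq> 0"
  using assms by (auto simp: det_pmat_eval)

section \<open>The combined system: regularity, transfer function and palindromicity\<close>

context stable_minimal_system
begin

text \<open>This is \<open>A\<close> in the convention where the system matrix has
  \<open>- A\<close> in its corner, so the blocks appear here with the signs of the two separate
  realizations.\<close>

definition sysA :: "complex poly mat" where
  "sysA = four_block_mat (0\<^sub>m r r) (lin_pencil E F) (dual_pencil E F) (0\<^sub>m r r)"

definition sysB :: "complex poly mat" where
  "sysB = pmat_const B @\<^sub>r ([:1, 1:] \<cdot>\<^sub>m pmat_const (mat_adjoint C))"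

definition sysC :: "complex poly mat" where
  "sysC = ([:0, 1:] \<cdot>\<^sub>m pmat_const (mat_adjoint B)) @\<^sub>c ([:1, 1:] \<cdot>\<^sub>m pmat_const C)"

lemma part_carriers:
  "lin_pencil E F \<in> carrier_mat r r" "dual_pencil E F \<in> carrier_mat r r"
  "pmat_const B \<in> carrier_mat r m" "[:1, 1:] \<cdot>\<^sub>m pmat_const (mat_adjoint C) \<in> carrier_mat r m"
  "[:0, 1:] \<cdot>\<^sub>m pmat_const (mat_adjoint B) \<in> carrier_mat m r" "[:1, 1:] \<cdot>\<^sub>m pmat_const C \<in> carrier_mat m r"
  using E F B C by (simp_all add: dual_pencil_carrier)

lemma sys_carriers:
  "sysA \<in> carrier_mat (r + r) (r + r)" "sysB \<in> carrier_mat (r + r) m" "sysC \<in> carrier_mat m (r + r)"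
  unfolding sysA_def sysB_def sysC_def
  by (rule four_block_carrier_mat, rule zero_carrier_mat, rule zero_carrier_mat,
      rule carrier_append_rows[OF part_carriers(3,4)], rule append_cols_carrier[OF part_carriers(5,6)])

lemma sys_eval:
  "pmat_eval sysA x = four_block_mat (0\<^sub>m r r) (x \<cdot>\<^sub>m E - F) (dual_at x) (0\<^sub>m r r)"
  "pmat_eval sysB x = B @\<^sub>r ((1 + x) \<cdot>\<^sub>m mat_adjoint C)"
  "pmat_eval sysC x = (x \<cdot>\<^sub>m mat_adjoint B) @\<^sub>c ((1 + x) \<cdot>\<^sub>m C)"
proof -
  have z: "pmat_eval (0\<^sub>m r r) x = 0\<^sub>m r r" by (intro eq_matI) simp_all
  show "pmat_eval sysA x = four_block_mat (0\<^sub>m r r) (x \<cdot>\<^sub>m E - F) (dual_at x) (0\<^sub>m r r)"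
    using map_four_block_mat[OF zero_carrier_mat part_carriers(1,2) zero_carrier_mat, of "\<lambda>p. poly p x"]
    unfolding pmat_eval_def[symmetric] sysA_def z pmat_eval_lin_pencil[OF E F] pmat_eval_dual_pencil[OF E F] dual_at_def .
  show "pmat_eval sysB x = B @\<^sub>r ((1 + x) \<cdot>\<^sub>m mat_adjoint C)"
    using map_append_rows[OF part_carriers(3,4), of "\<lambda>p. poly p x"]
    unfolding pmat_eval_def[symmetric] sysB_def pmat_eval_const pmat_eval_smult_const by simp
  show "pmat_eval sysC x = (x \<cdot>\<^sub>m mat_adjoint B) @\<^sub>c ((1 + x) \<cdot>\<^sub>m C)"
    using map_append_cols[OF part_carriers(5,6), of "\<lambda>p. poly p x"]
    unfolding pmat_eval_def[symmetric] sysC_def pmat_eval_smult_const by simp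
qed

lemma sys_coeff:
  "pmat_coeff sysA 1 = four_block_mat (0\<^sub>m r r) E (mat_adjoint (- F)) (0\<^sub>m r r)"
  "pmat_coeff sysB 1 = 0\<^sub>m r m @\<^sub>r mat_adjoint C"
  "pmat_coeff sysC 1 = mat_adjoint B @\<^sub>c C"
proof -
  have 1: "pmat_coeff (0\<^sub>m r r) 1 = 0\<^sub>m r r" "pmat_coeff (lin_pencil E F) 1 = E"
    "pmat_coeff (dual_pencil E F) 1 = mat_adjoint (- F)"
    using E F by (intro eq_matI; simp add: pmat_coeff_def lin_pencil_def dual_pencil_def)+
  have 2: "pmat_coeff (pmat_const B) 1 = 0\<^sub>m r m" "pmat_coeff ([:1, 1:] \<cdot>\<^sub>m pmat_const (mat_adjoint C)) 1 = mat_adjoint C"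
    "pmat_coeff ([:0, 1:] \<cdot>\<^sub>m pmat_const (mat_adjoint B)) 1 = mat_adjoint B"
    "pmat_coeff ([:1, 1:] \<cdot>\<^sub>m pmat_const C) 1 = C"
    using B C by (intro eq_matI; simp add: pmat_coeff_def)+
  show "pmat_coeff sysA 1 = four_block_mat (0\<^sub>m r r) E (mat_adjoint (- F)) (0\<^sub>m r r)"
    using map_four_block_mat[OF zero_carrier_mat part_carriers(1,2) zero_carrier_mat, of "\<lambda>p. coeff p 1"]
    unfolding pmat_coeff_def[symmetric] sysA_def 1 .
  show "pmat_coeff sysB 1 = 0\<^sub>m r m @\<^sub>r mat_adjoint C"
    using map_append_rows[OF part_carriers(3,4), of "\<lambda>p. coeff p 1"]
    unfolding pmat_coeff_def[symmetric] sysB_def 2 .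
  show "pmat_coeff sysC 1 = mat_adjoint B @\<^sub>c C"
    using map_append_cols[OF part_carriers(5,6), of "\<lambda>p. coeff p 1"]
    unfolding pmat_coeff_def[symmetric] sysC_def 2 .
qed

lemma det_dual_pencil: "det (dual_pencil E F) \<noteq> 0"
  by (rule det_nonzero_if_eval[of _ 1])
    (use det_dual_at[of 1] in \<open>simp add: pmat_eval_dual_pencil[OF E F] dual_at_def\<close>)

lemma strongly_minimal: "strongly_minimal_system sysA sysB sysC"
  unfolding strongly_minimal_system_def minimal_system_def minimal_system_at_infinity_def sys_eval sys_coeff
  by (intro allI conjI full_row_rank_at full_col_rank_at full_row_rank_at_infinity full_col_rank_at_infinity)

text \<open>On the unit circle the pencil and its dual are both invertible, so evaluation at
  \<open>1\<close> shows that the determinant is not the zero polynomial.\<close>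

lemma det_sysA: "det sysA \<noteq> 0"
proof (rule det_nonzero_if_eval)
  show "det (pmat_eval sysA 1) \<noteq> 0"
  proof
    assume d: "det (pmat_eval sysA 1) = 0"
    have c: "pmat_eval sysA 1 \<in> carrier_mat (r + r) (r + r)" using sys_carriers(1) by simp
    from d obtain v where v: "v \<in> carrier_vec (r + r)" "v \<noteq> 0\<^sub>v (r + r)" "pmat_eval sysA 1 *\<^sub>v v = 0\<^sub>v (r + r)"
      unfolding det_0_iff_vec_prod_zero_field[OF c] by (elim exE conjE)
    obtain v1 v2 where cv: "v1 \<in> carrier_vec r" "v2 \<in> carrier_vec r" and vv: "v = v1 @\<^sub>v v2"
      by (rule split_carrier_vec[OF v(1)])
    note n = antidiagonal_null[OF pencil_at dual_at_carrier cv v(3)[unfolded sys_eval vv]]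
    have v2: "v2 = 0\<^sub>v r" by (rule det_nonzero_mult_vec_0[OF pencil_at stable cv(2) n(1)]) simp
    have v1: "v1 = 0\<^sub>v r" by (rule det_nonzero_mult_vec_0[OF dual_at_carrier det_dual_at cv(1) n(2)]) simp
    have "v = 0\<^sub>v (r + r)" unfolding vv v1 v2 by (intro eq_vecI) auto
    then show False using v(2) by simp
  qed
qed

lemma linear_system:
  assumes R0: "R0 \<in> carrier_mat m m"
  shows "linear_system_matrix (four_block_mat (- sysA) sysB sysC ([:1, 1:] \<cdot>\<^sub>m pmat_const R0))
    sysA sysB sysC ([:1, 1:] \<cdot>\<^sub>m pmat_const R0)"
proof -
  have "is_pencil sysA"
    unfolding sysA_def
    by (rule is_pencil_four_block[OF zero_carrier_mat part_carriers(1,2) zero_carrier_mat is_pencil_zero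
          is_pencil_lin_pencil[OF E F] is_pencil_dual_pencil[OF E F] is_pencil_zero])
  moreover have "is_pencil sysB"
    unfolding sysB_def by (rule is_pencil_append_rows[OF part_carriers(3,4) is_pencil_const is_pencil_smult_const])
  moreover have "is_pencil sysC"
    unfolding sysC_def by (rule is_pencil_append_cols[OF part_carriers(5,6) is_pencil_smult_const is_pencil_smult_const])
  ultimately show ?thesis
    unfolding linear_system_matrix_def square_mat.simps carrier_matD[OF sys_carriers(1)]
      carrier_matD[OF sys_carriers(2)] carrier_matD[OF sys_carriers(3)]
    using det_sysA R0 is_pencil_smult_const by simp
qed

lemma in_realization:
  assumes Y: "Y \<in> carrier_mat r m" "rmat_poly (lin_pencil E F) * Y = rmat_const B"
    and G: "G = rmat_const C * Y"
  shows "minimal_gss_realization (lin_pencil E F) (pmat_const B) (pmat_const C) G"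
proof -
  have L: "lin_pencil E F \<in> carrier_mat r r" by (rule part_carriers)
  have d: "det (lin_pencil E F) \<noteq> 0"
    by (rule det_nonzero_if_eval[of _ 1]) (use stable[of 1] in \<open>simp add: pmat_eval_lin_pencil[OF E F]\<close>)
  have rd: "det (rmat_poly (lin_pencil E F)) \<noteq> 0" using d by (simp add: det_rmat_poly)
  have rL: "rmat_poly (lin_pencil E F) \<in> carrier_mat r r" using L by simp
  have c: "rmat_const C \<in> carrier_mat m r" "rmat_const B \<in> carrier_mat r m" using C B by simp_all
  have row: "full_row_rank (- (x \<cdot>\<^sub>m E - F) @\<^sub>c B)" for x
    by (rule full_row_rank_append_cols[OF pencil_at B]) (rule ctrl; assumption)
  have col: "full_col_rank (- (x \<cdot>\<^sub>m E - F) @\<^sub>r C)" for x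
    by (rule full_col_rank_append_rows[OF pencil_at C]) (rule obs; assumption)
  have "minimal_system (lin_pencil E F) (pmat_const B) (pmat_const C)"
    unfolding minimal_system_def pmat_eval_lin_pencil[OF E F] pmat_eval_const
    by (intro allI conjI row col)
  moreover have "linear_system_matrix (four_block_mat (- lin_pencil E F) (pmat_const B) (pmat_const C) (0\<^sub>m m m))
      (lin_pencil E F) (pmat_const B) (pmat_const C) (0\<^sub>m m m)"
    unfolding linear_system_matrix_def square_mat.simps carrier_matD[OF L]
    using d E F B C by (simp add: is_pencil_const is_pencil_zero is_pencil_lin_pencil[OF E F])
  moreover have "G = rmat_poly (pmat_const C) * rmat_inverse (rmat_poly (lin_pencil E F)) * rmat_poly (pmat_const B)"
    unfolding rmat_poly_const assoc_mult_mat[OF c(1) rmat_inverse(1)[OF rL rd] c(2)]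
      rmat_inverse_mult[OF rL rd Y] by (rule G)
  ultimately show ?thesis
    using B C by (simp add: minimal_gss_realization_def)
qed

lemma out_realization:
  assumes Y: "Y \<in> carrier_mat r m" "rmat_poly (lin_pencil E F) * Y = rmat_const B"
    and G: "G = rmat_recip (rmat_star (rmat_const C * Y))"
  shows "minimal_gss_realization (dual_pencil E F) (pmat_const (mat_adjoint C))
    ([:0, 1:] \<cdot>\<^sub>m pmat_const (mat_adjoint B)) G"
proof -
  have L: "dual_pencil E F \<in> carrier_mat r r" by (rule part_carriers)
  have B': "mat_adjoint B \<in> carrier_mat m r" and C': "mat_adjoint C \<in> carrier_mat r m" using B C by simp_all
  note d = det_dual_pencil
  have row: "full_row_rank (- dual_at x @\<^sub>c mat_adjoint C)" for x
    by (rule full_row_rank_append_cols[OF dual_at_carrier C']) (rule dual_ctrl; assumption)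
  have col: "full_col_rank (- dual_at x @\<^sub>r (x \<cdot>\<^sub>m mat_adjoint B))" for x
  proof (rule full_col_rank_append_rows[OF dual_at_carrier])
    show "x \<cdot>\<^sub>m mat_adjoint B \<in> carrier_mat m r" using B' by simp
    fix v assume v: "v \<in> carrier_vec r" "dual_at x *\<^sub>v v = 0\<^sub>v r" "(x \<cdot>\<^sub>m mat_adjoint B) *\<^sub>v v = 0\<^sub>v m"
    show "v = 0\<^sub>v r"
    proof (rule dual_obs[OF v(1,2)])
      assume "x \<noteq> 0"
      then show "mat_adjoint B *\<^sub>v v = 0\<^sub>v m"
        using smult_vec_eq_0D[OF _ _ mult_mat_vec_carrier[OF B' v(1)]] v(3)
        unfolding smult_mat_mult_vec[OF B' v(1)] by simp
    qed
  qed
  have "minimal_system (dual_pencil E F) (pmat_const (mat_adjoint C)) ([:0, 1:] \<cdot>\<^sub>m pmat_const (mat_adjoint B))"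
    unfolding minimal_system_def pmat_eval_dual_pencil[OF E F] pmat_eval_const pmat_eval_smult_const dual_at_def[symmetric]
    using row col by simp
  moreover have "linear_system_matrix (four_block_mat (- dual_pencil E F) (pmat_const (mat_adjoint C))
      ([:0, 1:] \<cdot>\<^sub>m pmat_const (mat_adjoint B)) (0\<^sub>m m m))
      (dual_pencil E F) (pmat_const (mat_adjoint C)) ([:0, 1:] \<cdot>\<^sub>m pmat_const (mat_adjoint B)) (0\<^sub>m m m)"
    unfolding linear_system_matrix_def square_mat.simps carrier_matD[OF L]
    using d B' C' by (simp add: is_pencil_const is_pencil_smult_const is_pencil_zero is_pencil_dual_pencil[OF E F])
  moreover have "G = rmat_poly ([:0, 1:] \<cdot>\<^sub>m pmat_const (mat_adjoint B)) * rmat_inverse (rmat_poly (dual_pencil E F)) *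
      rmat_poly (pmat_const (mat_adjoint C))"
    unfolding rmat_poly_const rmat_poly_smult_const G dual_realization[OF E F B C Y d] rat_z_def ..
  ultimately show ?thesis
    using B' C' by (simp add: minimal_gss_realization_def)
qed

text \<open>Each half receives the weight \<open>1 + z\<close> exactly once, the inner part at its
  output and the outer part at its input. Both contributions, like the constant term, therefore
  carry the same scalar.\<close>

lemma transfer:
  assumes Y: "Y \<in> carrier_mat r m" "rmat_poly (lin_pencil E F) * Y = rmat_const B"
    and R0: "R0 \<in> carrier_mat m m"
  shows "transfer_function sysA sysB sysC ([:1, 1:] \<cdot>\<^sub>m pmat_const R0) =
    (1 + rat_z) \<cdot>\<^sub>m (rmat_const C * Y + rmat_recip (rmat_star (rmat_const C * Y)) + rmat_const R0)"
proof -
  define P where "P = rmat_poly (lin_pencil E F)"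
  define Q where "Q = rmat_poly (dual_pencil E F)"
  define B' where "B' = rat_z \<cdot>\<^sub>m rmat_const (mat_adjoint B)"
  define C' where "C' = rmat_const (mat_adjoint C)"
  define w where "w = 1 + rat_z"
  have P: "P \<in> carrier_mat r r" and Q: "Q \<in> carrier_mat r r" using part_carriers by (simp_all add: P_def Q_def)
  have Bc: "rmat_const B \<in> carrier_mat r m" and Cc: "rmat_const C \<in> carrier_mat m r"
    and B': "B' \<in> carrier_mat m r" and C': "C' \<in> carrier_mat r m"
    using B C by (simp_all add: B'_def C'_def)
  note d = det_dual_pencil
  have dQ: "det Q \<noteq> 0" using d by (simp add: Q_def det_rmat_poly)
  note QI = rmat_inverse[OF Q dQ]
  have w: "to_fract [:1, 1:] = w"
  proof -
    have "[:1, 1:] = 1 + [:0, 1 :: complex:]" by (simp add: one_pCons)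
    then show ?thesis by (simp add: w_def rat_z_def del: one_pCons)
  qed
  have rA: "rmat_poly sysA = four_block_mat (0\<^sub>m r r) P Q (0\<^sub>m r r)"
  proof -
    have "rmat_poly (0\<^sub>m r r) = 0\<^sub>m r r" by (intro eq_matI) simp_all
    then show ?thesis
      using map_four_block_mat[OF zero_carrier_mat part_carriers(1,2) zero_carrier_mat, of to_fract]
      unfolding rmat_poly_def[symmetric] sysA_def P_def Q_def by simp
  qed
  have rB: "rmat_poly sysB = rmat_const B @\<^sub>r (w \<cdot>\<^sub>m C')"
    using map_append_rows[OF part_carriers(3,4), of to_fract]
    unfolding rmat_poly_def[symmetric] sysB_def rmat_poly_smult_const rmat_poly_const w C'_def .
  have rC: "rmat_poly sysC = B' @\<^sub>c (w \<cdot>\<^sub>m rmat_const C)"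
    using map_append_cols[OF part_carriers(5,6), of to_fract]
    unfolding rmat_poly_def[symmetric] sysC_def rmat_poly_smult_const w B'_def rat_z_def[symmetric] .
  have cA: "rmat_poly sysA \<in> carrier_mat (r + r) (r + r)" and cB: "rmat_poly sysB \<in> carrier_mat (r + r) m"
    and cC: "rmat_poly sysC \<in> carrier_mat m (r + r)"
    using sys_carriers by simp_all
  have dA: "det (rmat_poly sysA) \<noteq> 0" using det_sysA by (simp add: det_rmat_poly)
  \<comment> \<open>The upper component of the solution of \<open>A X = B\<close>. Because the
    blocks cross, it solves the dual equation with the weighted input, while \<open>Y\<close> below
    it solves the original one.\<close>
  define X1 where "X1 = w \<cdot>\<^sub>m (rmat_inverse Q * C')"
  have QC: "rmat_inverse Q * C' \<in> carrier_mat r m" by (rule mult_carrier_mat[OF QI(1) C'])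
  have X1: "X1 \<in> carrier_mat r m" using QC by (simp add: X1_def)
  have QX1: "Q * X1 = w \<cdot>\<^sub>m C'"
    unfolding X1_def mult_smult_distrib[OF Q QC] assoc_mult_mat[OF Q QI(1) C', symmetric] QI(2)
      left_mult_one_mat[OF C'] ..
  have X: "X1 @\<^sub>r Y \<in> carrier_mat (r + r) m" by (rule carrier_append_rows[OF X1 Y(1)])
  have AX: "rmat_poly sysA * (X1 @\<^sub>r Y) = rmat_poly sysB"
    unfolding rA rB antidiagonal_mult_append_rows[OF P Q X1 Y(1)] QX1 Y(2)[folded P_def] ..
  have "rmat_poly sysC * rmat_inverse (rmat_poly sysA) * rmat_poly sysB = rmat_poly sysC * (X1 @\<^sub>r Y)"
    unfolding assoc_mult_mat[OF cC rmat_inverse(1)[OF cA dA] cB] rmat_inverse_mult[OF cA dA X AX] ..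
  also have "\<dots> = B' * X1 + (w \<cdot>\<^sub>m rmat_const C) * Y"
    unfolding rC by (rule append_cols_mult_append_rows[OF B' _ X1 Y(1)]) (use Cc in simp)
  also have "B' * X1 = w \<cdot>\<^sub>m rmat_recip (rmat_star (rmat_const C * Y))"
    unfolding X1_def mult_smult_distrib[OF B' QC] dual_realization[OF E F B C Y d]
      B'_def[symmetric] C'_def[symmetric] Q_def[symmetric] assoc_mult_mat[OF B' QI(1) C'] ..
  also have "(w \<cdot>\<^sub>m rmat_const C) * Y = w \<cdot>\<^sub>m (rmat_const C * Y)"
    by (rule mult_smult_assoc_mat[OF Cc Y(1)])
  finally have CAB: "rmat_poly sysC * rmat_inverse (rmat_poly sysA) * rmat_poly sysB =
      w \<cdot>\<^sub>m rmat_recip (rmat_star (rmat_const C * Y)) + w \<cdot>\<^sub>m (rmat_const C * Y)" .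
  have sum: "w \<cdot>\<^sub>m c + (w \<cdot>\<^sub>m b + w \<cdot>\<^sub>m a) = w \<cdot>\<^sub>m (a + b + c)"
    if "a \<in> carrier_mat m m" "b \<in> carrier_mat m m" "c \<in> carrier_mat m m" for a b c :: "ratfun mat"
    using that by (intro eq_matI) (simp_all add: algebra_simps)
  have CY: "rmat_const C * Y \<in> carrier_mat m m" by (rule mult_carrier_mat[OF Cc Y(1)])
  show ?thesis
    unfolding transfer_function_def CAB rmat_poly_smult_const w w_def[symmetric]
    by (rule sum[OF CY rmat_recip_carrier[OF rmat_star_carrier[OF CY]]]) (use R0 in simp)
qed

text \<open>\<open>revstar\<close> maps the two pencil blocks to each other and also exchanges their
  places, which fixes the corner. It exchanges input and output: the weights \<open>1\<close> and
  \<open>z\<close> are swapped and \<open>1 + z\<close> is kept. The last block is fixed because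
  \<open>R0\<close> is Hermitian.\<close>

lemma palindromic:
  assumes R0: "R0 \<in> carrier_mat m m" "mat_adjoint R0 = R0"
  shows "star_palindromic (four_block_mat (- sysA) sysB sysC ([:1, 1:] \<cdot>\<^sub>m pmat_const R0))"
proof -
  have nA: "- sysA = four_block_mat (0\<^sub>m r r) (- lin_pencil E F) (- dual_pencil E F) (0\<^sub>m r r)"
    unfolding sysA_def using part_carriers(1,2) by (intro eq_matI) simp_all
  have n: "- lin_pencil E F \<in> carrier_mat r r" "- dual_pencil E F \<in> carrier_mat r r"
    using part_carriers by simp_all
  have cnA: "- sysA \<in> carrier_mat (r + r) (r + r)" using sys_carriers(1) by simp
  have D: "[:1, 1:] \<cdot>\<^sub>m pmat_const R0 \<in> carrier_mat m m" using R0 by simp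
  have "is_pencil (- lin_pencil E F)" "is_pencil (- dual_pencil E F)"
    by (rule is_pencilI; use E F in \<open>simp add: lin_pencil_def dual_pencil_def\<close>)+
  then have pA: "is_pencil (- sysA)"
    unfolding nA by (intro is_pencil_four_block[OF zero_carrier_mat n zero_carrier_mat] is_pencil_zero)
  have p: "is_pencil sysB" "is_pencil sysC" using linear_system[OF R0(1)] by (simp_all add: linear_system_matrix_def)
  have 0: "revstar (0\<^sub>m r r) = 0\<^sub>m r r" by (intro eq_matI) (simp_all add: revstar_def)
  have 1: "revstar (- lin_pencil E F) = - dual_pencil E F" "revstar (- dual_pencil E F) = - lin_pencil E F"
    using E F by (intro eq_matI; simp add: revstar_def lin_pencil_def dual_pencil_def)+
  have 2: "revstar (pmat_const B) = [:0, 1:] \<cdot>\<^sub>m pmat_const (mat_adjoint B)"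
    "revstar ([:0, 1:] \<cdot>\<^sub>m pmat_const (mat_adjoint B)) = pmat_const B"
    "revstar ([:1, 1:] \<cdot>\<^sub>m pmat_const (mat_adjoint C)) = [:1, 1:] \<cdot>\<^sub>m pmat_const C"
    "revstar ([:1, 1:] \<cdot>\<^sub>m pmat_const C) = [:1, 1:] \<cdot>\<^sub>m pmat_const (mat_adjoint C)"
    "revstar ([:1, 1:] \<cdot>\<^sub>m pmat_const R0) = [:1, 1:] \<cdot>\<^sub>m pmat_const (mat_adjoint R0)"
    by (intro eq_matI; simp add: revstar_def)+
  have rA: "revstar (- sysA) = - sysA"
    unfolding nA revstar_four_block[OF zero_carrier_mat n zero_carrier_mat] 0 1 ..
  have rB: "revstar sysB = sysC"
    unfolding sysB_def sysC_def revstar_append_rows[OF part_carriers(3,4)] 2 ..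
  have rC: "revstar sysC = sysB"
    unfolding sysB_def sysC_def revstar_append_cols[OF part_carriers(5,6)] 2 ..
  show ?thesis
  proof (rule star_palindromicI)
    show "four_block_mat (- sysA) sysB sysC ([:1, 1:] \<cdot>\<^sub>m pmat_const R0) \<in> carrier_mat ((r + r) + m) ((r + r) + m)"
      by (rule four_block_carrier_mat[OF cnA D])
    show "is_pencil (four_block_mat (- sysA) sysB sysC ([:1, 1:] \<cdot>\<^sub>m pmat_const R0))"
      by (rule is_pencil_four_block[OF cnA sys_carriers(2,3) D pA p is_pencil_smult_const])
    show "revstar (four_block_mat (- sysA) sysB sysC ([:1, 1:] \<cdot>\<^sub>m pmat_const R0)) =
        four_block_mat (- sysA) sysB sysC ([:1, 1:] \<cdot>\<^sub>m pmat_const R0)"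
      unfolding revstar_four_block[OF cnA sys_carriers(2,3) D] rA rB rC 2 R0(2) ..
  qed
qed

end

lemma det_nonzero_if_invertible:
  fixes A :: "complex mat"
  assumes A: "A \<in> carrier_mat n n" and "invertible_mat A"
  shows "det A \<noteq> 0"
proof -
  from assms obtain B where B: "A * B = 1\<^sub>m n" "B * A = 1\<^sub>m (dim_row B)"
    unfolding invertible_mat_def inverts_mat_def carrier_matD[OF A] by (elim conjE exE)
  \<comment> \<open>\<open>invertible_mat\<close> leaves the size of the inverse open; it is read
    off from the two products.\<close>
  have "dim_col B = n" using arg_cong[OF B(1), of dim_col] by simp
  moreover have "dim_row B = n" using arg_cong[OF B(2), of dim_col] A by simp
  ultimately have "B \<in> carrier_mat n n" by (intro carrier_matI)
  then show ?thesis by (rule det_nonzero_if_right_inverse[OF A _ B(1)])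
qed

text \<open>Taking adjoints of the compression identity exchanges \<open>U\<close> and
  \<open>V\<close>, after which \<open>unitary_compression\<close> applies.\<close>

lemma unitary_compression_adjoint:
  fixes H :: "complex mat"
  assumes U: "U1 \<in> carrier_mat n r" "U2 \<in> carrier_mat n s"
    and V: "V1 \<in> carrier_mat n r" "V2 \<in> carrier_mat n s" "unitary_mat (V1 @\<^sub>c V2)"
    and H: "H \<in> carrier_mat n n" and D: "D \<in> carrier_mat r r"
    and comp: "mat_adjoint (U1 @\<^sub>c U2) * H * (V1 @\<^sub>c V2) =
      four_block_mat D (0\<^sub>m r s) (0\<^sub>m s r) (0\<^sub>m s s)"
  shows "mat_adjoint U1 * H = D * mat_adjoint V1"
proof -
  let ?U = "U1 @\<^sub>c U2" and ?V = "V1 @\<^sub>c V2"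
  have cU: "?U \<in> carrier_mat n (r + s)" and cV: "?V \<in> carrier_mat n (r + s)"
    using append_cols_carrier U V by blast+
  have Ua: "mat_adjoint ?U \<in> carrier_mat (r + s) n" and Va: "mat_adjoint ?V \<in> carrier_mat (r + s) n"
    and Ha: "mat_adjoint H \<in> carrier_mat n n" and Da: "mat_adjoint D \<in> carrier_mat r r"
    using cU cV H D by simp_all
  have "mat_adjoint (mat_adjoint ?U * H * ?V) = mat_adjoint ?V * (mat_adjoint H * ?U)"
    unfolding adjoint_mult[OF mult_carrier_mat[OF Ua H] cV] adjoint_mult[OF Ua H] adjoint_adjoint ..
  also have "\<dots> = mat_adjoint ?V * mat_adjoint H * ?U"
    by (rule assoc_mult_mat[OF Va Ha cU, symmetric])
  finally have "mat_adjoint ?V * mat_adjoint H * ?U =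
      mat_adjoint (four_block_mat D (0\<^sub>m r s) (0\<^sub>m s r) (0\<^sub>m s s))"
    unfolding comp by (rule sym)
  also have "\<dots> = four_block_mat (mat_adjoint D) (0\<^sub>m r s) (0\<^sub>m s r) (0\<^sub>m s s)"
    using D by (intro eq_matI) simp_all
  finally have "mat_adjoint H * U1 = V1 * mat_adjoint D"
    by (rule unitary_compression[OF V U Ha Da])
  then have "mat_adjoint (mat_adjoint H * U1) = mat_adjoint (V1 * mat_adjoint D)" by simp
  then show ?thesis
    unfolding adjoint_mult[OF Ha U(1)] adjoint_mult[OF V(1) Da] adjoint_adjoint .
qed

theorem theorem6p2:
  fixes R Rin Rout :: "ratfun mat"
    and R0 H Hs U1 U2 V1 V2 U11 V11 Hh :: "complex mat"
    and c :: "nat \<Rightarrow> complex mat"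
    and m k rf :: nat
    and z :: "complex poly"
    and L L11 L12 L21 L22 :: "complex poly mat"
  assumes R: "R \<in> carrier_mat m m" "para_hermitian R" "\<And>x. cmod x = 1 \<Longrightarrow> \<not> has_pole R x"
    and decomposition:
      "Rin \<in> carrier_mat m m" "Rout \<in> carrier_mat m m" "R0 \<in> carrier_mat m m"
      "R = Rin + Rout + rmat_const R0"
    and Rin: "strictly_proper Rin" "\<And>x. has_pole Rin x \<Longrightarrow> cmod x < 1"
    and Rout: "rmat_eval Rout 0 = 0\<^sub>m m m" "\<And>x. has_pole Rout x \<Longrightarrow> cmod x > 1"
    and expansion: "expansion_at_infinity Rin c"
    and H: "H = block_hankel m k 0 c" and Hs: "Hs = block_hankel m k 1 c"
    and k: "k \<ge> 1" and rf: "rf = mat_rank H" "has_total_polar_degree Rin rf"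
    and U_V_dims:
      "U1 \<in> carrier_mat (k * m) rf" "U2 \<in> carrier_mat (k * m) (k * m - rf)"
      "V1 \<in> carrier_mat (k * m) rf" "V2 \<in> carrier_mat (k * m) (k * m - rf)"
    and U_V_unitary: "unitary_mat (U1 @\<^sub>c U2)" "unitary_mat (V1 @\<^sub>c V2)"
    and Hh: "Hh = mat_adjoint U1 * H * V1" "invertible_mat Hh"
    and compression:
      "mat_adjoint (U1 @\<^sub>c U2) * H * (V1 @\<^sub>c V2) =
         four_block_mat Hh (0\<^sub>m rf (k * m - rf))
           (0\<^sub>m (k * m - rf) rf) (0\<^sub>m (k * m - rf) (k * m - rf))"
    and U11: "U11 = first_rows m U1" and V11: "V11 = first_rows m V1"
    and z: "z = [:0, 1:]"
    and L11: "L11 = four_block_mat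
        (0\<^sub>m rf rf)
        (pmat_const (mat_adjoint U1 * Hs * V1) - z \<cdot>\<^sub>m pmat_const Hh)
        (z \<cdot>\<^sub>m pmat_const (mat_adjoint V1 * mat_adjoint Hs * U1) - pmat_const (mat_adjoint Hh))
        (0\<^sub>m rf rf)"
    and L12: "L12 = pmat_const (Hh * mat_adjoint V11) @\<^sub>r
        ((1 + z) \<cdot>\<^sub>m pmat_const (mat_adjoint Hh * mat_adjoint U11))"
    and L21: "L21 = (z \<cdot>\<^sub>m pmat_const (V11 * mat_adjoint Hh)) @\<^sub>c
        ((1 + z) \<cdot>\<^sub>m pmat_const (U11 * Hh))"
    and L22: "L22 = (1 + z) \<cdot>\<^sub>m pmat_const R0"
    and L: "L = four_block_mat L11 L12 L21 L22"
  shows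
    "minimal_gss_realization
       (z \<cdot>\<^sub>m pmat_const Hh - pmat_const (mat_adjoint U1 * Hs * V1))
       (pmat_const (Hh * mat_adjoint V11))
       (pmat_const (U11 * Hh))
       Rin \<and>
     minimal_gss_realization
       (pmat_const (mat_adjoint Hh) - z \<cdot>\<^sub>m pmat_const (mat_adjoint V1 * mat_adjoint Hs * U1))
       (pmat_const (mat_adjoint Hh * mat_adjoint U11))
       (z \<cdot>\<^sub>m pmat_const (V11 * mat_adjoint Hh))
       Rout \<and>
     linear_system_matrix L (- L11) L12 L21 L22 \<and>
     strongly_minimal_system (- L11) L12 L21 \<and>
     star_palindromic L \<and>
     transfer_function (- L11) L12 L21 L22 = (1 + rat_z) \<cdot>\<^sub>m R"
proof -
  define F where "F = mat_adjoint U1 * Hs * V1"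
  define Bc where "Bc = Hh * mat_adjoint V11"
  define Cc where "Cc = U11 * Hh"
  have cH: "H \<in> carrier_mat (k * m) (k * m)" "Hs \<in> carrier_mat (k * m) (k * m)"
    by (simp_all add: H Hs block_hankel_def)
  have Ua: "mat_adjoint U1 \<in> carrier_mat rf (k * m)" and Va: "mat_adjoint V1 \<in> carrier_mat rf (k * m)"
    using U_V_dims by simp_all
  have cE: "Hh \<in> carrier_mat rf rf"
    unfolding Hh(1) by (rule mult_carrier_mat[OF mult_carrier_mat[OF Ua cH(1)] U_V_dims(3)])
  have cF: "F \<in> carrier_mat rf rf"
    unfolding F_def by (rule mult_carrier_mat[OF mult_carrier_mat[OF Ua cH(2)] U_V_dims(3)])
  have c11: "U11 \<in> carrier_mat m rf" "mat_adjoint V11 \<in> carrier_mat rf m"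
    unfolding U11 V11 using U_V_dims by simp_all
  have cB: "Bc \<in> carrier_mat rf m" unfolding Bc_def by (rule mult_carrier_mat[OF cE c11(2)])
  have cC: "Cc \<in> carrier_mat m rf" unfolding Cc_def by (rule mult_carrier_mat[OF c11(1) cE])
  have dE: "det Hh \<noteq> 0" by (rule det_nonzero_if_invertible[OF cE Hh(2)])
  have HV: "H * V1 = U1 * Hh"
    by (rule unitary_compression[OF U_V_dims(1,2) U_V_unitary(1) U_V_dims(3,4) cH(1) cE compression])
  have UH: "mat_adjoint U1 * H = Hh * mat_adjoint V1"
    by (rule unitary_compression_adjoint[OF U_V_dims(1,2) U_V_dims(3,4) U_V_unitary(2) cH(1) cE compression])
  obtain Y where Y: "Y \<in> carrier_mat rf m" "rmat_poly (lin_pencil Hh F) * Y = rmat_const Bc"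
    and RinY: "Rin = rmat_const Cc * Y"
    and obs: "\<forall>x v. v \<in> carrier_vec rf \<longrightarrow> (x \<cdot>\<^sub>m Hh - F) *\<^sub>v v = 0\<^sub>v rf \<longrightarrow> Cc *\<^sub>v v = 0\<^sub>v m \<longrightarrow> v = 0\<^sub>v rf"
    and ctrl: "\<forall>x v. v \<in> carrier_vec rf \<longrightarrow> (x \<cdot>\<^sub>m Hh - F)\<^sup>T *\<^sub>v v = 0\<^sub>v rf \<longrightarrow>
       Bc\<^sup>T *\<^sub>v v = 0\<^sub>v m \<longrightarrow> v = 0\<^sub>v rf"
    and eig: "\<forall>x. mat_regular_at x Rin \<longrightarrow> det (x \<cdot>\<^sub>m Hh - F) \<noteq> 0"
    by (rule hankel_realization[OF decomposition(1) Rin(1) rf(2) expansion k U_V_dims(1,3)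
          HV[unfolded H] UH[unfolded H] cE Hh(1)[unfolded H] dE F_def[unfolded Hs] Bc_def[unfolded V11] Cc_def[unfolded U11]])
  \<comment> \<open>All poles of \<open>Rin\<close> lie in the open disk, and at regular points of
    \<open>Rin\<close> the pencil has no eigenvalue.\<close>
  have stab: "det (x \<cdot>\<^sub>m Hh - F) \<noteq> 0" if "cmod x \<ge> 1" for x
  proof (rule eig[rule_format])
    have "\<not> has_pole Rin x" using Rin(2)[of x] that by auto
    then show "mat_regular_at x Rin" unfolding has_pole_iff mat_regular_at_def by blast
  qed
  interpret stable_minimal_system rf m Hh F Bc Cc
    by (rule stable_minimal_system.intro[OF cE cF cB cC dE obs[rule_format] ctrl[rule_format] stab])
  have parts: "Rout = rmat_recip (rmat_star Rin)" "mat_adjoint R0 = R0"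
    by (rule para_hermitian_parts(1)[OF R(2) decomposition Rin Rout]; assumption)
      (rule para_hermitian_parts(2)[OF R(2) decomposition Rin Rout]; assumption)
  have F': "mat_adjoint V1 * mat_adjoint Hs * U1 = mat_adjoint F"
  proof -
    have Hsa: "mat_adjoint Hs \<in> carrier_mat (k * m) (k * m)" using cH by simp
    show ?thesis
      unfolding F_def adjoint_mult[OF mult_carrier_mat[OF Ua cH(2)] U_V_dims(3)] adjoint_mult[OF Ua cH(2)] adjoint_adjoint
      by (rule assoc_mult_mat[OF Va Hsa U_V_dims(1)])
  qed
  have B': "V11 * mat_adjoint Hh = mat_adjoint Bc"
    unfolding Bc_def adjoint_mult[OF cE c11(2)] adjoint_adjoint ..
  have C': "mat_adjoint Hh * mat_adjoint U11 = mat_adjoint Cc"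
    unfolding Cc_def by (rule adjoint_mult[OF c11(1) cE, symmetric])
  have z1: "1 + z = [:1, 1:]" unfolding z by (simp add: one_pCons)
  have A: "z \<cdot>\<^sub>m pmat_const Hh - pmat_const F = lin_pencil Hh F"
    unfolding z lin_pencil_def ..
  have Ad: "pmat_const (mat_adjoint Hh) - z \<cdot>\<^sub>m pmat_const (mat_adjoint F) = dual_pencil Hh F"
    unfolding z dual_pencil_def ..
  have L11': "- L11 = sysA"
    unfolding L11 F' F_def[symmetric] sysA_def lin_pencil_def dual_pencil_def z
    using cE cF by (intro eq_matI) simp_all
  have L11n: "L11 = - sysA" unfolding L11'[symmetric] by simp
  have L12': "L12 = sysB" unfolding L12 sysB_def C' Bc_def[symmetric] z1 ..
  have L21': "L21 = sysC" unfolding L21 sysC_def B' Cc_def[symmetric] z1 unfolding z ..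
  have L22': "L22 = [:1, 1:] \<cdot>\<^sub>m pmat_const R0" unfolding L22 z1 ..
  have L': "L = four_block_mat (- sysA) sysB sysC ([:1, 1:] \<cdot>\<^sub>m pmat_const R0)"
    unfolding L L11n L12' L21' L22' ..
  have in_real: "minimal_gss_realization (lin_pencil Hh F) (pmat_const Bc) (pmat_const Cc) Rin"
    by (rule in_realization[OF Y RinY])
  have out_real: "minimal_gss_realization (dual_pencil Hh F) (pmat_const (mat_adjoint Cc))
      (z \<cdot>\<^sub>m pmat_const (mat_adjoint Bc)) Rout"
    unfolding z by (rule out_realization[OF Y parts(1)[unfolded RinY]])
  have tf: "transfer_function sysA sysB sysC ([:1, 1:] \<cdot>\<^sub>m pmat_const R0) = (1 + rat_z) \<cdot>\<^sub>m R"
    unfolding transfer[OF Y decomposition(3)] RinY[symmetric] parts(1)[symmetric] decomposition(4) ..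
  show ?thesis
    unfolding L11' L12' L21' L22' L' F' B' C' F_def[symmetric] Bc_def[symmetric] Cc_def[symmetric] A Ad
    by (intro conjI in_real out_real linear_system strongly_minimal palindromic tf decomposition(3) parts(2))
qed

end
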